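(* Let $\ell$ and $p$ be odd primes, put $n=(\ell-1)/2$, and let $h_\ell^+$ be the class number of the maximal real subfield of $k=\mathbb{Q}(e^{2\pi i/\ell})$. Suppose $p\nmid \ell\,h_\ell^+\,n$. With the notation of the context, $K_\mu=k_{\mu+1}$ holds for all integers $\mu\ge 1$ if and only if $\dim_{\mathbb{Z}/p\mathbb{Z}}(H_1/S_2)=n-1$ and $p\nmid\det(N_\ell)$.
   Context: Let $\ell,p$ be odd primes, $\zeta=e^{2\pi i/\ell}$, $k=\mathbb{Q}(\zeta)$, $n=(\ell-1)/2$ (so $[k:\mathbb{Q}]=2n$), $\mathcal{O}_k=\mathbb{Z}[\zeta]$, $E=\mathcal{O}_k^\times$. For an integer $\mu\ge1$ let $S_\mu=\{a\in k^\times \mid a\equiv 1 \pmod{2p^\mu}\}$ (multiplicative congruence: $a$ is integral and congruent to $1$ modulo $2p^\mu$ at every prime of $k$ dividing $2p$), let $H_\mu=S_{\mu+1}(S_\mu\cap E)$, and let $k_\mu$ be the ray class field of $k$ modulo $2p^\mu$. The group $S_\mu/S_{\mu+1}$ is isomorphic to $\mathcal{O}_k/p\mathcal{O}_k$ via $(1+2p^\mu\omega)S_{\mu+1}\mapsto\omega+p\mathcal{O}_k$, so it and its subgroup $H_\mu/S_{\mu+1}$ are $\mathbb{Z}/p\mathbb{Z}$-vector spaces. By class field theory $S_\mu/H_\mu\cong \mathrm{Gal}(k_{\mu+1}/k_\mu)$ via $\omega H_\mu\mapsto \left(\frac{k_{\mu+1}/k}{(\omega)}\right)$ (Artin symbol).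 For $1\le i\le 2n$ let $\varphi_i\in\mathrm{Gal}(k/\mathbb{Q})$ be given by $\zeta^{\varphi_i}=\zeta^i$. Define $\varphi^*:k^\times\to k^\times$ by $\varphi^*(a)=\prod_{i=1}^n a^{\varphi_i^{-1}}$. Since $\varphi^*(H_\mu)\subset H_\mu$, $\varphi^*$ induces an endomorphism $\widetilde{\varphi^*_\mu}$ of $S_\mu/H_\mu$. The field $K_\mu$ is the class field of $k$ corresponding to $\ker(\widetilde{\varphi^*_\mu})$, i.e. the subfield of $k_{\mu+1}$ fixed by all $\left(\frac{k_{\mu+1}/k}{(\omega)}\right)$ with $\omega\in S_\mu$, $\omega H_\mu\in\ker(\widetilde{\varphi^*_\mu})$; thus $k_\mu\subset K_\mu\subset k_{\mu+1}$. $N_\ell=[n_{ij}]_{1\le i,j\le n}\in M_n(\mathbb{Z})$, where $n_{ij}=1$ if $\overline{i}\cdot\overline{j}\in\{\overline1,\dots,\overline n\}$ in $\mathbb{Z}/\ell\mathbb{Z}$ and $n_{ij}=0$ otherwise. *)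

theory Defs
  imports
    "HOL-Algebra.Algebra"
    "HOL-Algebra.Algebraic_Closure_Type"
    "HOL-Number_Theory.Residues"
    "Jordan_Normal_Form.Missing_VectorSpace"
    "Jordan_Normal_Form.Determinant"
begin

section \<open>Number fields inside the complex numbers\<close>

abbreviation CC :: "complex ring"
  where "CC \<equiv> ring_of_type_algebra"

definition field_units :: "complex set \<Rightarrow> complex monoid"
  where "field_units F = Multiplicative_Group.mult_of (CC\<lparr>carrier := F\<rparr>)"

definition int_ring :: "complex set \<Rightarrow> complex ring"
  where "int_ring F = CC\<lparr>carrier := {x \<in> F. algebraic_int x}\<rparr>"

definition gal :: "complex set \<Rightarrow> complex set \<Rightarrow> (complex \<Rightarrow> complex) monoid"
  where "gal F L = (BijGroup L)
    \<lparr>carrier := {\<sigma> \<in> Bij L. \<sigma> \<in> Ring.ring_hom (CC\<lparr>carrier := L\<rparr>) (CC\<lparr>carrier := L\<rparr>)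
                            \<and> (\<forall>x\<in>F. \<sigma> x = x)}\<rparr>"

definition galois_extension :: "complex set \<Rightarrow> complex set \<Rightarrow> bool"
  where "galois_extension F L \<longleftrightarrow>
    Subrings.subfield F CC \<and> Subrings.subfield L CC \<and> F \<subseteq> L \<and> ring.finite_dimension CC F L \<and>
    {x \<in> L. \<forall>\<sigma>\<in>carrier (gal F L). \<sigma> x = x} = F"

definition abelian_extension :: "complex set \<Rightarrow> complex set \<Rightarrow> bool"
  where "abelian_extension F L \<longleftrightarrow> galois_extension F L \<and> comm_group (gal F L)"


section \<open>Fractional ideals and class number\<close>

text \<open>
  For additive subgroups \<open>I\<close>, \<open>J\<close> of the complex numbers, \<open>ideal_prod CC I J\<close> is the subgroup
  generated by all products, so it is the product of fractional ideals as well.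
\<close>

definition fractional_ideals :: "complex set \<Rightarrow> complex set monoid"
  where "fractional_ideals F =
    \<lparr>carrier = {J. J \<noteq> {0} \<and>
       (\<exists>d \<in> carrier (int_ring F) - {0}. ideal ((*) d ` J) (int_ring F))},
     monoid.mult = ideal_prod CC,
     monoid.one = carrier (int_ring F)\<rparr>"

definition principal_ideal :: "complex set \<Rightarrow> complex \<Rightarrow> complex set"
  where "principal_ideal F a = (*) a ` carrier (int_ring F)"

definition class_number :: "complex set \<Rightarrow> nat"
  where "class_number F =
    Coset.order (fractional_ideals F Mod (principal_ideal F ` carrier (field_units F)))"


section \<open>Primes, localisation and ramification\<close>

definition primes_of :: "complex set \<Rightarrow> complex set set"
  where "primes_of F = {P. primeideal P (int_ring F) \<and> P \<noteq> {0}}"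

definition localisation :: "complex set \<Rightarrow> complex set \<Rightarrow> complex set"
  where "localisation F P =
    {x / y | x y. x \<in> carrier (int_ring F) \<and> y \<in> carrier (int_ring F) - P}"

text \<open>
  The order of a fractional ideal \<open>I\<close> at \<open>P\<close> is the largest integer \<open>e\<close> with
  \<open>I \<subseteq> P\<^sup>e O\<^sub>P\<close>, where \<open>O\<^sub>P\<close> is the local ring at \<open>P\<close>; without localising, denominators of \<open>I\<close> at
  other primes would interfere. Negative powers are inverses in the monoid of fractional ideals.
\<close>

definition ideal_order :: "complex set \<Rightarrow> complex set \<Rightarrow> complex set \<Rightarrow> int"
  where "ideal_order F P I =
    (GREATEST e::int. I \<subseteq> ideal_prod CC (P [^]\<^bsub>fractional_ideals F\<^esub> e) (localisation F P))"

definition unramified :: "complex set \<Rightarrow> complex set \<Rightarrow> complex set \<Rightarrow> bool"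
  where "unramified F L P \<longleftrightarrow>
    (\<forall>Q\<in>primes_of L. P \<subseteq> Q \<longrightarrow> ideal_order L Q (ideal_prod CC P (carrier (int_ring L))) = 1)"


section \<open>Artin symbol and ray class fields\<close>

text \<open>
  The Frobenius element is meant for abelian \<open>L\<close> over \<open>F\<close> and unramified \<open>P\<close>, where it does not
  depend on the prime of \<open>L\<close> above \<open>P\<close>.
\<close>

definition frobenius :: "complex set \<Rightarrow> complex set \<Rightarrow> complex set \<Rightarrow> complex \<Rightarrow> complex"
  where "frobenius F L P =
    (THE \<sigma>. \<sigma> \<in> carrier (gal F L) \<and>
       (\<forall>Q\<in>primes_of L. P \<subseteq> Q \<longrightarrow>
          (\<forall>x\<in>carrier (int_ring L). \<sigma> x - x ^ Coset.order (int_ring F Quot P) \<in> Q)))"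

definition artin :: "complex set \<Rightarrow> complex set \<Rightarrow> complex set \<Rightarrow> complex \<Rightarrow> complex"
  where "artin F L I =
    finprod (gal F L) (\<lambda>P. frobenius F L P [^]\<^bsub>gal F L\<^esub> ideal_order F P I)
      {P \<in> primes_of F. ideal_order F P I \<noteq> 0}"

definition ideals_prime_to :: "complex set \<Rightarrow> nat \<Rightarrow> complex set set"
  where "ideals_prime_to F m =
    {I \<in> carrier (fractional_ideals F).
       \<forall>P\<in>primes_of F. of_nat m \<in> P \<longrightarrow> ideal_order F P I = 0}"

text \<open>Multiplicative congruence \<open>a \<equiv> 1\<close> modulo the ideal generated by \<open>m\<close>.\<close>

definition ray_cong :: "complex set \<Rightarrow> nat \<Rightarrow> complex \<Rightarrow> bool"
  where "ray_cong F m a \<longleftrightarrow>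
    (\<forall>P\<in>primes_of F. of_nat m \<in> P \<longrightarrow>
       a \<in> localisation F P \<and> (a - 1) / of_nat m \<in> localisation F P)"

text \<open>
  \<open>L\<close> is the ray class field of \<open>F\<close> modulo \<open>m\<close> (no infinite places in the modulus): the abelian
  extension, unramified outside \<open>m\<close>, whose Artin map identifies the ray class group modulo \<open>m\<close> with
  the Galois group. Existence, and uniqueness inside the complex numbers, are theorems of class
  field theory.
\<close>

definition ray_class_field :: "complex set \<Rightarrow> nat \<Rightarrow> complex set \<Rightarrow> bool"
  where "ray_class_field F m L \<longleftrightarrow>
    abelian_extension F L \<and>
    (\<forall>P\<in>primes_of F. of_nat m \<notin> P \<longrightarrow> unramified F L P) \<and>
    artin F L ` ideals_prime_to F m = carrier (gal F L) \<and>
    {I \<in> ideals_prime_to F m. artin F L I = \<one>\<^bsub>gal F L\<^esub>} =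
      principal_ideal F ` {a \<in> carrier (field_units F). ray_cong F m a}"


section \<open>The cyclotomic setting\<close>

definition zeta :: "nat \<Rightarrow> complex"
  where "zeta l = exp (2 * of_real pi * \<i> / of_nat l)"

definition cyclotomic :: "nat \<Rightarrow> complex set"
  where "cyclotomic l = generate_field CC {zeta l}"

abbreviation half :: "nat \<Rightarrow> nat"
  where "half l \<equiv> (l - 1) div 2"

definition h_plus :: "nat \<Rightarrow> nat"
  where "h_plus l = class_number (cyclotomic l \<inter> \<real>)"

definition S_ray :: "nat \<Rightarrow> nat \<Rightarrow> nat \<Rightarrow> complex set"
  where "S_ray l p \<mu> =
    {a \<in> carrier (field_units (cyclotomic l)). ray_cong (cyclotomic l) (2 * p ^ \<mu>) a}"

definition H_ray :: "nat \<Rightarrow> nat \<Rightarrow> nat \<Rightarrow> complex set"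
  where "H_ray l p \<mu> =
    S_ray l p (\<mu> + 1) <#>\<^bsub>field_units (cyclotomic l)\<^esub>
      (S_ray l p \<mu> \<inter> Units (int_ring (cyclotomic l)))"

abbreviation S_mod_H :: "nat \<Rightarrow> nat \<Rightarrow> nat \<Rightarrow> complex set monoid"
  where "S_mod_H l p \<mu> \<equiv> (field_units (cyclotomic l))\<lparr>carrier := S_ray l p \<mu>\<rparr> Mod H_ray l p \<mu>"

abbreviation H_mod_S :: "nat \<Rightarrow> nat \<Rightarrow> nat \<Rightarrow> complex set monoid"
  where "H_mod_S l p \<mu> \<equiv>
    (field_units (cyclotomic l))\<lparr>carrier := H_ray l p \<mu>\<rparr> Mod S_ray l p (\<mu> + 1)"

text \<open>
  A multiplicatively written abelian group of exponent \<open>p\<close> as a vector space over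
  \<^term>\<open>residue_ring (int p)\<close>: scalars act as exponents. The multiplicative fields of the record
  play no role in a module.
\<close>

definition exponent_module :: "('a, 'b) monoid_scheme \<Rightarrow> (int, 'a) module"
  where "exponent_module G =
    \<lparr>carrier = carrier G, monoid.mult = undefined, monoid.one = undefined,
     ring.zero = \<one>\<^bsub>G\<^esub>, add = monoid.mult G, module.smult = (\<lambda>c x. x [^]\<^bsub>G\<^esub> c)\<rparr>"

definition dim_mod :: "nat \<Rightarrow> ('a, 'b) monoid_scheme \<Rightarrow> nat"
  where "dim_mod p G = vectorspace.dim (residue_ring (int p)) (exponent_module G)"

definition phi :: "nat \<Rightarrow> nat \<Rightarrow> complex \<Rightarrow> complex"
  where "phi l i = (THE \<sigma>. \<sigma> \<in> carrier (gal \<rat> (cyclotomic l)) \<and> \<sigma> (zeta l) = zeta l ^ i)"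

definition phi_star :: "nat \<Rightarrow> complex \<Rightarrow> complex"
  where "phi_star l a = (\<Prod>i = 1..half l. (inv\<^bsub>gal \<rat> (cyclotomic l)\<^esub> (phi l i)) a)"

definition phi_tilde :: "nat \<Rightarrow> nat \<Rightarrow> nat \<Rightarrow> complex set \<Rightarrow> complex set"
  where "phi_tilde l p \<mu> C =
    the_elem ((\<lambda>a. H_ray l p \<mu> #>\<^bsub>field_units (cyclotomic l)\<^esub> phi_star l a) ` C)"

text \<open>
  The field \<open>K\<^sub>\<mu>\<close>, as a subfield of a given ray class field \<open>L\<close> modulo \<open>2p\<^bsup>\<mu>+1\<^esup>\<close>.
\<close>

definition K_field :: "nat \<Rightarrow> nat \<Rightarrow> nat \<Rightarrow> complex set \<Rightarrow> complex set"
  where "K_field l p \<mu> L =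
    {x \<in> L. \<forall>\<omega>\<in>S_ray l p \<mu>.
       H_ray l p \<mu> #>\<^bsub>field_units (cyclotomic l)\<^esub> \<omega>
           \<in> kernel (S_mod_H l p \<mu>) (S_mod_H l p \<mu>) (phi_tilde l p \<mu>) \<longrightarrow>
       artin (cyclotomic l) L (principal_ideal (cyclotomic l) \<omega>) x = x}"

text \<open>Matrix indices start at 0, hence the shift.\<close>

definition N_mat :: "nat \<Rightarrow> int mat"
  where "N_mat l = mat (half l) (half l)
    (\<lambda>(i, j). if ((i + 1) * (j + 1)) mod l \<in> {1..half l} then 1 else 0)"

end

theory Submission
  imports Defs "Jordan_Normal_Form.Char_Poly" "HOL-Analysis.Complex_Transcendental"
begin

text \<open>
  Let \<open>A\<close> be the ring of integers of \<open>k\<close>. Writing an element of \<open>S\<^sub>\<mu>\<close> as \<open>1 + 2p\<^sup>\<mu>x\<close> modulo \<open>S\<^bsub>\<mu>+1\<^esub>\<close>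
  turns \<open>\<phi>\<^sup>*\<close> into \<open>T = \<Sum>\<^sub>i \<phi>\<^sub>i\<^bsup>-1\<^esup>\<close> on \<open>A/pA\<close> and \<open>H\<^sub>\<mu>/S\<^bsub>\<mu>+1\<^esub>\<close> into a subspace \<open>W\<^sub>\<mu>\<close>. The defining
  property of the ray class field says that \<open>K\<^sub>\<mu> = k\<^bsub>\<mu>+1\<^esub>\<close> holds iff \<open>T\<close> is injective modulo \<open>W\<^sub>\<mu>\<close>.

  Units congruent to 1 are real and have norm 1, so \<open>W\<^sub>\<mu>\<close> lies in the space \<open>V\<^sub>0\<close> of real elements of
  trace 0, which has dimension \<open>n - 1\<close>; raising units to the \<open>p\<close>-th power gives \<open>W\<^sub>\<mu> \<subseteq> W\<^bsub>\<mu>+1\<^esub>\<close>. As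
  \<open>T + T \<circ> J\<close> is the trace, \<open>J\<close> being complex conjugation, \<open>T\<close> vanishes on \<open>V\<^sub>0\<close> and is invertible on
  the constants, while on the odd part it is given, in the basis \<open>\<zeta>\<^sup>i - \<zeta>\<^bsup>-i\<^esup>\<close>, by \<open>2N\<^sub>l\<close> minus the all-ones
  matrix, whose first row reduces its kernel to that of \<open>N\<^sub>l\<close>. So \<open>T\<close> is injective modulo \<open>W\<^sub>\<mu>\<close> for all
  \<open>\<mu>\<close> iff \<open>W\<^sub>1 = V\<^sub>0\<close> and \<open>p\<close> does not divide \<open>det N\<^sub>l\<close>.
\<close>


section \<open>Algebraic integers\<close>

text \<open>Class field theory enters through the kernel of the Artin map, which is part of the
  definition of a ray class field; the rest is arithmetic modulo p. Divisibility by p in A is read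
  off from traces: by \<open>co_expansion\<close>, l x is a combination of powers of \<zeta> with
  the integers \<open>co j x\<close> as coefficients, and l is invertible modulo p. The map x
  \<mapsto> 1 + 2p^\<mu> x turns sums into products modulo 2p^(\<mu>+1), because \<mu> \<ge> 1 makes
  the square of 2p^\<mu> vanish there; this is why the norm linearises to the trace and \<phi>* to
  T. Elements of S_\<mu> have denominators. The p-th power of a denominator congruent to 1 modulo
  2p^\<mu> is congruent to 1 modulo 2p^(\<mu>+1), which lifts congruences by one level without
  factoring ideals. Invertibility of 2 modulo p separates even and odd parts; on rational numbers
  the trace is multiplication by l - 1 = 2n, and there p must not divide n. The chain of inclusions
  of W_1 in W_2 and so on, all inside V_0, is the reason why a condition at level 1 decides every
  level.\<close>

lemma int_matrix_eigenvalue_algebraic_int: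
  fixes x :: complex and w :: "'i \<Rightarrow> complex"
  assumes I: "finite I" and nz: "i0 \<in> I" "w i0 \<noteq> 0"
    and ev: "\<And>i. i \<in> I \<Longrightarrow> x * w i = (\<Sum>j\<in>I. of_int (M i j) * w j)"
  shows "algebraic_int x"
proof -
  obtain h where h: "bij_betw h {..<card I} I"
    using ex_bij_betw_nat_finite[OF I] atLeast0LessThan by auto
  define n where "n = card I"
  define A where "A = Matrix.mat n n (\<lambda>(i, j). M (h i) (h j))"
  define B :: "complex mat" where "B = map_mat of_int A"
  define v where "v = Matrix.vec n (\<lambda>i. w (h i))"
  have A: "A \<in> carrier_mat n n" and B: "B \<in> carrier_mat n n"
    by (auto simp: A_def B_def)
  have hI: "h i \<in> I" if "i < n" for i
    using h that by (auto simp: n_def bij_betw_def)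
  have "B *\<^sub>v v = x \<cdot>\<^sub>v v"
  proof (rule eq_vecI)
    fix i assume "i < dim_vec (x \<cdot>\<^sub>v v)"
    then have i: "i < n" by (simp add: v_def)
    have "(B *\<^sub>v v) $ i = (\<Sum>j<n. of_int (M (h i) (h j)) * w (h j))"
      using i by (auto simp: B_def A_def v_def scalar_prod_def atLeast0LessThan intro!: sum.cong)
    also have "\<dots> = (\<Sum>j\<in>I. of_int (M (h i) j) * w j)"
      by (rule sum.reindex_bij_betw[OF h[folded n_def], of "\<lambda>j. of_int (M (h i) j) * w j"])
    also have "\<dots> = x * w (h i)" using ev[OF hI[OF i]] by simp
    finally show "(B *\<^sub>v v) $ i = (x \<cdot>\<^sub>v v) $ i" using i by (simp add: v_def)
  qed (auto simp: v_def B_def A_def)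
  moreover have "v \<noteq> 0\<^sub>v n"
  proof
    assume "v = 0\<^sub>v n"
    obtain k where k: "k < n" "h k = i0"
      using h nz(1) unfolding n_def bij_betw_def by (metis imageE lessThan_iff)
    have "v $ k = 0" using \<open>v = 0\<^sub>v n\<close> k by simp
    then show False using k nz by (simp add: v_def)
  qed
  ultimately have "eigenvalue B x"
    unfolding eigenvalue_def eigenvector_def using B by (intro exI[of _ v]) (auto simp: v_def)
  then have "poly (char_poly B) x = 0"
    using eigenvalue_root_char_poly[OF B] by simp
  moreover have "char_poly B = map_poly of_int (char_poly A)"
    unfolding B_def by (rule of_int_hom.char_poly_hom[OF A])
  ultimately show ?thesis
    unfolding algebraic_int_altdef_ipoly using degree_monic_char_poly[OF A]
    by (intro exI[of _ "char_poly A"]) auto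
qed

definition int_span :: "('i \<Rightarrow> complex) \<Rightarrow> 'i set \<Rightarrow> complex set"
  where "int_span w I = {\<Sum>j\<in>I. of_int (c j) * w j | c :: 'i \<Rightarrow> int. True}"

text \<open>The determinant trick: multiplication by \<open>x\<close> on a stable lattice is given
  by an integer matrix with \<open>w\<close> as eigenvector, so \<open>x\<close> is a root of its
  monic characteristic polynomial. The nonzero generator keeps the eigenvector nonzero.\<close>

lemma int_span_stable_algebraic_int:
  assumes "finite I" "i0 \<in> I" "w i0 \<noteq> 0" and st: "\<And>i. i \<in> I \<Longrightarrow> x * w i \<in> int_span w I"
  shows "algebraic_int x"
proof -
  have "\<forall>i\<in>I. \<exists>c :: 'a \<Rightarrow> int. x * w i = (\<Sum>j\<in>I. of_int (c j) * w j)"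
    using st by (auto simp: int_span_def)
  then obtain M :: "'a \<Rightarrow> 'a \<Rightarrow> int" where "\<And>i. i \<in> I \<Longrightarrow> x * w i = (\<Sum>j\<in>I. of_int (M i j) * w j)"
    by metis
  with assms(1-3) show ?thesis by (rule int_matrix_eigenvalue_algebraic_int)
qed

lemma int_spanI: "u = (\<Sum>j\<in>I. of_int (c j) * w j) \<Longrightarrow> u \<in> int_span w I"
  unfolding int_span_def by blast

lemma int_spanE:
  assumes "u \<in> int_span w I"
  obtains c where "u = (\<Sum>j\<in>I. of_int (c j) * w j)"
  using assms unfolding int_span_def by blast

lemma int_span_add:
  assumes "u \<in> int_span w I" "v \<in> int_span w I"
  shows "u + v \<in> int_span w I"
proof -
  obtain c d where "u = (\<Sum>j\<in>I. of_int (c j) * w j)" "v = (\<Sum>j\<in>I. of_int (d j) * w j)"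
    using assms by (elim int_spanE)
  then show ?thesis
    by (intro int_spanI[of _ "\<lambda>j. c j + d j"]) (simp add: sum.distrib distrib_right)
qed

lemma int_span_0: "0 \<in> int_span w I"
  by (rule int_spanI[of _ "\<lambda>_. 0"]) simp

lemma int_span_mult_int:
  assumes "u \<in> int_span w I"
  shows "of_int m * u \<in> int_span w I"
proof -
  obtain c where "u = (\<Sum>j\<in>I. of_int (c j) * w j)"
    using assms by (elim int_spanE)
  then show ?thesis
    by (intro int_spanI[of _ "\<lambda>j. m * c j"]) (simp add: sum_distrib_left mult.assoc)
qed

lemma int_span_sum: "(\<And>j. j \<in> J \<Longrightarrow> f j \<in> int_span w I) \<Longrightarrow> (\<Sum>j\<in>J. f j) \<in> int_span w I"
  by (induction J rule: infinite_finite_induct) (simp_all add: int_span_add int_span_0)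

lemma int_span_base:
  assumes "finite I" "i \<in> I"
  shows "w i \<in> int_span w I"
proof (rule int_spanI)
  have "(\<Sum>j\<in>I. of_int (if j = i then 1 else 0) * w j) = (\<Sum>j\<in>I. if j = i then w i else 0)"
    by (rule sum.cong) auto
  then show "w i = (\<Sum>j\<in>I. of_int (if j = i then 1 else 0) * w j)"
    using assms by simp
qed

lemma int_span_mult:
  assumes "\<And>i. i \<in> I \<Longrightarrow> x * w i \<in> int_span w I" and "u \<in> int_span w I"
  shows "x * u \<in> int_span w I"
proof -
  obtain c where c: "u = (\<Sum>j\<in>I. of_int (c j) * w j)" using assms(2) by (auto simp: int_span_def)
  have "x * u = (\<Sum>j\<in>I. of_int (c j) * (x * w j))"
    by (simp add: c sum_distrib_left mult_ac)
  also have "\<dots> \<in> int_span w I"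
    by (intro int_span_sum int_span_mult_int assms(1))
  finally show ?thesis .
qed

lemma algebraic_int_power_reduce:
  fixes x :: complex
  assumes "algebraic_int x"
  obtains a :: nat and c :: "nat \<Rightarrow> int" where "a > 0" "x ^ a = (\<Sum>k<a. of_int (c k) * x ^ k)"
proof -
  obtain p where p: "poly (map_poly of_int p) x = 0" "lead_coeff p = 1"
    using assms unfolding algebraic_int_altdef_ipoly by blast
  define T where "T = (\<Sum>k<degree p. of_int (coeff p k) * x ^ k)"
  have "0 = (\<Sum>k\<le>degree p. of_int (coeff p k) * x ^ k)"
    using p(1) by (simp add: poly_altdef degree_map_poly coeff_map_poly)
  also have "\<dots> = T + x ^ degree p"
    using p(2) by (simp add: T_def lessThan_Suc_atMost[symmetric])
  finally have "x ^ degree p = - T"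
    by (metis eq_neg_iff_add_eq_0 add.commute)
  then have "x ^ degree p = (\<Sum>k<degree p. of_int (- coeff p k) * x ^ k)"
    by (simp add: T_def sum_negf)
  \<comment> \<open>A monic polynomial of degree 0 is 1 and has no root. Positivity of
    \<open>a\<close> later puts the monomial 1 into the spanning family.\<close>
  moreover have "degree p > 0"
  proof (rule Nat.gr0I)
    assume "degree p = 0"
    then have "p = 1" using p(2) by (metis degree_0_id of_nat_1 one_poly_eq_simps(1))
    then show False using p(1) by simp
  qed
  ultimately show thesis by (intro that)
qed

text \<open>The monomials x^i y^j with exponents below the degrees of monic equations of
  \<open>x\<close> and \<open>y\<close> span a lattice stable under \<open>x\<close> and under
  \<open>y\<close>, hence under their sum and product.\<close>

lemma
  fixes x y :: complex
  assumes "algebraic_int x" "algebraic_int y"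
  shows algebraic_int_add: "algebraic_int (x + y)"
    and algebraic_int_mult: "algebraic_int (x * y)"
proof -
  obtain a c where a: "a > 0" "x ^ a = (\<Sum>k<a. of_int (c k) * x ^ k)"
    using algebraic_int_power_reduce[OF assms(1)] by blast
  obtain b d where b: "b > 0" "y ^ b = (\<Sum>k<b. of_int (d k) * y ^ k)"
    using algebraic_int_power_reduce[OF assms(2)] by blast
  define I where "I = {..<a} \<times> {..<b}"
  define w where "w = (\<lambda>(i, j). x ^ i * y ^ j)"
  have fin: "finite I" by (simp add: I_def)
  have i0: "(0, 0) \<in> I" "w (0, 0) \<noteq> 0" using a b by (auto simp: I_def w_def)
  have X: "x * w ij \<in> int_span w I" if ijI: "ij \<in> I" for ij
  proof -
    obtain i j where ij: "ij = (i, j)" "i < a" "j < b" using ijI unfolding I_def by (cases ij) auto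
    show ?thesis
    proof (cases "Suc i < a")
      case True
      then have "x * w ij = w (Suc i, j)" "(Suc i, j) \<in> I" using ij by (auto simp: w_def I_def)
      then show ?thesis using int_span_base[OF fin] by metis
    next
      case False
      then have "x * w ij = x ^ a * y ^ j" using ij
        by (metis (no_types, lifting) Suc_lessI case_prod_conv mult.assoc power_Suc w_def)
      also have "\<dots> = (\<Sum>k<a. of_int (c k) * w (k, j))"
        unfolding a(2) sum_distrib_right w_def by (simp add: mult_ac)
      also have "\<dots> \<in> int_span w I"
        using ij by (intro int_span_sum int_span_mult_int int_span_base[OF fin]) (auto simp: I_def)
      finally show ?thesis .
    qed
  qed
  have Y: "y * w ij \<in> int_span w I" if ijI: "ij \<in> I" for ij
  proof -
    obtain i j where ij: "ij = (i, j)" "i < a" "j < b" using ijI unfolding I_def by (cases ij) auto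
    show ?thesis
    proof (cases "Suc j < b")
      case True
      then have "y * w ij = w (i, Suc j)" "(i, Suc j) \<in> I" using ij by (auto simp: w_def I_def)
      then show ?thesis using int_span_base[OF fin] by metis
    next
      case False
      then have "Suc j = b" using ij by simp
      then have "y * w ij = x ^ i * y ^ b" using ij
        by (auto simp: w_def)
      also have "\<dots> = (\<Sum>k<b. of_int (d k) * w (i, k))"
        unfolding b(2) sum_distrib_left w_def by (simp add: mult_ac)
      also have "\<dots> \<in> int_span w I"
        using ij by (intro int_span_sum int_span_mult_int int_span_base[OF fin]) (auto simp: I_def)
      finally show ?thesis .
    qed
  qed
  have "(x + y) * w ij \<in> int_span w I" if "ij \<in> I" for ij
    using int_span_add[OF X[OF that] Y[OF that]] by (simp only: distrib_right)
  then show "algebraic_int (x + y)"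
    by (intro int_span_stable_algebraic_int[of I "(0, 0)" w] fin i0)
  have "(x * y) * w ij \<in> int_span w I" if "ij \<in> I" for ij
  proof -
    have "x * (y * w ij) \<in> int_span w I"
      using X Y[OF that] by (rule int_span_mult)
    then show ?thesis by (simp only: mult.assoc)
  qed
  then show "algebraic_int (x * y)"
    by (intro int_span_stable_algebraic_int[of I "(0, 0)" w] fin i0)
qed

lemma algebraic_int_diff: "algebraic_int (x :: complex) \<Longrightarrow> algebraic_int y \<Longrightarrow> algebraic_int (x - y)"
  using algebraic_int_add[of x "- y"] by simp

lemma algebraic_int_sum:
  "(\<And>i. i \<in> I \<Longrightarrow> algebraic_int (f i :: complex)) \<Longrightarrow> algebraic_int (\<Sum>i\<in>I. f i)"
  by (induction I rule: infinite_finite_induct) (simp_all add: algebraic_int_add)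

lemma algebraic_int_prod:
  "(\<And>i. i \<in> I \<Longrightarrow> algebraic_int (f i :: complex)) \<Longrightarrow> algebraic_int (\<Prod>i\<in>I. f i)"
  by (induction I rule: infinite_finite_induct) (simp_all add: algebraic_int_mult)

lemma algebraic_int_power: "algebraic_int (x :: complex) \<Longrightarrow> algebraic_int (x ^ n)"
  by (induction n) (simp_all add: algebraic_int_mult)

text \<open>Zorn's lemma on the ideals that contain \<open>I\<close> and miss 1, a condition that
  survives unions of chains. The maximal ideal serves to turn the local conditions of
  \<open>ray_cong\<close> into one global denominator.\<close>

lemma exists_maximalideal:
  assumes "cring R" "ideal I R" "I \<noteq> carrier R"
  obtains M where "maximalideal M R" "I \<subseteq> M"
proof -
  interpret cring R by fact
  define S where "S = {J. ideal J R \<and> I \<subseteq> J \<and> \<one>\<^bsub>R\<^esub> \<notin> J}"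
  have one: "\<one>\<^bsub>R\<^esub> \<notin> J \<longleftrightarrow> J \<noteq> carrier R" if "ideal J R" for J
    using ideal.one_imp_carrier[OF that] by auto
  have IS: "S \<noteq> {}" using assms(2,3) one[OF assms(2)] by (auto simp: S_def)
  have "\<Union>C \<in> S" if ne: "C \<noteq> {}" and ch: "subset.chain S C" for C
  proof -
    have C: "C \<subseteq> S" using ch unfolding subset.chain_def by blast
    have "subset.chain {J. ideal J R} C"
      using ch unfolding subset.chain_def S_def by blast
    then have "ideal (\<Union>C) R" using chain_Union_is_ideal[of C] ne by auto
    moreover have "I \<subseteq> \<Union>C" using C ne unfolding S_def by blast
    moreover have "\<one>\<^bsub>R\<^esub> \<notin> \<Union>C" using C unfolding S_def by blast
    ultimately show ?thesis unfolding S_def by blast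
  qed
  from subset_Zorn_nonempty[OF IS this]
  obtain M where M: "M \<in> S" "\<And>J. J \<in> S \<Longrightarrow> M \<subseteq> J \<Longrightarrow> J = M"
    by blast
  have "maximalideal M R"
  proof (rule maximalidealI)
    show "ideal M R" "carrier R \<noteq> M" using M one by (auto simp: S_def)
    fix J assume "ideal J R" "M \<subseteq> J" "J \<subseteq> carrier R"
    then show "J = M \<or> J = carrier R"
      using M(1) M(2)[of J] one by (auto simp: S_def)
  qed
  then show thesis using that M(1) by (auto simp: S_def)
qed


section \<open>Linear independence of the powers of the root of unity\<close>

lemma common_denominator:
  assumes "finite I"
  shows "\<exists>d::int. d > 0 \<and> (\<forall>i\<in>I. \<exists>m. of_int d * (c i :: rat) = of_int m)"
  using assms
proof induction
  case (insert i I)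
  then obtain d where d: "d > 0" "\<forall>i\<in>I. \<exists>m. of_int d * (c i :: rat) = of_int m" by blast
  obtain a b where ab: "b > 0" "c i = of_int a / of_int b"
    by (meson quotient_of_denom_pos quotient_of_div surj_pair)
  show ?case
  proof (rule exI[of _ "d * b"], intro conjI ballI)
    show "d * b > 0" using d ab by simp
    fix j assume j: "j \<in> insert i I"
    show "\<exists>m. of_int (d * b) * c j = of_int m"
    proof (cases "j = i")
      case True
      have "of_int (d * b) * c i = (of_int (d * a) :: rat)" using ab by simp
      then show ?thesis using True by blast
    next
      case False
      then obtain m where "of_int d * (c j :: rat) = of_int m" using d j by blast
      then have "of_int (d * b) * c j = (of_int (b * m) :: rat)" by (simp add: mult_ac)
      then show ?thesis by blast
    qed
  qed
qed (auto intro: exI[of _ 1])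

text \<open>The inverse would be a rational algebraic integer, hence an integer. The linear
  independence of the powers of \<zeta> rests on this contradiction.\<close>

lemma not_algebraic_int_inverse_nat:
  assumes "m > 1" "algebraic_int (y :: complex)" "of_nat m * y = 1"
  shows False
proof -
  have "y = 1 / of_nat m" using assms by (simp add: field_simps)
  then have "y \<in> \<rat>" by simp
  then have "y \<in> \<int>" using assms rational_algebraic_int_is_int by blast
  then obtain k where "y = of_int k" by (auto elim: Ints_cases)
  then have "of_int (int m * k) = (1 :: complex)" using assms by simp
  then have "int m * k = 1" using of_int_eq_1_iff by blast
  then show False using assms(1) by (simp add: zmult_eq_1_iff)
qed

interpretation of_rat_poly_hom: map_poly_comm_ring_hom "of_rat :: rat \<Rightarrow> complex" ..

locale cyclo =
  fixes l :: nat
  assumes prime: "Factorial_Ring.prime l" and odd: "odd l"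
begin

abbreviation z :: complex where "z \<equiv> zeta l"

lemma l_ge_3: "l \<ge> 3"
  using prime odd prime_ge_2_nat[of l] by (cases "l = 2") auto

lemma zeta_power: "z ^ m = exp (2 * of_real pi * \<i> * of_nat m / of_nat l)"
  unfolding zeta_def exp_of_nat_mult[symmetric] by (simp add: mult_ac)

lemma zeta_power_l: "z ^ l = 1"
  using l_ge_3 by (simp add: zeta_power exp_eq_1 )

lemma zeta_nz: "z \<noteq> 0"
  by (simp add: zeta_def)

lemma zeta_power_mod: "z ^ (m mod l) = z ^ m"
proof -
  have "z ^ m = z ^ (l * (m div l) + m mod l)" by simp
  also have "\<dots> = z ^ (m mod l)" by (simp only: power_add power_mult zeta_power_l power_one mult_1)
  finally show ?thesis by simp
qed

lemma zeta_power_cong: "a mod l = b mod l \<Longrightarrow> z ^ a = z ^ b"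
  by (metis zeta_power_mod)

lemma zeta_power_eq_1_iff: "z ^ m = 1 \<longleftrightarrow> l dvd m"
proof
  assume "z ^ m = 1"
  then obtain k :: int where "Im (2 * of_real pi * \<i> * of_nat m / of_nat l) = of_int (2 * k) * pi"
    unfolding zeta_power exp_eq_1 by blast
  then have "real m = real_of_int k * real l" using l_ge_3 by (simp add: field_simps)
  then have "int m = k * int l"
    by (metis of_int_eq_iff of_int_mult of_int_of_nat_eq)
  then have "int l dvd int m" by simp
  then show "l dvd m" by simp
next
  assume "l dvd m"
  then show "z ^ m = 1" using zeta_power_cong[of m 0] by simp
qed

lemma sum_zeta_powers: "(\<Sum>j<l. z ^ (m * j)) = (if l dvd m then of_nat l else 0)"
proof (cases "l dvd m")
  case True
  then have "z ^ (m * j) = 1" for j by (simp add: zeta_power_eq_1_iff)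
  then show ?thesis using True by simp
next
  case False
  have "(z ^ m) ^ l = (z ^ l) ^ m" by (simp flip: power_mult add: mult.commute)
  then have 1: "(z ^ m) ^ l = 1" by (simp add: zeta_power_l)
  have "(\<Sum>j<l. z ^ (m * j)) = (\<Sum>j<l. (z ^ m) ^ j)" by (simp add: power_mult)
  also have "\<dots> = 0"
    using False geometric_sum[of "z ^ m" l] zeta_power_l
    by (simp add: zeta_power_eq_1_iff 1)
  finally show ?thesis using False by simp
qed

lemma atLeast1_lessThan_l: "{..<l} = insert 0 {1..<l}" 
  using l_ge_3 by auto

lemma sum_zeta_powers_nonzero: "(\<Sum>j\<in>{1..<l}. z ^ (m * j)) = (if l dvd m then of_nat l - 1 else -1)"
proof -
  have "(\<Sum>j<l. z ^ (m * j)) = 1 + (\<Sum>j\<in>{1..<l}. z ^ (m * j))"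
    unfolding atLeast1_lessThan_l by simp
  then show ?thesis
    using sum_zeta_powers[of m] by (metis add_diff_cancel_left' diff_0)
qed

lemma algebraic_int_zeta: "algebraic_int z"
  by (rule algebraic_int_root[of 1 "monom 1 l"])
     (use l_ge_3 zeta_power_l in \<open>auto simp: poly_monom degree_monom_eq\<close>)

lemma cnj_zeta: "cnj z = z ^ (l - 1)"
proof -
  have "cnj z * z = 1"
    unfolding zeta_def exp_cnj by (simp flip: exp_add)
  moreover have "z ^ (l - 1) * z = 1"
    using zeta_power_l l_ge_3 by (metis One_nat_def Suc_pred' mult.commute power_Suc less_le_trans zero_less_numeral)
  ultimately show ?thesis using zeta_nz by (metis mult_right_cancel)
qed

text \<open>With \<open>t = 1 - \<zeta>\<close> one has \<open>t\<^bsup>l - 1\<^esup> = l(ts - 1)\<close>. Expanding the relation in powers of \<open>t\<close> and looking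
  at the first coefficient prime to \<open>l\<close> shows that \<open>l\<close> divides \<open>t\<^bsup>l - 2\<^esup>\<close>, so \<open>t\<close> and hence \<open>l\<close> would be
  a unit.\<close>

lemma zeta_linear_independent_step:
  fixes f :: "int poly"
  assumes "degree f < l - 1" "poly (map_poly of_int f) z = 0"
  shows "[:int l:] dvd f"
proof (rule ccontr)
  assume notdvd: "\<not> [:int l:] dvd f"
  define t where "t = 1 - z"
  have algt: "algebraic_int t"
    unfolding t_def by (intro algebraic_int_diff algebraic_int_zeta algebraic_int_1)
  have t_nz: "t \<noteq> 0"
    unfolding t_def using zeta_power_eq_1_iff[of 1] l_ge_3 by auto
  \<comment> \<open>\<open>s\<close> collects the middle terms of the expansion of (1 - t)^l = 1
    after division by l t^2. The remaining terms are 1, -l t and, l being odd, -t^l.\<close>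
  define s where "s = (\<Sum>k\<in>{2..<l}. of_nat ((l choose k) div l) * (- t) ^ (k - 2))"
  have algs: "algebraic_int s"
    unfolding s_def by (intro algebraic_int_sum algebraic_int_mult algebraic_int_power) (auto intro: algt)
  have key: "t ^ (l - 1) = of_nat l * (t * s - 1)"
  proof -
    have set: "{..l} = insert 0 (insert 1 (insert l {2..<l}))" using l_ge_3 by auto
    have "1 = (- t + 1) ^ l" by (simp add: t_def zeta_power_l)
    also have "\<dots> = (\<Sum>k\<le>l. of_nat (l choose k) * (- t) ^ k)" using binomial_ring[of "- t" 1 l] by simp
    also have "\<dots> = 1 - of_nat l * t - t ^ l + (\<Sum>k\<in>{2..<l}. of_nat (l choose k) * (- t) ^ k)"
      unfolding set using l_ge_3 odd by simp
    also have "(\<Sum>k\<in>{2..<l}. of_nat (l choose k) * (- t) ^ k) = of_nat l * t\<^sup>2 * s"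
      unfolding s_def sum_distrib_left
    proof (rule sum.cong)
      fix k assume k: "k \<in> {2..<l}"
      then have "l dvd (l choose k)" using prime by (intro dvd_choose_prime) auto
      then have "of_nat (l choose k) = (of_nat l * of_nat ((l choose k) div l) :: complex)"
        by (metis dvd_mult_div_cancel of_nat_mult)
      moreover have "(- t) ^ k = t\<^sup>2 * (- t) ^ (k - 2)"
      proof -
        have "(- t) ^ k = (- t) ^ (2 + (k - 2))" using k by (metis le_add_diff_inverse atLeastLessThan_iff)
        then show ?thesis unfolding power_add by (simp only: power2_minus)
      qed
      ultimately show "of_nat (l choose k) * (- t) ^ k
          = of_nat l * t\<^sup>2 * (of_nat ((l choose k) div l) * (- t) ^ (k - 2))"
        by (simp only: mult_ac)
    qed simp
    finally have "t * t ^ (l - 1) = t * (of_nat l * (t * s - 1))"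
      using l_ge_3 by (simp flip: power_Suc add: algebra_simps power2_eq_square)
    then show ?thesis using t_nz by simp
  qed
  \<comment> \<open>The same relation in powers of t = 1 - \<zeta>. The substitution X \<mapsto> 1 -
    X is an involution, so \<open>g\<close> still has a coefficient that l does not divide.\<close>
  define g where "g = pcompose f [:1, -1:]"
  have f_g: "f = pcompose g [:1, -1:]"
    unfolding g_def by (simp add: pcompose_assoc[symmetric] pcompose_pCons)
  have gt: "poly (map_poly of_int g) t = 0"
  proof -
    have "poly (map_poly of_int g) t = poly (map_poly of_int f) (1 - t)"
      by (simp add: g_def of_int_hom.map_poly_pcompose poly_pcompose map_poly_pCons)
    then show ?thesis using assms by (simp add: t_def)
  qed
  have degg: "degree g < l - 1"
    using assms by (simp add: g_def)
  have "\<exists>i. \<not> int l dvd coeff g i"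
  proof (rule ccontr)
    assume "\<nexists>i. \<not> int l dvd coeff g i"
    then have "[:int l:] dvd g" by (simp add: const_poly_dvd_iff)
    then obtain h where "g = [:int l:] * h" by (auto elim: dvdE)
    then have "f = [:int l:] * pcompose h [:1, -1:]"
      by (subst f_g) (simp add: pcompose_smult)
    then show False using notdvd dvd_triv_left by metis
  qed
  define i0 where "i0 = (LEAST i. \<not> int l dvd coeff g i)"
  have i0: "\<not> int l dvd coeff g i0" and i0_min: "\<And>i. i < i0 \<Longrightarrow> int l dvd coeff g i"
    unfolding i0_def
    using LeastI_ex[OF \<open>\<exists>i. \<not> int l dvd coeff g i\<close>] not_less_Least by blast+
  have "i0 \<le> degree g" using i0 by (intro le_degree) auto
  \<comment> \<open>Multiplication by t^m moves the term of index \<open>i0\<close> to exponent l -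
    2. Earlier terms are multiples of l by minimality of \<open>i0\<close>; later ones have exponent
    at least l - 1 and are multiples of l by \<open>key\<close>.\<close>
  define m where "m = l - 2 - i0"
  have m: "m + i0 = l - 2" using \<open>i0 \<le> degree g\<close> degg by (simp add: m_def)
  have "\<exists>b. algebraic_int b \<and> of_int (coeff g i) * t ^ (i + m) = of_nat l * b" if "i \<noteq> i0" for i
  proof (cases "i < i0")
    case True
    then obtain q where "coeff g i = int l * q" using i0_min by (auto elim: dvdE)
    then have "of_int (coeff g i) * t ^ (i + m) = of_nat l * (of_int q * t ^ (i + m))" by simp
    moreover have "algebraic_int (of_int q * t ^ (i + m))"
      by (intro algebraic_int_mult algebraic_int_power algt algebraic_int_of_int)
    ultimately show ?thesis by blast
  next
    case False
    then have "i + m = (i - i0 - 1) + (l - 1)" using that m l_ge_3 by simp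
    then have "of_int (coeff g i) * t ^ (i + m)
        = of_nat l * (of_int (coeff g i) * t ^ (i - i0 - 1) * (t * s - 1))"
      by (simp only: power_add key mult_ac)
    moreover have "algebraic_int (of_int (coeff g i) * t ^ (i - i0 - 1) * (t * s - 1))"
      by (intro algebraic_int_mult algebraic_int_power algebraic_int_diff algt algs algebraic_int_of_int algebraic_int_1)
    ultimately show ?thesis by blast
  qed
  then obtain b where b: "\<And>i. i \<noteq> i0 \<Longrightarrow> algebraic_int (b i)"
      "\<And>i. i \<noteq> i0 \<Longrightarrow> of_int (coeff g i) * t ^ (i + m) = of_nat l * b i"
    by metis
  have "0 = poly (map_poly of_int g) t * t ^ m" using gt by simp
  also have "\<dots> = (\<Sum>i\<le>degree g. of_int (coeff g i) * t ^ (i + m))"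
    unfolding poly_altdef sum_distrib_right
    by (simp add: degree_map_poly coeff_map_poly power_add mult.assoc)
  also have "\<dots> = of_int (coeff g i0) * t ^ (l - 2) + (\<Sum>i\<in>{..degree g} - {i0}. of_nat l * b i)"
    using \<open>i0 \<le> degree g\<close> b(2) m by (subst sum.remove[of _ i0]) (auto simp: add.commute intro!: sum.cong)
  finally have 1: "of_int (coeff g i0) * t ^ (l - 2) = of_nat l * (- (\<Sum>i\<in>{..degree g} - {i0}. b i))"
    by (simp only: sum_distrib_left mult_minus_right eq_neg_iff_add_eq_0)
  define B where "B = - (\<Sum>i\<in>{..degree g} - {i0}. b i)"
  have algB: "algebraic_int B"
    unfolding B_def by (intro algebraic_int_minus algebraic_int_sum b) auto
  have "coprime (coeff g i0) (int l)"
    using i0 prime by (metis coprime_commute prime_imp_coprime prime_nat_int_transfer)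
  then obtain u v where uv: "u * coeff g i0 + v * int l = 1"
    by (metis cong_solve_coprime_int bezout_int coprime_imp_gcd_eq_1)
  define B2 where "B2 = of_int u * B + of_int v * t ^ (l - 2)"
  have algB2: "algebraic_int B2"
    unfolding B2_def by (intro algebraic_int_add algebraic_int_mult algebraic_int_power algB algt algebraic_int_of_int)
  have "t ^ (l - 2) = of_int (u * coeff g i0 + v * int l) * t ^ (l - 2)" by (simp add: uv)
  also have "\<dots> = of_int u * (of_int (coeff g i0) * t ^ (l - 2)) + of_int v * of_nat l * t ^ (l - 2)"
    by (simp add: algebra_simps)
  also have "\<dots> = of_nat l * B2"
    unfolding 1 B2_def B_def[symmetric] by (simp add: algebra_simps)
  finally have 2: "t ^ (l - 2) = of_nat l * B2" .
  have "of_nat l * (t * s - 1) = t * t ^ (l - 2)"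
    unfolding key[symmetric] using l_ge_3 by (simp flip: power_Suc add: Suc_diff_Suc numeral_2_eq_2)
  then have "of_nat l * (t * s - 1) = of_nat l * (t * B2)" by (simp add: 2 mult_ac)
  then have "t * s - 1 = t * B2" using l_ge_3 by simp
  then have inv: "t * (s - B2) = 1" by (simp add: algebra_simps)
  have "of_nat l * (B2 * (s - B2) ^ (l - 2)) = (t * (s - B2)) ^ (l - 2)"
    by (simp add: power_mult_distrib 2 mult_ac)
  then have "of_nat l * (B2 * (s - B2) ^ (l - 2)) = 1" by (simp add: inv)
  moreover have "algebraic_int (B2 * (s - B2) ^ (l - 2))"
    by (intro algebraic_int_mult algebraic_int_power algebraic_int_diff algB2 algs)
  ultimately show False using not_algebraic_int_inverse_nat[of l] l_ge_3 by auto
qed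

text \<open>Descent: a nonzero relation whose leading coefficient is smallest in absolute value has
  all coefficients divisible by l, and dividing by l gives a smaller one.\<close>

lemma zeta_linear_independent_int:
  fixes f :: "int poly"
  assumes "degree f < l - 1" "poly (map_poly of_int f) z = 0"
  shows "f = 0"
proof (rule ccontr)
  assume "f \<noteq> 0"
  then have "\<exists>f :: int poly. f \<noteq> 0 \<and> degree f < l - 1 \<and> poly (map_poly of_int f) z = 0"
    using assms by blast
  then obtain f :: "int poly" where f: "f \<noteq> 0" "degree f < l - 1" "poly (map_poly of_int f) z = 0"
    and min: "\<And>g :: int poly. g \<noteq> 0 \<Longrightarrow> degree g < l - 1 \<Longrightarrow> poly (map_poly of_int g) z = 0
      \<Longrightarrow> nat \<bar>lead_coeff f\<bar> \<le> nat \<bar>lead_coeff g\<bar>"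
    using ex_has_least_nat[of "\<lambda>f :: int poly. f \<noteq> 0 \<and> degree f < l - 1 \<and> poly (map_poly of_int f) z = 0"
        _ "\<lambda>f. nat \<bar>lead_coeff f\<bar>"] by (metis (no_types, lifting))
  obtain g where g: "f = [:int l:] * g"
    using zeta_linear_independent_step[OF f(2,3)] by (auto elim: dvdE)
  then have fg: "f = Polynomial.smult (int l) g" by simp
  have "poly (map_poly of_int f) z = of_nat l * poly (map_poly of_int g) z"
    by (simp add: fg of_int_hom.map_poly_hom_smult)
  then have "poly (map_poly of_int g) z = 0" using f(3) l_ge_3 by simp
  moreover have "g \<noteq> 0" "degree g < l - 1" using f fg l_ge_3 by auto
  ultimately have "nat \<bar>lead_coeff f\<bar> \<le> nat \<bar>lead_coeff g\<bar>" using min by blast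
  then have "int l * \<bar>lead_coeff g\<bar> \<le> \<bar>lead_coeff g\<bar>"
    using l_ge_3 by (simp add: fg abs_mult)
  moreover have "\<bar>lead_coeff g\<bar> > 0" using \<open>g \<noteq> 0\<close> by simp
  ultimately show False using l_ge_3 by (simp add: mult_le_cancel_right1)
qed

text \<open>\<open>ev i f\<close> is the image of \<open>f(\<zeta>)\<close> under the automorphism \<open>\<zeta> \<mapsto> \<zeta>\<^sup>i\<close>.\<close>

definition ev :: "nat \<Rightarrow> rat poly \<Rightarrow> complex"
  where "ev i f = poly (map_poly of_rat f) (z ^ i)"

lemma ev_add: "ev i (f + g) = ev i f + ev i g"
  and ev_mult: "ev i (f * g) = ev i f * ev i g"
  and ev_const: "ev i [:c:] = of_rat c"
  and ev_minus: "ev i (- f) = - ev i f"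
  and ev_monom: "ev i (monom 1 m) = z ^ (i * m)"
  by (simp_all add: ev_def of_rat_hom.map_poly_hom_add of_rat_poly_hom.hom_mult
      of_rat_poly_hom.hom_uminus poly_monom power_mult of_rat_hom.map_poly_pCons_hom)

lemma ev_pcompose: "ev i (pcompose f g) = poly (map_poly of_rat f) (ev i g)"
  by (simp add: ev_def of_rat_hom.map_poly_pcompose poly_pcompose)

lemma zeta_linear_independent_rat:
  assumes "degree f < l - 1" "ev 1 f = 0"
  shows "f = 0"
proof -
  obtain d :: int where d: "d > 0" "\<forall>i\<in>{..degree f}. \<exists>m. of_int d * coeff f i = of_int m"
    using common_denominator[of "{..degree f}" "coeff f"] by blast
  then have "\<exists>m. of_int d * coeff f i = of_int m" for i
    by (cases "i \<le> degree f") (auto simp: coeff_eq_0 intro: exI[of _ 0])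
  then obtain c where c: "\<And>i. of_int d * coeff f i = of_int (c i)" by metis
  define g where "g = Abs_poly c"
  have cg: "coeff g = c"
    unfolding g_def
  proof (rule coeff_Abs_poly[of "degree f"])
    fix i assume "degree f < i"
    then show "c i = 0" using c[of i] by (simp add: coeff_eq_0)
  qed
  have gf: "map_poly of_int g = Polynomial.smult (of_int d) f"
    by (rule poly_eqI) (simp add: coeff_map_poly cg c)
  have "map_poly of_rat (map_poly of_int g :: rat poly) = (map_poly of_int g :: complex poly)"
    by (rule poly_eqI) (simp add: coeff_map_poly)
  then have "poly (map_poly of_int g) z = of_int d * ev 1 f"
    by (metis gf ev_def of_rat_hom.map_poly_hom_smult of_rat_of_int_eq poly_smult power_one_right)
  then have 1: "poly (map_poly of_int g) z = 0" using assms by simp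
  have "degree (map_poly of_int g :: rat poly) = degree f" using gf d by simp
  then have "degree g < l - 1" using assms by simp
  then have "g = 0" using zeta_linear_independent_int 1 by blast
  then show ?thesis using gf d by simp
qed

text \<open>Division by 1 + X + ... + X^(l-1) leaves a remainder of degree below l - 1 that vanishes
  at \<zeta>, hence is 0, and the divisor vanishes at all conjugates of \<zeta>. This is what makes
  the conjugation maps well defined.\<close>

lemma ev_eq_0:
  assumes f: "ev 1 f = 0" and i: "\<not> l dvd i"
  shows "ev i f = 0"
proof -
  define C where "C = (\<Sum>j<l. monom (1::rat) j)"
  have evsum: "ev i (\<Sum>j\<in>J. g j) = (\<Sum>j\<in>J. ev i (g j))" for i J and g :: "nat \<Rightarrow> rat poly"
    by (induction J rule: infinite_finite_induct) (simp_all add: ev_add ev_const[of _ 0, simplified])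
  have C: "ev i C = 0" if "\<not> l dvd i" for i
    using sum_zeta_powers[of i] that by (simp add: C_def evsum ev_monom)
  have coeffC: "coeff C k = (if k < l then 1 else 0)" for k
    by (simp add: C_def coeff_sum)
  have degC: "degree C = l - 1"
  proof (rule antisym)
    show "degree C \<le> l - 1" by (rule degree_le) (auto simp: coeffC)
    show "l - 1 \<le> degree C" using l_ge_3 by (intro le_degree) (simp add: coeffC)
  qed
  define q r where "q = f div C" and "r = f mod C"
  have fqr: "f = q * C + r" by (simp add: q_def r_def)
  have "degree r < l - 1"
  proof (cases "r = 0")
    case False
    have "C \<noteq> 0" using degC l_ge_3 by auto
    then show ?thesis using degree_mod_less'[of C f] False degC by (simp add: r_def)
  qed (use l_ge_3 in simp)
  moreover have "ev 1 r = 0"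
    using f C[of 1] l_ge_3 by (simp add: fqr ev_add ev_mult)
  ultimately have "r = 0" using zeta_linear_independent_rat by blast
  then show ?thesis using fqr C[OF i] by (simp add: ev_mult)
qed

end


section \<open>Automorphisms, trace and norm\<close>

declare One_nat_def [simp del]

lemma cnj_Rats: "x \<in> \<rat> \<Longrightarrow> cnj x = x"
  by (auto elim!: Rats_cases')

context cyclo
begin

abbreviation G :: "nat set" where "G \<equiv> {1..<l}"

text \<open>The field as polynomial values at \<zeta>, so that an automorphism just moves the
  evaluation point. Closure under inverses comes from the norm; \<open>cyclotomic_eq_K\<close> makes
  the link with the generated field.\<close>

definition K :: "complex set" where "K = range (ev 1)"

text \<open>A representing polynomial is chosen; by \<open>sig_ev\<close> the choice does not matter
  when l does not divide \<open>i\<close>. Any such \<open>i\<close> is allowed as index, and only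
  its residue modulo l counts.\<close>

definition sig :: "nat \<Rightarrow> complex \<Rightarrow> complex"
  where "sig i x = ev i (SOME f. ev 1 f = x)"

lemma ev_diff: "ev i (f - g) = ev i f - ev i g"
  using ev_add[of i f "- g"] by (simp add: ev_minus)

lemma sig_ev:
  assumes "\<not> l dvd i"
  shows "sig i (ev 1 f) = ev i f"
proof -
  define g where "g = (SOME g. ev 1 g = ev 1 f)"
  have "ev 1 g = ev 1 f" unfolding g_def by (rule someI[of _ f]) simp
  then have "ev 1 (g - f) = 0" by (simp add: ev_diff)
  from ev_eq_0[OF this assms] have "ev i (g - f) = 0" .
  then show ?thesis by (simp add: sig_def g_def[symmetric] ev_diff)
qed

lemma K_ev [simp, intro]: "ev 1 f \<in> K"
  by (simp add: K_def)

lemma KE: assumes "x \<in> K" obtains f where "x = ev 1 f"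
  using assms by (auto simp: K_def)

lemma K_add [intro]: "x \<in> K \<Longrightarrow> y \<in> K \<Longrightarrow> x + y \<in> K"
  by (elim KE) (simp only: ev_add[symmetric] K_ev)

lemma K_mult [intro]: "x \<in> K \<Longrightarrow> y \<in> K \<Longrightarrow> x * y \<in> K"
  by (elim KE) (simp only: ev_mult[symmetric] K_ev)

lemma K_minus [intro]: "x \<in> K \<Longrightarrow> - x \<in> K"
  by (elim KE) (simp only: ev_minus[symmetric] K_ev)

lemma K_diff [intro]: "x \<in> K \<Longrightarrow> y \<in> K \<Longrightarrow> x - y \<in> K"
  by (elim KE) (simp only: ev_diff[symmetric] K_ev)

lemma K_Rats [intro]: "x \<in> \<rat> \<Longrightarrow> x \<in> K"
  by (elim Rats_cases) (simp only: ev_const[of 1, symmetric] K_ev)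

lemma K_zeta_power [intro]: "z ^ m \<in> K"
  using ev_monom[of 1 m] by (metis K_ev mult_1)

lemma K_simps [simp]: "0 \<in> K" "1 \<in> K" "of_nat m \<in> K" "of_int k \<in> K" "numeral w \<in> K"
  by (auto intro: K_Rats)

lemma K_sum: "(\<And>i. i \<in> I \<Longrightarrow> f i \<in> K) \<Longrightarrow> (\<Sum>i\<in>I. f i) \<in> K"
  by (induction I rule: infinite_finite_induct) (simp_all add: K_add)

lemma K_prod: "(\<And>i. i \<in> I \<Longrightarrow> f i \<in> K) \<Longrightarrow> (\<Prod>i\<in>I. f i) \<in> K"
  by (induction I rule: infinite_finite_induct) (simp_all add: K_mult)

lemma K_power: "x \<in> K \<Longrightarrow> x ^ m \<in> K"
  by (induction m) (simp_all add: K_mult)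

lemma G_not_dvd: "i \<in> G \<Longrightarrow> \<not> l dvd i"
  by (auto dest: dvd_imp_le)

lemma l_minus_1: "\<not> l dvd l - 1" "l - 1 \<in> G"
  using l_ge_3 G_not_dvd[of "l - 1"] by auto

lemma not_dvd_mult: "\<not> l dvd i \<Longrightarrow> \<not> l dvd j \<Longrightarrow> \<not> l dvd i * j"
  using prime prime_dvd_mult_iff by blast

lemma sig_mod: "sig (i mod l) x = sig i x"
  by (simp add: sig_def ev_def zeta_power_mod)

lemma sig_cong: "i mod l = j mod l \<Longrightarrow> sig i x = sig j x"
  by (metis sig_mod)

lemma sig_1: "x \<in> K \<Longrightarrow> sig 1 x = x"
  using l_ge_3 by (elim KE) (simp only: sig_ev nat_dvd_1_iff_1)

context
  fixes i :: nat
  assumes i: "\<not> l dvd i"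
begin

lemma sig_add: "x \<in> K \<Longrightarrow> y \<in> K \<Longrightarrow> sig i (x + y) = sig i x + sig i y"
  using i by (elim KE) (simp only: ev_add[symmetric] sig_ev not_False_eq_True)

lemma sig_mult: "x \<in> K \<Longrightarrow> y \<in> K \<Longrightarrow> sig i (x * y) = sig i x * sig i y"
  using i by (elim KE) (simp only: ev_mult[symmetric] sig_ev not_False_eq_True)

lemma sig_diff: "x \<in> K \<Longrightarrow> y \<in> K \<Longrightarrow> sig i (x - y) = sig i x - sig i y"
  using i by (elim KE) (simp only: ev_diff[symmetric] sig_ev not_False_eq_True)

lemma sig_minus: "x \<in> K \<Longrightarrow> sig i (- x) = - sig i x"
  using i by (elim KE) (simp only: ev_minus[symmetric] sig_ev not_False_eq_True)

lemma sig_Rats: "x \<in> \<rat> \<Longrightarrow> sig i x = x"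
  using i by (elim Rats_cases) (metis ev_const sig_ev)

lemma sig_consts [simp]: "sig i 0 = 0" "sig i 1 = 1" "sig i (of_nat m) = of_nat m"
  "sig i (of_int k) = of_int k" "sig i (numeral w) = numeral w"
  by (auto intro: sig_Rats)

lemma sig_zeta_power: "sig i (z ^ m) = z ^ (i * m)"
  using sig_ev[OF i, of "monom 1 m"] by (simp add: ev_monom)

lemma sig_K: "x \<in> K \<Longrightarrow> sig i x \<in> K"
proof (elim KE)
  fix f assume "x = ev 1 f"
  then have "sig i x = ev i f" using sig_ev[OF i] by simp
  also have "\<dots> = ev 1 (pcompose f (monom 1 i))"
    by (simp add: ev_pcompose ev_monom) (simp add: ev_def)
  finally show ?thesis by simp
qed

lemma sig_sum: "(\<And>j. j \<in> J \<Longrightarrow> f j \<in> K) \<Longrightarrow> sig i (\<Sum>j\<in>J. f j) = (\<Sum>j\<in>J. sig i (f j))"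
  by (induction J rule: infinite_finite_induct) (simp_all add: sig_add K_sum)

lemma sig_prod: "(\<And>j. j \<in> J \<Longrightarrow> f j \<in> K) \<Longrightarrow> sig i (\<Prod>j\<in>J. f j) = (\<Prod>j\<in>J. sig i (f j))"
  by (induction J rule: infinite_finite_induct) (simp_all add: sig_mult K_prod)

lemma sig_power: "x \<in> K \<Longrightarrow> sig i (x ^ m) = sig i x ^ m"
  by (induction m) (simp_all add: sig_mult K_power)

lemma sig_algebraic_int:
  assumes x: "x \<in> K" "algebraic_int x"
  shows "algebraic_int (sig i x)"
proof -
  obtain p where p: "poly (map_poly of_int p) x = 0" "lead_coeff p = 1"
    using x unfolding algebraic_int_altdef_ipoly by blast
  have "sig i (poly (map_poly of_int p) x) = poly (map_poly of_int p) (sig i x)"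
    unfolding poly_altdef using x
    by (simp add: sig_sum sig_mult sig_power K_mult K_power degree_map_poly coeff_map_poly)
  then have "poly (map_poly of_int p) (sig i x) = 0" using p by simp
  then show ?thesis unfolding algebraic_int_altdef_ipoly using p by blast
qed

end

lemma sig_sig:
  assumes i: "\<not> l dvd i" and j: "\<not> l dvd j" and x: "x \<in> K"
  shows "sig i (sig j x) = sig (i * j) x"
proof -
  obtain f where f: "x = ev 1 f" using x by (elim KE)
  have "sig j x = ev j f" using f sig_ev[OF j] by simp
  also have "\<dots> = ev 1 (pcompose f (monom 1 j))"
    by (simp add: ev_pcompose ev_monom) (simp add: ev_def)
  finally have "sig i (sig j x) = ev i (pcompose f (monom 1 j))" using sig_ev[OF i] by simp
  also have "\<dots> = ev (i * j) f"
    by (simp add: ev_pcompose ev_monom) (simp add: ev_def)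
  also have "\<dots> = sig (i * j) x" using f sig_ev[OF not_dvd_mult[OF i j]] by simp
  finally show ?thesis .
qed

lemma sig_cnj:
  assumes "x \<in> K" shows "sig (l - 1) x = cnj x"
proof -
  obtain f where f: "x = ev 1 f" using assms by (elim KE)
  have nd: "\<not> l dvd l - 1" using l_ge_3 by (auto dest: dvd_imp_le)
  have "sig (l - 1) x = poly (map_poly of_rat f) (cnj z)"
    using sig_ev[OF nd, of f] by (simp add: f ev_def cnj_zeta)
  also have "\<dots> = cnj (poly (map_poly of_rat f) z)"
    by (simp add: poly_altdef cnj_Rats coeff_map_poly)
  finally show ?thesis by (simp add: f ev_def)
qed

lemma K_cnj: "x \<in> K \<Longrightarrow> cnj x \<in> K"
  using sig_cnj[of x] sig_K[OF l_minus_1(1)] by metis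

lemma G_inverse:
  assumes "\<not> l dvd i"
  obtains j where "j \<in> G" "(i * j) mod l = 1" "(j * i) mod l = 1"
proof -
  have "coprime i l" using assms prime by (metis coprime_commute prime_imp_coprime)
  then obtain x where "[i * x = 1] (mod l)" using cong_solve_coprime_nat by (metis One_nat_def)
  then have x: "(i * (x mod l)) mod l = 1" using l_ge_3 by (simp add: cong_def mod_mult_right_eq)
  then have "x mod l \<noteq> 0" using l_ge_3 by (intro notI) simp
  moreover have "x mod l < l" using l_ge_3 by simp
  ultimately show thesis using x by (intro that[of "x mod l"]) (auto simp: mult.commute)
qed

lemma sig_inj:
  assumes "\<not> l dvd i" "x \<in> K" "sig i x = 0"
  shows "x = 0"
proof -
  obtain j where j: "j \<in> G" "(j * i) mod l = 1" using G_inverse[OF assms(1)] by blast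
  have "sig j (sig i x) = sig (j * i) x" using assms j G_not_dvd by (intro sig_sig) auto
  also have "\<dots> = sig 1 x" using j l_ge_3 by (intro sig_cong) simp
  also have "\<dots> = x" using assms by (intro sig_1)
  finally show ?thesis using assms(3) j G_not_dvd by simp
qed

lemma bij_betw_mult_G:
  assumes a: "\<not> l dvd a"
  shows "bij_betw (\<lambda>i. (a * i) mod l) G G"
proof (rule bij_betw_imageI)
  have sub: "(\<lambda>i. (a * i) mod l) ` G \<subseteq> G"
  proof
    fix y assume "y \<in> (\<lambda>i. (a * i) mod l) ` G"
    then obtain i where i: "i \<in> G" "y = (a * i) mod l" by blast
    then have "y \<noteq> 0" using not_dvd_mult[OF a, of i] G_not_dvd by (simp add: mod_eq_0_iff_dvd)
    then show "y \<in> G" using i l_ge_3 by simp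
  qed
  show inj: "inj_on (\<lambda>i. (a * i) mod l) G"
  proof (rule inj_onI)
    fix i j assume ij: "i \<in> G" "j \<in> G" "(a * i) mod l = (a * j) mod l"
    have "coprime a l" using a prime by (metis coprime_commute prime_imp_coprime)
    then have "[i = j] (mod l)" using ij(3) cong_mult_lcancel_nat by (auto simp: cong_def)
    then show "i = j" using ij by (simp add: cong_def)
  qed
  show "(\<lambda>i. (a * i) mod l) ` G = G"
    using endo_inj_surj[OF _ sub inj] by simp
qed

lemma sum_mult_G:
  assumes "\<not> l dvd a" "\<And>i. g (i mod l) = g i"
  shows "(\<Sum>i\<in>G. g (a * i)) = (\<Sum>i\<in>G. g i)"
  using sum.reindex_bij_betw[OF bij_betw_mult_G[OF assms(1)], of g] by (simp add: assms(2))

lemma prod_mult_G: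
  assumes "\<not> l dvd a" "\<And>i. g (i mod l) = g i"
  shows "(\<Prod>i\<in>G. g (a * i)) = (\<Prod>i\<in>G. g i)"
  using prod.reindex_bij_betw[OF bij_betw_mult_G[OF assms(1)], of g] by (simp add: assms(2))

section \<open>Trace, norm and inverses\<close>

definition tr :: "complex \<Rightarrow> complex" where "tr x = (\<Sum>i\<in>G. sig i x)"

lemma tr_Rats: assumes "x \<in> K" shows "tr x \<in> \<rat>"
proof -
  obtain f where f: "x = ev 1 f" using assms by (elim KE)
  have "tr x = (\<Sum>i\<in>G. ev i f)"
    unfolding tr_def using f G_not_dvd sig_ev by (intro sum.cong) auto
  also have "\<dots> = (\<Sum>i\<in>G. \<Sum>m\<le>degree f. of_rat (coeff f m) * z ^ (m * i))"
    by (simp add: ev_def poly_altdef coeff_map_poly power_mult[symmetric] mult.commute)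
  also have "\<dots> = (\<Sum>m\<le>degree f. of_rat (coeff f m) * (\<Sum>i\<in>G. z ^ (m * i)))"
    by (subst sum.swap) (simp add: sum_distrib_left)
  also have "\<dots> \<in> \<rat>"
    unfolding sum_zeta_powers_nonzero by (intro Rats_sum Rats_mult) auto
  finally show ?thesis .
qed

text \<open>Averaging: a fixed element is its trace divided by the degree l - 1, so rationality of
  traces is enough.\<close>

lemma fixed_Rats:
  assumes "x \<in> K" "\<And>i. i \<in> G \<Longrightarrow> sig i x = x"
  shows "x \<in> \<rat>"
proof -
  have "tr x = of_nat (l - 1) * x" using assms by (simp add: tr_def)
  then have "x = tr x / of_nat (l - 1)" using l_ge_3 by (simp add: field_simps)
  then show ?thesis using tr_Rats[OF assms(1)] by (metis Rats_divide Rats_of_nat)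
qed

definition nrm :: "complex \<Rightarrow> complex" where "nrm x = (\<Prod>i\<in>G. sig i x)"

lemma nrm_Rats: assumes x: "x \<in> K" shows "nrm x \<in> \<rat>"
proof (rule fixed_Rats)
  show "nrm x \<in> K" unfolding nrm_def using x G_not_dvd by (intro K_prod sig_K) auto
  fix j assume j: "j \<in> G"
  have "sig j (nrm x) = (\<Prod>i\<in>G. sig j (sig i x))"
    unfolding nrm_def using x G_not_dvd j by (intro sig_prod sig_K) auto
  also have "\<dots> = (\<Prod>i\<in>G. sig (j * i) x)"
    using x G_not_dvd j by (intro prod.cong sig_sig) auto
  also have "\<dots> = nrm x"
    unfolding nrm_def using G_not_dvd j by (intro prod_mult_G) (auto simp: sig_mod)
  finally show "sig j (nrm x) = nrm x" .
qed

lemma nrm_nz: assumes "x \<in> K" "x \<noteq> 0" shows "nrm x \<noteq> 0"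
proof -
  have "sig i x \<noteq> 0" if "i \<in> G" for i using assms sig_inj[of i x] G_not_dvd[OF that] by blast
  then show ?thesis by (simp add: nrm_def)
qed

lemma nrm_mult: "x \<in> K \<Longrightarrow> y \<in> K \<Longrightarrow> nrm (x * y) = nrm x * nrm y"
  unfolding nrm_def using G_not_dvd by (simp add: sig_mult prod.distrib)

text \<open>The inverse is the product of the other conjugates divided by the norm, a nonzero
  rational number.\<close>

lemma K_inverse [intro]: assumes "x \<in> K" shows "inverse x \<in> K"
proof (cases "x = 0")
  case False
  define y where "y = (\<Prod>i\<in>G - {1}. sig i x)"
  have "nrm x = sig 1 x * y"
    unfolding nrm_def y_def using l_ge_3 by (subst prod.remove[of _ 1]) auto
  then have "nrm x = x * y" using sig_1 assms by simp
  then have "inverse x = y * inverse (nrm x)" using nrm_nz[OF assms False] False by (simp add: field_simps)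
  moreover have "y \<in> K" unfolding y_def using assms G_not_dvd by (intro K_prod sig_K) auto
  moreover have "inverse (nrm x) \<in> K" using nrm_Rats[OF assms] by (intro K_Rats) simp
  ultimately show ?thesis by (simp add: K_mult)
qed simp

lemma K_divide [intro]: "x \<in> K \<Longrightarrow> y \<in> K \<Longrightarrow> x / y \<in> K"
  by (simp add: divide_inverse K_mult K_inverse)

lemma sig_divide: "\<not> l dvd i \<Longrightarrow> x \<in> K \<Longrightarrow> y \<in> K \<Longrightarrow> sig i (x / y) = sig i x / sig i y"
proof (cases "y = 0")
  case False
  assume a: "\<not> l dvd i" "x \<in> K" "y \<in> K"
  then have "sig i (x / y) * sig i y = sig i x"
    using False by (simp flip: sig_mult add: K_divide)
  moreover have "sig i y \<noteq> 0" using sig_inj a False by blast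
  ultimately show ?thesis by (simp add: field_simps)
qed simp


section \<open>Integral coordinates\<close>

definition A :: "complex set" where "A = {x \<in> K. algebraic_int x}"

lemma A_K: "x \<in> A \<Longrightarrow> x \<in> K"
  by (simp add: A_def)

lemma A_add [intro]: "x \<in> A \<Longrightarrow> y \<in> A \<Longrightarrow> x + y \<in> A"
  and A_mult [intro]: "x \<in> A \<Longrightarrow> y \<in> A \<Longrightarrow> x * y \<in> A"
  and A_diff [intro]: "x \<in> A \<Longrightarrow> y \<in> A \<Longrightarrow> x - y \<in> A"
  and A_minus [intro]: "x \<in> A \<Longrightarrow> - x \<in> A"
  and A_power [intro]: "x \<in> A \<Longrightarrow> x ^ m \<in> A"
  by (auto simp: A_def K_power algebraic_int_add algebraic_int_mult algebraic_int_diff algebraic_int_power)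

lemma A_sum: "(\<And>i. i \<in> I \<Longrightarrow> f i \<in> A) \<Longrightarrow> (\<Sum>i\<in>I. f i) \<in> A"
  and A_prod: "(\<And>i. i \<in> I \<Longrightarrow> f i \<in> A) \<Longrightarrow> (\<Prod>i\<in>I. f i) \<in> A"
  by (auto simp: A_def K_sum K_prod algebraic_int_sum algebraic_int_prod)

lemma A_zeta_power [intro]: "z ^ m \<in> A"
  by (simp add: A_def K_zeta_power algebraic_int_power algebraic_int_zeta)

lemma A_simps [simp]: "0 \<in> A" "1 \<in> A" "of_nat m \<in> A" "of_int k \<in> A" "numeral w \<in> A"
  by (simp_all add: A_def)

lemma A_sig: "\<not> l dvd i \<Longrightarrow> x \<in> A \<Longrightarrow> sig i x \<in> A"
  by (simp add: A_def sig_K sig_algebraic_int)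

lemma A_cnj: "x \<in> A \<Longrightarrow> cnj x \<in> A"
  by (auto simp: A_def K_cnj)

lemma A_Rats_Ints: "x \<in> A \<Longrightarrow> x \<in> \<rat> \<Longrightarrow> x \<in> \<int>"
  by (auto simp: A_def rational_algebraic_int_is_int)

lemma tr_A: "x \<in> A \<Longrightarrow> tr x \<in> A"
  unfolding tr_def using G_not_dvd by (intro A_sum A_sig) auto

lemma tr_Ints: "x \<in> A \<Longrightarrow> tr x \<in> \<int>"
  by (intro A_Rats_Ints tr_A tr_Rats A_K)

lemma nrm_Ints: "x \<in> A \<Longrightarrow> nrm x \<in> \<int>"
proof (intro A_Rats_Ints nrm_Rats A_K)
  assume "x \<in> A"
  then show "nrm x \<in> A" unfolding nrm_def using G_not_dvd by (intro A_prod A_sig) auto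
qed

lemma tr_add: "x \<in> K \<Longrightarrow> y \<in> K \<Longrightarrow> tr (x + y) = tr x + tr y"
  unfolding tr_def using G_not_dvd by (simp add: sig_add sum.distrib)

lemma tr_minus: "x \<in> K \<Longrightarrow> tr (- x) = - tr x"
  unfolding tr_def using G_not_dvd by (simp add: sig_minus sum_negf)

lemma tr_mult_Rats: "q \<in> \<rat> \<Longrightarrow> x \<in> K \<Longrightarrow> tr (q * x) = q * tr x"
  unfolding tr_def using G_not_dvd by (simp add: sig_mult K_Rats sig_Rats sum_distrib_left)

lemma tr_sum: "(\<And>j. j \<in> J \<Longrightarrow> f j \<in> K) \<Longrightarrow> tr (\<Sum>j\<in>J. f j) = (\<Sum>j\<in>J. tr (f j))"
proof (induction J rule: infinite_finite_induct)
  case (insert j J)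
  then show ?case by (simp add: tr_add K_sum)
qed (simp_all add: tr_def G_not_dvd)

lemma tr_zeta_power: "tr (z ^ m) = (if l dvd m then of_nat l - 1 else -1)"
proof -
  have "tr (z ^ m) = (\<Sum>i\<in>G. z ^ (m * i))"
    unfolding tr_def using G_not_dvd by (intro sum.cong) (auto simp: sig_zeta_power mult.commute)
  then show ?thesis by (simp only: sum_zeta_powers_nonzero)
qed

lemma tr_sig:
  assumes "\<not> l dvd i" "x \<in> K"
  shows "tr (sig i x) = tr x"
proof -
  have "tr (sig i x) = (\<Sum>j\<in>G. sig (i * j) x)"
    unfolding tr_def using assms G_not_dvd
    by (intro sum.cong) (auto simp: sig_sig mult.commute)
  also have "\<dots> = tr x"
    unfolding tr_def using assms by (intro sum_mult_G) (auto simp: sig_mod)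
  finally show ?thesis .
qed

text \<open>\<open>co j x / l\<close> is the coefficient of \<open>\<zeta>\<^sup>j\<close> in the expansion of \<open>x\<close> with respect to the basis
  \<open>\<zeta>, \<dots>, \<zeta>\<^bsup>l - 1\<^esup>\<close>.\<close>

definition co :: "nat \<Rightarrow> complex \<Rightarrow> complex"
  where "co j x = tr (x * z ^ ((l - 1) * j)) - tr x"

lemma co_add: "x \<in> K \<Longrightarrow> y \<in> K \<Longrightarrow> co j (x + y) = co j x + co j y"
  by (simp add: co_def distrib_right tr_add K_mult K_zeta_power)

lemma co_minus: "x \<in> K \<Longrightarrow> co j (- x) = - co j x"
  by (simp add: co_def tr_minus K_mult K_zeta_power)

lemma co_diff: "x \<in> K \<Longrightarrow> y \<in> K \<Longrightarrow> co j (x - y) = co j x - co j y"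
  using co_add[of x "- y"] by (simp add: co_minus K_minus)

lemma co_mult_Rats: "q \<in> \<rat> \<Longrightarrow> x \<in> K \<Longrightarrow> co j (q * x) = q * co j x"
  by (simp add: co_def mult.assoc tr_mult_Rats K_mult K_zeta_power algebra_simps)

lemma co_sum: "(\<And>i. i \<in> I \<Longrightarrow> f i \<in> K) \<Longrightarrow> co j (\<Sum>i\<in>I. f i) = (\<Sum>i\<in>I. co j (f i))"
  by (simp add: co_def sum_distrib_right tr_sum K_mult K_zeta_power sum_subtractf)

lemma co_Ints: "x \<in> A \<Longrightarrow> co j x \<in> \<int>"
  unfolding co_def by (intro Ints_diff tr_Ints A_mult A_zeta_power)

lemma co_cong: "j mod l = k mod l \<Longrightarrow> co j x = co k x"
proof -
  assume "j mod l = k mod l"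
  then have "((l - 1) * j) mod l = ((l - 1) * k) mod l" by (metis mod_mult_right_eq)
  then show ?thesis unfolding co_def using zeta_power_cong by metis
qed

lemma co_mod: "co (j mod l) x = co j x"
  by (rule co_cong) simp

lemma co_sig:
  assumes "\<not> l dvd i" "x \<in> K"
  shows "co (i * j) (sig i x) = co j x"
proof -
  have "sig i (x * z ^ ((l - 1) * j)) = sig i x * z ^ ((l - 1) * (i * j))"
    using assms by (simp add: sig_mult K_zeta_power sig_zeta_power mult_ac)
  then have "tr (sig i x * z ^ ((l - 1) * (i * j))) = tr (x * z ^ ((l - 1) * j))"
    using tr_sig[of i "x * z ^ ((l - 1) * j)"] assms by (simp add: K_mult K_zeta_power)
  then show ?thesis using assms by (simp add: co_def tr_sig)
qed

lemma dvd_add_l_minus_1: "l dvd i + (l - 1) * j \<longleftrightarrow> i mod l = j mod l"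
proof -
  have "int (i + (l - 1) * j) = int i - int j + int l * int j"
    using l_ge_3 by (cases l) (auto simp: algebra_simps)
  then have "l dvd i + (l - 1) * j \<longleftrightarrow> int l dvd int i - int j"
    by (metis dvd_add_times_triv_right_iff int_dvd_int_iff mult.commute)
  also have "\<dots> \<longleftrightarrow> i mod l = j mod l"
    by (metis mod_eq_dvd_iff of_nat_eq_iff zmod_int)
  finally show ?thesis .
qed

lemma co_zeta_power:
  assumes "\<not> l dvd i"
  shows "co j (z ^ i) = (if i mod l = j mod l then of_nat l else 0)"
  using assms by (simp add: co_def tr_zeta_power dvd_add_l_minus_1 flip: power_add)

lemma co_expansion:
  assumes "x \<in> K"
  shows "(\<Sum>j\<in>G. co j x * z ^ j) = of_nat l * x"
proof -
  have "(\<Sum>j<l. co j x * z ^ j) = (\<Sum>j<l. tr (x * z ^ ((l - 1) * j)) * z ^ j) - tr x * (\<Sum>j<l. z ^ j)"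
    by (simp add: co_def left_diff_distrib sum_subtractf sum_distrib_left)
  also have "(\<Sum>j<l. z ^ j) = 0"
    using sum_zeta_powers[of 1] l_ge_3 by simp
  also have "(\<Sum>j<l. tr (x * z ^ ((l - 1) * j)) * z ^ j)
      = (\<Sum>j<l. \<Sum>i\<in>G. sig i x * z ^ ((1 + (l - 1) * i) * j))"
    unfolding tr_def sum_distrib_right using assms G_not_dvd
    by (intro sum.cong) (auto simp: sig_mult K_zeta_power sig_zeta_power power_add[symmetric] algebra_simps)
  also have "\<dots> = (\<Sum>i\<in>G. sig i x * (\<Sum>j<l. z ^ ((1 + (l - 1) * i) * j)))"
    by (subst sum.swap) (simp add: sum_distrib_left)
  also have "\<dots> = (\<Sum>i\<in>G. if i = 1 then of_nat l * x else 0)"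
    unfolding sum_zeta_powers dvd_add_l_minus_1
    using l_ge_3 sig_1[OF assms] by (intro sum.cong) auto
  also have "\<dots> = of_nat l * x" using l_ge_3 by simp
  finally have "(\<Sum>j<l. co j x * z ^ j) = of_nat l * x" by simp
  moreover have "co 0 x = 0" by (simp add: co_def)
  ultimately show ?thesis unfolding atLeast1_lessThan_l by simp
qed

lemma tr_co: "x \<in> K \<Longrightarrow> of_nat l * tr x = - (\<Sum>j\<in>G. co j x)"
proof -
  assume x: "x \<in> K"
  have coR: "co j x \<in> \<rat>" for j
    unfolding co_def using x by (intro Rats_diff tr_Rats K_mult K_zeta_power)
  have "of_nat l * tr x = tr (\<Sum>j\<in>G. co j x * z ^ j)"
    using x by (simp add: co_expansion tr_mult_Rats)
  also have "\<dots> = (\<Sum>j\<in>G. co j x * tr (z ^ j))"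
    using coR by (simp add: tr_sum K_mult K_Rats K_zeta_power tr_mult_Rats)
  also have "\<dots> = (\<Sum>j\<in>G. - co j x)"
    using G_not_dvd by (intro sum.cong) (auto simp: tr_zeta_power)
  finally show ?thesis by (simp add: sum_negf)
qed

text \<open>The coordinate as an \<open>int\<close>, for congruences and integer matrices. On
  \<open>A\<close> the coordinate is an integer, so the floor of the real part is exact
  there.\<close>

definition ci :: "nat \<Rightarrow> complex \<Rightarrow> int" where "ci j x = \<lfloor>Re (co j x)\<rfloor>"

lemma of_int_ci: "x \<in> A \<Longrightarrow> of_int (ci j x) = co j x"
  using co_Ints[of x j] by (auto simp: ci_def elim!: Ints_cases)

lemma ci_eqI: "co j x = of_int k \<Longrightarrow> ci j x = k"
  by (simp add: ci_def)

lemma ci_add: "x \<in> A \<Longrightarrow> y \<in> A \<Longrightarrow> ci j (x + y) = ci j x + ci j y"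
  by (rule ci_eqI) (simp add: co_add A_K of_int_ci)

lemma ci_diff: "x \<in> A \<Longrightarrow> y \<in> A \<Longrightarrow> ci j (x - y) = ci j x - ci j y"
  by (rule ci_eqI) (simp add: co_diff A_K of_int_ci)

lemma ci_sum: "(\<And>i. i \<in> I \<Longrightarrow> f i \<in> A) \<Longrightarrow> ci j (\<Sum>i\<in>I. f i) = (\<Sum>i\<in>I. ci j (f i))"
  by (rule ci_eqI) (simp add: co_sum A_K of_int_ci)

lemma ci_mult_int: "x \<in> A \<Longrightarrow> ci j (of_int k * x) = k * ci j x"
  by (rule ci_eqI) (simp add: co_mult_Rats A_K of_int_ci)

lemma ci_mod: "ci (j mod l) x = ci j x"
  by (simp add: ci_def co_mod)

lemma ci_cong: "j mod l = k mod l \<Longrightarrow> ci j x = ci k x"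
  by (metis ci_mod)

lemma ci_sig: "\<not> l dvd i \<Longrightarrow> x \<in> A \<Longrightarrow> ci (i * j) (sig i x) = ci j x"
  by (rule ci_eqI) (simp add: co_sig A_K of_int_ci)

lemma ci_cnj: "x \<in> A \<Longrightarrow> j \<in> G \<Longrightarrow> ci (l - j) (cnj x) = ci j x"
proof -
  assume x: "x \<in> A" and j: "j \<in> G"
  have "((l - 1) * j) mod l = (l - j) mod l"
  proof -
    have "(l - 1) * j = (l - j) + l * (j - 1)"
      using j l_ge_3 by (cases j) (auto simp: algebra_simps One_nat_def)
    then show ?thesis by simp
  qed
  then have "ci (l - j) (cnj x) = ci ((l - 1) * j) (sig (l - 1) x)"
    using ci_cong sig_cnj x A_K by metis
  then show ?thesis using ci_sig l_minus_1 x by simp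
qed

lemma ci_zeta_power:
  "\<not> l dvd i \<Longrightarrow> ci j (z ^ i) = (if i mod l = j mod l then int l else 0)"
  by (rule ci_eqI) (simp add: co_zeta_power)

lemma tr_ci: "x \<in> A \<Longrightarrow> of_nat l * tr x = of_int (- (\<Sum>j\<in>G. ci j x))"
  using tr_co[OF A_K, of x] by (simp add: of_int_ci)

definition divA :: "nat \<Rightarrow> complex \<Rightarrow> bool"
  where "divA m x \<longleftrightarrow> (\<exists>t\<in>A. x = of_nat m * t)"

lemma divA_A: "divA m x \<Longrightarrow> x \<in> A"
  by (auto simp: divA_def)

lemma divA_K: "divA m x \<Longrightarrow> x \<in> K"
  by (auto dest: divA_A A_K)

lemma divA_add: "divA m x \<Longrightarrow> divA m y \<Longrightarrow> divA m (x + y)"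
  unfolding divA_def by (metis A_add distrib_left)

lemma divA_minus: "divA m x \<Longrightarrow> divA m (- x)"
  unfolding divA_def by (metis A_minus mult_minus_right)

lemma divA_diff: "divA m x \<Longrightarrow> divA m y \<Longrightarrow> divA m (x - y)"
  using divA_add[OF _ divA_minus] by simp

lemma divA_mult: "divA m x \<Longrightarrow> y \<in> A \<Longrightarrow> divA m (x * y)"
  unfolding divA_def by (metis A_mult mult.assoc)

lemma divA_mult': "divA m x \<Longrightarrow> y \<in> A \<Longrightarrow> divA m (y * x)"
  using divA_mult by (simp add: mult.commute)

lemma divA_0 [simp]: "divA m 0"
  unfolding divA_def by (intro bexI[of _ 0]) simp_all

lemma divA_I [intro]: "t \<in> A \<Longrightarrow> divA m (of_nat m * t)"
  by (auto simp: divA_def)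

lemma divA_of_dvd: "m dvd k \<Longrightarrow> t \<in> A \<Longrightarrow> divA m (of_nat k * t)"
  unfolding divA_def by (elim dvdE) (auto intro!: bexI[of _ "of_nat _ * t"] simp: mult.assoc)

lemma divA_dvd: "m dvd k \<Longrightarrow> divA k x \<Longrightarrow> divA m x"
  unfolding divA_def[of k] using divA_of_dvd by blast

lemma divA_sum: "(\<And>i. i \<in> I \<Longrightarrow> divA m (f i)) \<Longrightarrow> divA m (\<Sum>i\<in>I. f i)"
  by (induction I rule: infinite_finite_induct) (simp_all add: divA_add)

lemma divA_sig: "\<not> l dvd i \<Longrightarrow> divA m x \<Longrightarrow> divA m (sig i x)"
  unfolding divA_def using sig_mult[of i "of_nat m"] A_sig A_K by (metis K_simps(3) sig_consts(3))

lemma divA_cnj: "divA m x \<Longrightarrow> divA m (cnj x)"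
  using divA_sig[OF l_minus_1(1)] divA_K sig_cnj by metis

lemma divA_tr: "divA m x \<Longrightarrow> divA m (tr x)"
  unfolding tr_def using G_not_dvd by (intro divA_sum divA_sig) auto

lemma divA_mult_both: "m > 0 \<Longrightarrow> divA (m * k) (of_nat m * x) \<longleftrightarrow> divA k x"
  unfolding divA_def by (auto simp: mult.assoc)

lemma divA_cancel_coprime:
  assumes "coprime k m" "divA m (of_nat k * x)" "x \<in> A"
  shows "divA m x"
proof -
  obtain u v where uv: "u * int k + v * int m = 1"
    using assms(1) bezout_int[of "int k" "int m"] by (auto simp: coprime_iff_gcd_eq_1)
  have "x = of_int (u * int k + v * int m) * x" by (simp add: uv)
  also have "\<dots> = of_int u * (of_nat k * x) + of_nat m * (of_int v * x)"
    by (simp add: algebra_simps)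
  finally have x: "x = of_int u * (of_nat k * x) + of_nat m * (of_int v * x)" .
  have "divA m (of_int u * (of_nat k * x))"
    by (rule divA_mult'[OF assms(2)]) simp
  moreover have "divA m (of_nat m * (of_int v * x))"
    by (rule divA_I) (simp add: A_mult assms(3))
  ultimately show ?thesis by (subst x) (rule divA_add)
qed

lemma divA_Ints: 
  assumes "m > 0" shows "divA m (of_int k) \<longleftrightarrow> int m dvd k"
proof
  assume "divA m (of_int k)"
  then obtain t where t: "t \<in> A" "of_int k = of_nat m * t" by (auto simp: divA_def)
  then have "t = of_int k / of_nat m" using assms by (simp add: field_simps)
  then have "t \<in> \<rat>" by simp
  then obtain j where "t = of_int j" using A_Rats_Ints[OF t(1)] by (auto elim: Ints_cases)
  then have "of_int k = (of_int (int m * j) :: complex)" using t by simp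
  then have "k = int m * j" using of_int_eq_iff by blast
  then show "int m dvd k" by simp
next
  assume "int m dvd k"
  then obtain j where "k = int m * j" by (auto elim: dvdE)
  then show "divA m (of_int k)" by (auto simp: divA_def intro!: bexI[of _ "of_int j"])
qed

text \<open>By \<open>co_expansion\<close> the coordinates describe l x rather than x; as l is prime
  to \<open>m\<close>, nothing is lost modulo \<open>m\<close>.\<close>

lemma divA_iff_ci:
  assumes m: "coprime l m" "m > 0" and x: "x \<in> A"
  shows "divA m x \<longleftrightarrow> (\<forall>j\<in>G. int m dvd ci j x)"
proof
  assume "divA m x"
  then obtain t where t: "t \<in> A" "x = of_nat m * t" by (auto simp: divA_def)
  then have "ci j x = int m * ci j t" for j using ci_mult_int[of t j "int m"] by simp
  then show "\<forall>j\<in>G. int m dvd ci j x" by simp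
next
  assume a: "\<forall>j\<in>G. int m dvd ci j x"
  have "divA m (co j x * z ^ j)" if "j \<in> G" for j
    using a that m by (intro divA_mult) (auto simp: of_int_ci[OF x, symmetric] divA_Ints)
  then have "divA m (of_nat l * x)"
    unfolding co_expansion[OF A_K[OF x], symmetric] by (intro divA_sum)
  then show "divA m x" using divA_cancel_coprime m x by blast
qed

end


section \<open>The operator T and its matrix\<close>

text \<open>Over a finite residue ring an injective matrix is surjective, hence has a right inverse.\<close>

lemma prime_dvd_det_iff:
  fixes M :: "int mat"
  assumes M: "M \<in> carrier_mat n n" and p: "Factorial_Ring.prime (p :: nat)"
  shows "\<not> int p dvd Determinant.det M \<longleftrightarrow>
    (\<forall>v\<in>carrier_vec n. (\<forall>i<n. int p dvd (M *\<^sub>v v) $ i) \<longrightarrow> (\<forall>i<n. int p dvd v $ i))"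
proof
  assume nd: "\<not> int p dvd Determinant.det M"
  show "\<forall>v\<in>carrier_vec n. (\<forall>i<n. int p dvd (M *\<^sub>v v) $ i) \<longrightarrow> (\<forall>i<n. int p dvd v $ i)"
  proof (intro ballI impI allI)
    fix v i assume v: "v \<in> carrier_vec n" and d: "\<forall>i<n. int p dvd (M *\<^sub>v v) $ i" and i: "i < n"
    \<comment> \<open>This direction is Cramer's rule: \<open>det M\<close> times \<open>v\<close>
      equals \<open>adj_mat M\<close> applied to \<open>M v\<close>, whose entries p
      divides.\<close>
    have adj: "adj_mat M \<in> carrier_mat n n" "adj_mat M * M = Determinant.det M \<cdot>\<^sub>m 1\<^sub>m n"
      using adj_mat[OF M] by auto
    have "adj_mat M *\<^sub>v (M *\<^sub>v v) = (Determinant.det M \<cdot>\<^sub>m 1\<^sub>m n) *\<^sub>v v"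
      using adj M v by (metis assoc_mult_mat_vec)
    also have "\<dots> = Determinant.det M \<cdot>\<^sub>v v"
    proof (rule eq_vecI)
      fix j assume "j < dim_vec (Determinant.det M \<cdot>\<^sub>v v)"
      then have j: "j < n" using v by simp
      have "((Determinant.det M \<cdot>\<^sub>m 1\<^sub>m n) *\<^sub>v v) $ j
          = (\<Sum>k<n. Determinant.det M * (if k = j then 1 else 0) * v $ k)"
        using j v by (simp add: scalar_prod_def atLeast0LessThan)
      also have "\<dots> = (\<Sum>k<n. if k = j then Determinant.det M * v $ k else 0)"
        by (rule sum.cong) auto
      finally have "((Determinant.det M \<cdot>\<^sub>m 1\<^sub>m n) *\<^sub>v v) $ j
          = (\<Sum>k<n. if k = j then Determinant.det M * v $ k else 0)" .
      then show "((Determinant.det M \<cdot>\<^sub>m 1\<^sub>m n) *\<^sub>v v) $ j = (Determinant.det M \<cdot>\<^sub>v v) $ j"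
        using j v by simp
    qed (use v in simp)
    finally have "Determinant.det M * v $ i = (adj_mat M *\<^sub>v (M *\<^sub>v v)) $ i"
      using i v by simp
    also have "\<dots> = (\<Sum>j<n. adj_mat M $$ (i, j) * (M *\<^sub>v v) $ j)"
      using adj(1) i M by (auto simp: scalar_prod_def atLeast0LessThan intro!: sum.cong)
    also have "int p dvd \<dots>"
      using d by (intro dvd_sum dvd_mult) auto
    finally show "int p dvd v $ i"
      using nd p by (simp add: prime_dvd_mult_iff)
  qed
next
  assume inj: "\<forall>v\<in>carrier_vec n. (\<forall>i<n. int p dvd (M *\<^sub>v v) $ i) \<longrightarrow> (\<forall>i<n. int p dvd v $ i)"
  have p0: "int p > 0" using p prime_gt_0_nat by simp
  \<comment> \<open>A finite model of (Z/p)^n by reduced representatives. \<open>F\<close> is the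
    map given by \<open>M\<close> on it, so injectivity yields surjectivity by counting.\<close>
  define Y where "Y = {..<n} \<rightarrow>\<^sub>E {0..<int p}"
  have finY: "finite Y" by (simp add: Y_def finite_PiE)
  define F where "F = (\<lambda>x. \<lambda>i\<in>{..<n}. (M *\<^sub>v Matrix.vec n x) $ i mod int p)"
  have FY: "F ` Y \<subseteq> Y"
    unfolding F_def Y_def using p0 by (intro image_subsetI PiE_I) auto
  have Mv: "(M *\<^sub>v Matrix.vec n x) $ i = (\<Sum>j<n. M $$ (i, j) * x j)" if "i < n" for x i
    using M that by (auto simp: scalar_prod_def atLeast0LessThan intro!: sum.cong)
  have "inj_on F Y"
  proof (rule inj_onI)
    fix x y assume xy: "x \<in> Y" "y \<in> Y" "F x = F y"
    have "int p dvd (M *\<^sub>v Matrix.vec n (\<lambda>j. x j - y j)) $ i" if "i < n" for i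
    proof -
      have "(M *\<^sub>v Matrix.vec n x) $ i mod int p = (M *\<^sub>v Matrix.vec n y) $ i mod int p"
        using fun_cong[OF xy(3), of i] that by (simp add: F_def)
      then have "int p dvd (M *\<^sub>v Matrix.vec n x) $ i - (M *\<^sub>v Matrix.vec n y) $ i" by (simp add: mod_eq_dvd_iff)
      then show ?thesis using that by (simp add: Mv right_diff_distrib sum_subtractf)
    qed
    then have "\<forall>i<n. int p dvd Matrix.vec n (\<lambda>j. x j - y j) $ i"
      using bspec[OF inj, of "Matrix.vec n (\<lambda>j. x j - y j)"] by simp
    then have d: "int p dvd x i - y i" if "i < n" for i using that by simp
    show "x = y"
    proof
      fix i show "x i = y i"
      proof (cases "i < n")
        case True
        then have "x i \<in> {0..<int p}" "y i \<in> {0..<int p}"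
          using PiE_mem[OF xy(1)[unfolded Y_def]] PiE_mem[OF xy(2)[unfolded Y_def]] by auto
        moreover have "x i mod int p = y i mod int p" using d[OF True] by (simp add: mod_eq_dvd_iff)
        ultimately show ?thesis by simp
      next
        case False
        then show ?thesis
          using PiE_arb[OF xy(1)[unfolded Y_def], of i] PiE_arb[OF xy(2)[unfolded Y_def], of i] by simp
      qed
    qed
  qed
  then have surj: "F ` Y = Y" using endo_inj_surj[OF finY FY] by simp
  have "\<exists>x. \<forall>i<n. int p dvd (\<Sum>j<n. M $$ (i, j) * x j) - (if i = k then 1 else 0)" if "k < n" for k
  proof -
    define e where "e = (\<lambda>i\<in>{..<n}. if i = k then 1 else (0::int))"
    have "e \<in> Y" using p0 p prime_gt_1_nat[of p] by (auto simp: e_def Y_def)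
    then have "e \<in> F ` Y" using surj by simp
    then obtain x where "F x = e" by (elim imageE) simp
    have "(\<Sum>j<n. M $$ (i, j) * x j) mod int p = (if i = k then 1 else 0) mod int p" if "i < n" for i
      using fun_cong[OF \<open>F x = e\<close>, of i] that prime_gt_1_nat[OF p] by (simp add: F_def e_def Mv)
    then show ?thesis unfolding mod_eq_dvd_iff by (intro exI[of _ x]) simp
  qed
  then obtain B where B: "\<And>k i. k < n \<Longrightarrow> i < n \<Longrightarrow>
      int p dvd (\<Sum>j<n. M $$ (i, j) * B k j) - (if i = k then 1 else 0)"
    by metis
  \<comment> \<open>Column k of \<open>C\<close> is a preimage of the k-th unit vector; hence
    \<open>M * C\<close> is the identity modulo p and \<open>det M\<close> is invertible modulo
    p.\<close>
  define C where "C = Matrix.mat n n (\<lambda>(j, k). B k j)"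
  have C: "C \<in> carrier_mat n n" by (simp add: C_def)
  have MC: "M * C \<in> carrier_mat n n" using M C by simp
  have ent: "[(M * C) $$ (i, k) = 1\<^sub>m n $$ (i, k)] (mod int p)" if "i < n" "k < n" for i k
  proof -
    have "(M * C) $$ (i, k) = (\<Sum>j<n. M $$ (i, j) * B k j)"
      using M that by (auto simp: C_def scalar_prod_def atLeast0LessThan intro!: sum.cong)
    then show ?thesis using B[OF that(2,1)] that by (simp add: cong_iff_dvd_diff)
  qed
  have "[Determinant.det (M * C) = Determinant.det (1\<^sub>m n)] (mod int p)"
    unfolding det_def'[OF MC] det_def'[OF one_carrier_mat]
    by (intro cong_sum cong_mult cong_refl cong_prod ent) (auto dest: permutes_in_image)
  then have "[Determinant.det M * Determinant.det C = 1] (mod int p)"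
    by (simp add: det_mult[OF M C])
  then show "\<not> int p dvd Determinant.det M"
    using p by (metis cong_dvd_iff dvd_mult2 not_prime_unit prime_nat_int_transfer)
qed

locale cyclo_p = cyclo +
  fixes p :: nat
  assumes prime_p: "Factorial_Ring.prime p" and odd_p: "odd p" and p_ne_l: "p \<noteq> l"
    and p_half: "\<not> p dvd half l"
begin

definition n :: nat where "n = half l"

lemma l_eq: "l = 2 * n + 1" "n \<ge> 1"
  using odd l_ge_3 by (auto simp: n_def elim!: oddE)

lemma p_pos: "p > 0" "p \<ge> 3"
  using prime_p odd_p prime_ge_2_nat[of p] by (auto simp: prime_gt_0_nat) (cases "p = 2", auto)

lemma coprime_l_p: "coprime l p" "coprime p l"
  using prime prime_p p_ne_l primes_coprime by auto

lemma coprime_2_p: "coprime 2 p"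
  using odd_p by simp

lemma G_split: "G = {1..n} \<union> (\<lambda>i. l - i) ` {1..n}" "{1..n} \<inter> (\<lambda>i. l - i) ` {1..n} = {}"
proof -
  have "i \<in> (\<lambda>i. l - i) ` {1..n}" if "i \<in> G" "i > n" for i
    using that l_eq by (intro image_eqI[of _ _ "l - i"]) auto
  then show "G = {1..n} \<union> (\<lambda>i. l - i) ` {1..n}" using l_eq by force
  show "{1..n} \<inter> (\<lambda>i. l - i) ` {1..n} = {}" using l_eq by auto
qed

lemma sum_G_split: "(\<Sum>i\<in>G. f i) = (\<Sum>i=1..n. f i + f (l - i))"
proof -
  have "inj_on (\<lambda>i. l - i) {1..n}" using l_eq by (auto simp: inj_on_def)
  then show ?thesis
    using G_split by (simp add: sum.union_disjoint sum.reindex sum.distrib)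
qed

definition iinv :: "nat \<Rightarrow> nat" where "iinv i = (SOME j. j \<in> G \<and> (i * j) mod l = 1)"

lemma iinv: assumes "\<not> l dvd i"
  shows "iinv i \<in> G" "(i * iinv i) mod l = 1" "(iinv i * i) mod l = 1" "\<not> l dvd iinv i"
proof -
  have "\<exists>j. j \<in> G \<and> (i * j) mod l = 1" using G_inverse[OF assms] by blast
  then show 1: "iinv i \<in> G" and 2: "(i * iinv i) mod l = 1"
    unfolding iinv_def using someI_ex[of "\<lambda>j. j \<in> G \<and> (i * j) mod l = 1"] by blast+
  show "(iinv i * i) mod l = 1" using 2 by (simp add: mult.commute)
  show "\<not> l dvd iinv i" using 1 G_not_dvd by blast
qed

definition T :: "complex \<Rightarrow> complex" where "T x = (\<Sum>i=1..n. sig (iinv i) x)"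

lemma n_G: "i \<in> {1..n} \<Longrightarrow> i \<in> G" "i \<in> {1..n} \<Longrightarrow> l - i \<in> G"
  using l_eq by auto

lemma iinv_n: "i \<in> {1..n} \<Longrightarrow> \<not> l dvd iinv i"
  using n_G G_not_dvd iinv(4) by blast

lemma T_A: "x \<in> A \<Longrightarrow> T x \<in> A"
  unfolding T_def using iinv_n by (intro A_sum A_sig)

lemma T_diff: "x \<in> K \<Longrightarrow> y \<in> K \<Longrightarrow> T (x - y) = T x - T y"
  unfolding T_def using iinv_n by (simp add: sig_diff sum_subtractf)

lemma T_cnj: "x \<in> K \<Longrightarrow> T (cnj x) = cnj (T x)"
proof -
  assume x: "x \<in> K"
  have "sig (iinv i) (cnj x) = cnj (sig (iinv i) x)" if "i \<in> {1..n}" for i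
  proof -
    have "sig (iinv i) (cnj x) = sig (iinv i * (l - 1)) x"
      using sig_sig[OF iinv_n[OF that] l_minus_1(1) x] by (simp add: sig_cnj[OF x])
    also have "\<dots> = cnj (sig (iinv i) x)"
      using sig_sig[OF l_minus_1(1) iinv_n[OF that] x] sig_cnj[OF sig_K[OF iinv_n[OF that] x]]
      by (simp add: mult.commute)
    finally show ?thesis .
  qed
  then show ?thesis by (simp add: T_def)
qed

lemma divA_T: "divA m x \<Longrightarrow> divA m (T x)"
  unfolding T_def using iinv_n by (intro divA_sum divA_sig)

lemma mult_eq_cong: "\<not> l dvd a \<Longrightarrow> (a * x) mod l = 1 \<Longrightarrow> (a * y) mod l = 1 \<Longrightarrow> x mod l = y mod l"
proof -
  assume a: "\<not> l dvd a" "(a * x) mod l = 1" "(a * y) mod l = 1"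
  have "coprime a l" using a prime by (metis coprime_commute prime_imp_coprime)
  moreover have "[a * x = a * y] (mod l)" using a by (simp add: cong_def)
  ultimately have "[x = y] (mod l)" using cong_mult_lcancel_nat by blast
  then show ?thesis by (simp add: cong_def)
qed

lemma iinv_bij: "bij_betw iinv G G"
proof (rule bij_betw_imageI)
  have sub: "iinv ` G \<subseteq> G" using iinv G_not_dvd by blast
  show inj: "inj_on iinv G"
  proof (rule inj_onI)
    fix i j assume ij: "i \<in> G" "j \<in> G" "iinv i = iinv j"
    have "i mod l = j mod l"
      using iinv[OF G_not_dvd[OF ij(1)]] iinv[OF G_not_dvd[OF ij(2)]] ij(3)
      by (intro mult_eq_cong[of "iinv i"]) auto
    then show "i = j" using ij by simp
  qed
  show "iinv ` G = G" using endo_inj_surj[OF _ sub inj] by simp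
qed

text \<open>Inversion permutes \<open>G\<close>, so the trace may be summed over inverses. Pairing i
  with l - i, the inverse of -i is minus the inverse of i, and \<open>sig (l - 1)\<close> is complex
  conjugation.\<close>

lemma tr_T: "x \<in> K \<Longrightarrow> tr x = T x + T (cnj x)"
proof -
  assume x: "x \<in> K"
  have "tr x = (\<Sum>i\<in>G. sig (iinv i) x)"
    unfolding tr_def using sum.reindex_bij_betw[OF iinv_bij, of "\<lambda>i. sig i x"] by simp
  also have "\<dots> = (\<Sum>i=1..n. sig (iinv i) x + sig (iinv (l - i)) x)" by (rule sum_G_split)
  also have "\<dots> = (\<Sum>i=1..n. sig (iinv i) x + sig (iinv i) (cnj x))"
  proof (intro sum.cong refl arg_cong2[of _ _ _ _ "(+)"])
    fix i assume i: "i \<in> {1..n}"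
    have "(l - i) * ((l - 1) * iinv i) mod l = 1"
    proof -
      have "int ((l - i) * ((l - 1) * iinv i)) = int (i * iinv i) + int l * (int (iinv i) * (int l - 1 - int i))"
      proof -
        have "int (l - i) = int l - int i" "int (l - 1) = int l - 1"
          using i l_eq by (auto simp: of_nat_diff)
        then show ?thesis unfolding of_nat_mult by (simp only:) (simp add: algebra_simps)
      qed
      then have "int ((l - i) * ((l - 1) * iinv i)) mod int l = int (i * iinv i) mod int l" by simp
      then show ?thesis using iinv(2)[OF G_not_dvd[OF n_G(1)[OF i]]] by (metis of_nat_eq_iff zmod_int)
    qed
    then have "iinv (l - i) mod l = ((l - 1) * iinv i) mod l"
      using iinv[OF G_not_dvd[OF n_G(2)[OF i]]] G_not_dvd[OF n_G(2)[OF i]]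
      by (intro mult_eq_cong[of "l - i"]) auto
    then have "sig (iinv (l - i)) x = sig (iinv i * (l - 1)) x" by (intro sig_cong) (simp add: mult.commute)
    also have "\<dots> = sig (iinv i) (cnj x)"
      using sig_sig[OF iinv_n[OF i] l_minus_1(1) x] by (simp add: sig_cnj[OF x])
    finally show "sig (iinv (l - i)) x = sig (iinv i) (cnj x)" .
  qed
  finally show ?thesis by (simp add: T_def sum.distrib)
qed

text \<open>The entries of N_l with indices starting at 1, defined beyond n as well: the coordinates
  of \<open>T x\<close> run over all of \<open>G\<close> before symmetry is used.\<close>

definition N :: "nat \<Rightarrow> nat \<Rightarrow> int"
  where "N j a = (if (j * a) mod l \<in> {1..n} then 1 else 0)"

text \<open>With m the inverse of a, applying \<open>sig (iinv i)\<close> brings the coordinate at i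
  m to m. The substitution i = a j then turns the range 1..n of i into the condition that a j has
  its residue in 1..n, which is the entry \<open>N j a\<close>.\<close>

lemma ci_T:
  assumes x: "x \<in> A" and a: "\<not> l dvd a"
  shows "ci (iinv a) (T x) = (\<Sum>j\<in>G. N j a * ci j x)"
proof -
  define m where "m = iinv a"
  have m: "\<not> l dvd m" "(a * m) mod l = 1" using iinv[OF a] by (auto simp: m_def)
  have "ci m (T x) = (\<Sum>i=1..n. ci m (sig (iinv i) x))"
    unfolding T_def using x iinv_n A_sig by (intro ci_sum) auto
  also have "\<dots> = (\<Sum>i=1..n. ci (i * m) x)"
  proof (rule sum.cong)
    fix i assume i: "i \<in> {1..n}"
    have "(iinv i * (i * m)) mod l = m mod l"
      using iinv(3)[OF G_not_dvd[OF n_G(1)[OF i]]]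
      by (metis mod_mult_left_eq mult.assoc mult_1)
    then have "ci m (sig (iinv i) x) = ci (iinv i * (i * m)) (sig (iinv i) x)"
      by (intro ci_cong) simp
    also have "\<dots> = ci (i * m) x" using ci_sig[OF iinv_n[OF i] x] .
    finally show "ci m (sig (iinv i) x) = ci (i * m) x" .
  qed simp
  also have "\<dots> = (\<Sum>i\<in>G. (if i mod l \<in> {1..n} then 1 else 0) * ci (i * m) x)"
  proof (rule sum.mono_neutral_cong_left)
    show "{1..n} \<subseteq> G" using n_G by blast
  qed (use l_eq in auto)
  also have "\<dots> = (\<Sum>j\<in>G. (if (a * j) mod l \<in> {1..n} then 1 else 0) * ci ((a * j) * m) x)"
    using a ci_cong[of "_ mod l * m" "_ * m" x] by (intro sum_mult_G[symmetric]) (auto simp: mod_mult_left_eq)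
  also have "\<dots> = (\<Sum>j\<in>G. N j a * ci j x)"
  proof (rule sum.cong)
    fix j assume "j \<in> G"
    have "((a * j) * m) mod l = j mod l"
      using m by (metis mod_mult_left_eq mult.assoc mult.commute mult_1)
    then have "ci ((a * j) * m) x = ci j x" by (rule ci_cong)
    then show "(if (a * j) mod l \<in> {1..n} then 1 else 0) * ci ((a * j) * m) x = N j a * ci j x"
      by (simp add: N_def mult.commute)
  qed simp
  finally show ?thesis by (simp add: m_def)
qed

text \<open>The residues of j a and (l - j) a are nonzero and add up to l = 2n + 1, so exactly one
  of them is at most n.\<close>

lemma N_neg: assumes "j \<in> {1..n}" "\<not> l dvd a" shows "N (l - j) a = 1 - N j a"
proof -
  have nd: "\<not> l dvd j * a" using assms n_G(1) G_not_dvd not_dvd_mult by blast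
  define r where "r = (j * a) mod l"
  have r: "r \<noteq> 0" "r < l" using nd l_ge_3 by (auto simp: r_def mod_eq_0_iff_dvd)
  have "(l - j) * a + j * a = l * a"
    using assms l_eq by (auto simp: algebra_simps simp flip: distrib_right)
  then have "((l - j) * a + j * a) mod l = 0" by simp
  then have "((l - j) * a mod l + r) mod l = 0" by (simp add: r_def mod_simps)
  then have "l dvd ((l - j) * a mod l + r)" by (simp add: mod_eq_0_iff_dvd)
  then obtain k where k: "(l - j) * a mod l + r = l * k" by (auto elim: dvdE)
  have "(l - j) * a mod l < l" using l_ge_3 by simp
  then have "l * k < l * 2" "l * k > 0" using k r by linarith+
  then have "k = 1" by simp
  then have "(l - j) * a mod l = l - r" using k by simp
  then show ?thesis using r l_eq by (auto simp: N_def r_def[symmetric])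
qed

lemma ci_T_odd:
  assumes x: "x \<in> A" and odd: "divA p (cnj x + x)" and a: "\<not> l dvd a"
  shows "[ci (iinv a) (T x) = (\<Sum>j=1..n. (2 * N j a - 1) * ci j x)] (mod int p)"
proof -
  have c: "[ci (l - j) x = - ci j x] (mod int p)" if j: "j \<in> {1..n}" for j
  proof -
    have "int p dvd ci (l - j) (cnj x + x)"
      using odd divA_iff_ci[OF coprime_l_p(1) p_pos(1) divA_A[OF odd]] n_G(2)[OF j] by blast
    then have "int p dvd ci j x + ci (l - j) x"
      using ci_cnj[OF x n_G(1)[OF j]] ci_add[OF A_cnj[OF x] x] by simp
    then show ?thesis by (simp add: cong_iff_dvd_diff add.commute)
  qed
  have "ci (iinv a) (T x) = (\<Sum>j=1..n. N j a * ci j x + N (l - j) a * ci (l - j) x)"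
    unfolding ci_T[OF x a] by (rule sum_G_split)
  also have "[\<dots> = (\<Sum>j=1..n. N j a * ci j x + (1 - N j a) * (- ci j x))] (mod int p)"
    using N_neg[OF _ a] c by (intro cong_sum cong_add cong_mult) auto
  also have "(\<Sum>j=1..n. N j a * ci j x + (1 - N j a) * (- ci j x)) = (\<Sum>j=1..n. (2 * N j a - 1) * ci j x)"
    by (simp add: algebra_simps)
  finally show ?thesis .
qed

lemma divA_T_odd_iff:
  assumes x: "x \<in> A" and odd: "divA p (cnj x + x)"
  shows "divA p (T x) \<longleftrightarrow> (\<forall>a\<in>{1..n}. int p dvd (\<Sum>j=1..n. N j a * ci j x))"
proof -
  define S where "S a = (\<Sum>j=1..n. N j a * ci j x)" for a
  define t where "t = (\<Sum>j=1..n. ci j x)"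
  have sum: "(\<Sum>j=1..n. (2 * N j a - 1) * ci j x) = 2 * S a - t" for a
    by (simp add: S_def t_def sum_distrib_left left_diff_distrib sum_subtractf mult.assoc)
  have cT: "int p dvd ci (iinv a) (T x) \<longleftrightarrow> int p dvd 2 * S a - t" if "\<not> l dvd a" for a
    using ci_T_odd[OF x odd that] unfolding sum by (rule cong_dvd_iff)
  have S1: "S 1 = t"
    unfolding S_def t_def using l_eq by (intro sum.cong) (auto simp: N_def)
  \<comment> \<open>Consequently 2 S(l - a) - t is the negative of 2 S(a) - t, so the rows beyond n
    repeat the conditions of the first n.\<close>
  have Sneg: "S (l - a) = t - S a" if a: "a \<in> {1..n}" for a
  proof -
    have "N j (l - a) = 1 - N j a" if "j \<in> {1..n}" for j
      using N_neg[OF a, of j] that n_G(1) G_not_dvd by (auto simp: N_def mult.commute)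
    then show ?thesis by (simp add: S_def t_def left_diff_distrib sum_subtractf)
  qed
  have dvd2: "int p dvd 2 * k \<longleftrightarrow> int p dvd k" for k
    using odd_p prime_p by (metis coprime_2_p coprime_commute coprime_dvd_mult_right_iff coprime_int_iff of_nat_numeral)
  have "divA p (T x) \<longleftrightarrow> (\<forall>m\<in>G. int p dvd ci m (T x))"
    by (rule divA_iff_ci[OF coprime_l_p(1) p_pos(1) T_A[OF x]])
  also have "\<dots> \<longleftrightarrow> (\<forall>m\<in>iinv ` G. int p dvd ci m (T x))"
    unfolding bij_betw_imp_surj_on[OF iinv_bij] ..
  also have "\<dots> \<longleftrightarrow> (\<forall>a\<in>G. int p dvd ci (iinv a) (T x))"
    by (rule ball_simps)
  also have "\<dots> \<longleftrightarrow> (\<forall>a\<in>G. int p dvd 2 * S a - t)"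
    using cT G_not_dvd by blast
  also have "\<dots> \<longleftrightarrow> (\<forall>a\<in>{1..n}. int p dvd S a)"
  proof
    assume L: "\<forall>a\<in>G. int p dvd 2 * S a - t"
    have "1 \<in> G" using l_ge_3 by simp
    then have "int p dvd 2 * S 1 - t" using L by blast
    then have t: "int p dvd t" by (simp add: S1)
    show "\<forall>a\<in>{1..n}. int p dvd S a"
    proof
      fix a assume "a \<in> {1..n}"
      then have "int p dvd 2 * S a - t" using L n_G by blast
      then have "int p dvd 2 * S a" using t by (metis dvd_add_left_iff diff_add_cancel)
      then show "int p dvd S a" using dvd2 by blast
    qed
  next
    assume R: "\<forall>a\<in>{1..n}. int p dvd S a"
    have t: "int p dvd t" using R S1 l_eq by force
    have "int p dvd S a" if "a \<in> G" for a
      using that R Sneg t unfolding G_split by auto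
    then show "\<forall>a\<in>G. int p dvd 2 * S a - t" using t by auto
  qed
  finally show ?thesis by (simp add: S_def)
qed

text \<open>An integer with prescribed coordinates 1, ..., n up to the factor l, even under
  conjugation for \<open>e = 1\<close> and odd for \<open>e = -1\<close>. It gives surjectivity of
  the coordinate maps on both parts.\<close>

definition build :: "int \<Rightarrow> (nat \<Rightarrow> int) \<Rightarrow> complex"
  where "build e c = (\<Sum>i=1..n. of_int (c i) * (z ^ i + of_int e * z ^ (l - i)))"

lemma build_A: "build e c \<in> A"
  unfolding build_def by (intro A_sum A_mult A_add) auto

lemma cnj_zeta_power: "i \<in> {1..n} \<Longrightarrow> cnj (z ^ i) = z ^ (l - i)"
  "i \<in> {1..n} \<Longrightarrow> cnj (z ^ (l - i)) = z ^ i"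
proof -
  assume i: "i \<in> {1..n}"
  have 1: "cnj (z ^ k) = z ^ (l - k)" if "k \<le> l" for k
  proof -
    have "z ^ (l - k) * z ^ k = 1" using that zeta_power_l by (simp flip: power_add)
    moreover have "cnj (z ^ k) * z ^ k = 1"
      unfolding complex_cnj_power cnj_zeta power_mult[symmetric] power_add[symmetric]
      using l_ge_3 by (simp add: zeta_power_eq_1_iff algebra_simps)
    ultimately show ?thesis using zeta_nz by (metis mult_right_cancel power_not_zero)
  qed
  show "cnj (z ^ i) = z ^ (l - i)" "cnj (z ^ (l - i)) = z ^ i"
    using 1[of i] 1[of "l - i"] i l_eq by auto
qed

lemma cnj_build: "e * e = 1 \<Longrightarrow> cnj (build e c) = of_int e * build e c"
proof -
  assume e: "e * e = 1"
  then have e': "of_int e * of_int e = (1 :: complex)" by (metis of_int_1 of_int_mult)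
  have "cnj (of_int (c i) * (z ^ i + of_int e * z ^ (l - i)))
      = of_int e * (of_int (c i) * (z ^ i + of_int e * z ^ (l - i)))" if "i \<in> {1..n}" for i
  proof -
    have "cnj (of_int (c i) * (z ^ i + of_int e * z ^ (l - i)))
        = of_int (c i) * (cnj (z ^ i) + of_int e * cnj (z ^ (l - i)))" by simp
    also have "\<dots> = of_int (c i) * (z ^ (l - i) + of_int e * z ^ i)"
      unfolding cnj_zeta_power[OF that] ..
    also have "\<dots> = of_int (c i) * (of_int e * of_int e * z ^ (l - i) + of_int e * z ^ i)"
      by (simp add: e')
    also have "\<dots> = of_int e * (of_int (c i) * (z ^ i + of_int e * z ^ (l - i)))"
      by (simp only: algebra_simps)
    finally show ?thesis .
  qed
  then show ?thesis unfolding build_def cnj_sum sum_distrib_left by (rule sum.cong[OF refl])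
qed

lemma ci_build: assumes j: "j \<in> {1..n}" shows "ci j (build e c) = int l * c j"
proof -
  have "ci j (build e c) = (\<Sum>i=1..n. ci j (of_int (c i) * (z ^ i + of_int e * z ^ (l - i))))"
    unfolding build_def by (intro ci_sum A_mult A_add) auto
  also have "\<dots> = (\<Sum>i=1..n. if i = j then int l * c j else 0)"
  proof (rule sum.cong)
    fix i assume i: "i \<in> {1..n}"
    have nd: "\<not> l dvd i" "\<not> l dvd l - i" using n_G[OF i] G_not_dvd by auto
    have "ci j (of_int (c i) * (z ^ i + of_int e * z ^ (l - i))) = c i * (ci j (z ^ i) + e * ci j (z ^ (l - i)))"
      by (simp add: ci_mult_int ci_add A_add A_mult A_zeta_power)
    also have "\<dots> = (if i = j then int l * c j else 0)"
      unfolding ci_zeta_power[OF nd(1)] ci_zeta_power[OF nd(2)] using i j l_eq by auto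
    finally show "ci j (of_int (c i) * (z ^ i + of_int e * z ^ (l - i))) = (if i = j then int l * c j else 0)" .
  qed simp
  also have "\<dots> = int l * c j" using j by simp
  finally show ?thesis .
qed

lemma tr_build: "tr (build 1 c) = of_int (- 2 * (\<Sum>i=1..n. c i))"
proof -
  have "tr (build 1 c) = (\<Sum>i=1..n. tr (of_int (c i) * (z ^ i + z ^ (l - i))))"
    unfolding build_def by (simp add: tr_sum K_mult K_add K_zeta_power)
  also have "\<dots> = (\<Sum>i=1..n. of_int (- 2 * c i))"
  proof (rule sum.cong)
    fix i assume i: "i \<in> {1..n}"
    have nd: "\<not> l dvd i" "\<not> l dvd l - i" using n_G[OF i] G_not_dvd by auto
    then show "tr (of_int (c i) * (z ^ i + z ^ (l - i))) = of_int (- 2 * c i)"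
      by (simp add: tr_mult_Rats tr_add K_add K_zeta_power tr_zeta_power)
  qed simp
  finally show ?thesis by (simp add: sum_distrib_left sum_negf)
qed

lemma odd_divA_iff:
  assumes x: "x \<in> A" and odd: "divA p (cnj x + x)"
  shows "divA p x \<longleftrightarrow> (\<forall>j\<in>{1..n}. int p dvd ci j x)"
proof -
  have "int p dvd ci (l - j) x \<longleftrightarrow> int p dvd ci j x" if j: "j \<in> {1..n}" for j
  proof -
    have "int p dvd ci (l - j) (cnj x + x)"
      using odd divA_iff_ci[OF coprime_l_p(1) p_pos(1) divA_A[OF odd]] n_G(2)[OF j] by blast
    then have "int p dvd ci j x + ci (l - j) x"
      using ci_cnj[OF x n_G(1)[OF j]] ci_add[OF A_cnj[OF x] x] by simp
    then show ?thesis by (metis dvd_add_right_iff add.commute)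
  qed
  then show ?thesis
    unfolding divA_iff_ci[OF coprime_l_p(1) p_pos(1) x] unfolding G_split(1) by auto
qed

text \<open>Modulo p, odd elements correspond to vectors through the coordinates 1, ..., n, and
  \<open>divA_T_odd_iff\<close> makes \<open>T\<close> the matrix N_l there. A vector v is realised
  by \<open>build (-1)\<close>, whose coordinates are l v; the factor l is invertible modulo
  p.\<close>

lemma det_N_iff_T_inj:
  "\<not> int p dvd Determinant.det (N_mat l) \<longleftrightarrow>
    (\<forall>x\<in>A. divA p (cnj x + x) \<longrightarrow> divA p (T x) \<longrightarrow> divA p x)"
proof -
  define M where "M = N_mat l"
  have M: "M \<in> carrier_mat n n" by (simp add: M_def N_mat_def n_def)
  have Mv: "(M *\<^sub>v v) $ a = (\<Sum>j=1..n. N j (a + 1) * v $ (j - 1))"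
    if "a < n" "v \<in> carrier_vec n" for a v
  proof -
    have "(M *\<^sub>v v) $ a = (\<Sum>j<n. N (j + 1) (a + 1) * v $ j)"
      using that by (auto simp: M_def N_mat_def n_def[symmetric] scalar_prod_def N_def
          atLeast0LessThan mult.commute intro!: sum.cong)
    also have "\<dots> = (\<Sum>j=1..n. N j (a + 1) * v $ (j - 1))"
      by (rule sum.reindex_bij_witness[of _ "\<lambda>j. j - 1" "\<lambda>j. j + 1"]) auto
    finally show ?thesis .
  qed
  have all: "(\<forall>a<n. P (a + 1)) \<longleftrightarrow> (\<forall>a\<in>{1..n}. P a)" for P
  proof safe
    fix a assume "\<forall>a<n. P (a + 1)" "a \<in> {1..n}"
    then show "P a" by (auto dest: spec[of _ "a - 1"])
  qed auto
  have dl: "int p dvd int l * k \<longleftrightarrow> int p dvd k" for k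
    using coprime_l_p by (metis coprime_dvd_mult_right_iff coprime_int_iff)
  show ?thesis
    unfolding M_def[symmetric] prime_dvd_det_iff[OF M prime_p]
  proof (intro iffI ballI impI)
    fix x assume L: "\<forall>v\<in>carrier_vec n. (\<forall>i<n. int p dvd (M *\<^sub>v v) $ i) \<longrightarrow> (\<forall>i<n. int p dvd v $ i)"
      and x: "x \<in> A" "divA p (cnj x + x)" "divA p (T x)"
    define v where "v = Matrix.vec n (\<lambda>j. ci (j + 1) x)"
    have v: "v \<in> carrier_vec n" by (simp add: v_def)
    have "(M *\<^sub>v v) $ a = (\<Sum>j=1..n. N j (a + 1) * ci j x)" if "a < n" for a
      unfolding Mv[OF that v] by (intro sum.cong) (auto simp: v_def)
    moreover have "int p dvd (\<Sum>j=1..n. N j (a + 1) * ci j x)" if "a < n" for a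
      using divA_T_odd_iff[OF x(1,2)] x(3) that by auto
    ultimately have "\<forall>i<n. int p dvd v $ i" using L v by simp
    then have "\<forall>i<n. int p dvd ci (i + 1) x" by (simp add: v_def)
    then show "divA p x" using odd_divA_iff[OF x(1,2)] all[of "\<lambda>j. int p dvd ci j x"] by blast
  next
    fix v assume R: "\<forall>x\<in>A. divA p (cnj x + x) \<longrightarrow> divA p (T x) \<longrightarrow> divA p x"
      and v: "v \<in> carrier_vec n" and Mv0: "\<forall>i<n. int p dvd (M *\<^sub>v v) $ i"
    define x where "x = build (-1) (\<lambda>j. v $ (j - 1))"
    have x: "x \<in> A" by (simp add: x_def build_A)
    have "cnj x + x = 0" unfolding x_def by (subst cnj_build) simp_all
    then have odd: "divA p (cnj x + x)" by simp
    have cx: "ci j x = int l * v $ (j - 1)" if "j \<in> {1..n}" for j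
      unfolding x_def by (rule ci_build[OF that])
    have S: "(\<Sum>j=1..n. N j (a + 1) * ci j x) = int l * (M *\<^sub>v v) $ a" if "a < n" for a
      unfolding Mv[OF that v] using cx by (simp add: sum_distrib_left mult_ac)
    have "\<forall>a<n. int p dvd (\<Sum>j=1..n. N j (a + 1) * ci j x)" using S Mv0 by simp
    then have "divA p (T x)"
      unfolding divA_T_odd_iff[OF x odd] all[of "\<lambda>a. int p dvd (\<Sum>j=1..n. N j a * ci j x)"] .
    then have "divA p x" using R x odd by blast
    then have "\<forall>j\<in>{1..n}. int p dvd v $ (j - 1)"
      unfolding odd_divA_iff[OF x odd] using cx dl by simp
    then show "\<forall>i<n. int p dvd v $ i"
      unfolding all[of "\<lambda>j. int p dvd v $ (j - 1)", symmetric] by simp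
  qed
qed


section \<open>Units congruent to 1\<close>

text \<open>Being real and having trace 0 are imposed only modulo p, so that \<open>V0\<close> is a
  union of classes of A modulo pA and can be compared with \<open>W\<close>.\<close>

definition V0 :: "complex set"
  where "V0 = {x \<in> A. divA p (cnj x - x) \<and> divA p (tr x)}"

text \<open>\<open>W \<mu> / pA\<close> is the image of \<open>H\<^sub>\<mu>/S\<^bsub>\<mu>+1\<^esub>\<close> in \<open>A/pA\<close>.\<close>

definition W :: "nat \<Rightarrow> complex set"
  where "W \<mu> = {x \<in> A. \<exists>u\<in>A. \<exists>v\<in>A. u * v = 1 \<and> divA (2 * p ^ (\<mu> + 1)) (u - 1 - of_nat (2 * p ^ \<mu>) * x)}"

lemma divA_2_cancel: "divA p (2 * x) \<Longrightarrow> x \<in> A \<Longrightarrow> divA p x"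
  using divA_cancel_coprime[OF coprime_2_p, of x] by simp

lemma V0_A: "x \<in> V0 \<Longrightarrow> x \<in> A"
  and V0_cnj: "x \<in> V0 \<Longrightarrow> divA p (cnj x - x)"
  and V0_tr: "x \<in> V0 \<Longrightarrow> divA p (tr x)"
  by (simp_all add: V0_def)

lemma V0_diff: "x \<in> V0 \<Longrightarrow> y \<in> V0 \<Longrightarrow> x - y \<in> V0"
proof -
  assume x: "x \<in> V0" and y: "y \<in> V0"
  have "cnj (x - y) - (x - y) = (cnj x - x) - (cnj y - y)" by simp
  moreover have "tr (x - y) = tr x - tr y"
    using tr_add[of x "- y"] tr_minus[of y] x y A_K K_minus by (simp add: V0_def)
  ultimately show ?thesis using x y unfolding V0_def by (simp only: mem_Collect_eq divA_diff A_diff)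
qed

lemma V0_cong: "x \<in> V0 \<Longrightarrow> y \<in> A \<Longrightarrow> divA p (y - x) \<Longrightarrow> y \<in> V0"
proof -
  assume x: "x \<in> V0" and y: "y \<in> A" "divA p (y - x)"
  have "cnj y - y = (cnj x - x) + (cnj (y - x) - (y - x))" by simp
  moreover have "divA p ((cnj x - x) + (cnj (y - x) - (y - x)))"
    by (intro divA_add divA_diff[OF divA_cnj] V0_cnj[OF x] y(2))
  moreover have "tr y = tr x + tr (y - x)"
    using tr_add[of x "y - x"] x y A_K K_diff by (simp add: V0_def)
  moreover have "divA p (tr x + tr (y - x))"
    by (intro divA_add V0_tr[OF x] divA_tr[OF y(2)])
  ultimately show ?thesis using y unfolding V0_def by simp
qed

text \<open>By \<open>tr_T\<close>, 2 T x is the trace of x minus T of the multiple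
  \<open>cnj x - x\<close> of p, and 2 is invertible modulo p.\<close>

lemma T_V0: "x \<in> V0 \<Longrightarrow> divA p (T x)"
proof -
  assume x: "x \<in> V0"
  then have xA: "x \<in> A" and xK: "x \<in> K" by (simp_all add: V0_def A_K)
  have "2 * T x = tr x - T (cnj x - x)"
    using tr_T[OF xK] T_diff[OF K_cnj[OF xK] xK] by simp
  moreover have "divA p (tr x - T (cnj x - x))"
    by (rule divA_diff[OF V0_tr[OF x] divA_T[OF V0_cnj[OF x]]])
  ultimately show ?thesis using divA_2_cancel T_A[OF xA] by simp
qed

text \<open>The difference of x and its conjugate is odd, and \<open>T\<close> sends it to the same
  difference for \<open>T x\<close>, a multiple of p; injectivity on the odd part makes x real
  modulo p. The trace of x is then recovered from that of \<open>T x\<close>.\<close>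

lemma V0_of_T_V0:
  assumes N: "\<not> int p dvd Determinant.det (N_mat l)" and x: "x \<in> A" and Tx: "T x \<in> V0"
  shows "x \<in> V0"
proof -
  have xK: "x \<in> K" using x A_K by blast
  define y where "y = cnj x - x"
  have y: "y \<in> A" unfolding y_def using x by (intro A_diff A_cnj)
  have "cnj y + y = 0" by (simp add: y_def)
  moreover have "T y = cnj (T x) - T x"
    unfolding y_def using T_diff[OF K_cnj[OF xK] xK] T_cnj[OF xK] by simp
  ultimately have dy: "divA p y"
    using N Tx y unfolding det_N_iff_T_inj by (simp add: V0_def)
  have "tr x = 2 * T x + T y"
    using tr_T[OF xK] T_diff[OF K_cnj[OF xK] xK] by (simp add: y_def)
  then have "tr (tr x) = 2 * tr (T x) + tr (T y)"
    using tr_add[of "2 * T x" "T y"] tr_mult_Rats[of 2 "T x"] A_K T_A x y by (simp add: A_mult)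
  \<comment> \<open>\<open>tr x\<close> is rational, so its trace multiplies it by l - 1 = 2n. Here
    it matters that p does not divide n.\<close>
  moreover have "tr (tr x) = of_nat (l - 1) * tr x"
    using tr_Rats[OF xK] by (simp add: tr_def[of "tr x"] sig_Rats G_not_dvd)
  moreover have "divA p (2 * tr (T x) + tr (T y))"
    by (rule divA_add[OF divA_mult'[OF V0_tr[OF Tx]] divA_tr[OF divA_T[OF dy]]]) simp
  ultimately have "divA p (of_nat (l - 1) * tr x)" by simp
  moreover have "coprime (l - 1) p"
  proof -
    have "coprime n p" using p_half prime_p by (simp add: n_def coprime_commute prime_imp_coprime)
    then have "coprime (2 * n) p" using coprime_2_p by (metis coprime_mult_left_iff)
    moreover have "l - 1 = 2 * n" using l_eq by simp
    ultimately show ?thesis by metis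
  qed
  ultimately have "divA p (tr x)" using divA_cancel_coprime tr_A[OF x] by blast
  then show ?thesis using dy x by (simp add: V0_def y_def)
qed

text \<open>On \<open>V0 / pA\<close> the coordinates \<open>n + 1, \<dots>, l - 1\<close> are determined by symmetry and the first one by
  the trace, so \<open>kappa\<close> identifies it with \<open>(\<int>/p)\<^bsup>n - 1\<^esup>\<close>.\<close>

definition kappa :: "complex \<Rightarrow> nat \<Rightarrow> int"
  where "kappa x = (\<lambda>j\<in>{2..n}. ci j x mod int p)"

lemma kappa_range: "kappa x \<in> {2..n} \<rightarrow>\<^sub>E {0..<int p}"
  unfolding kappa_def using p_pos by (intro PiE_I) auto

lemma kappa_eq_iff:
  assumes x: "x \<in> V0" and y: "y \<in> V0"
  shows "kappa x = kappa y \<longleftrightarrow> divA p (x - y)"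
proof
  assume "divA p (x - y)"
  then have "int p dvd ci j x - ci j y" if "j \<in> {1..n}" for j
    using divA_iff_ci[OF coprime_l_p(1) p_pos(1), of "x - y"] ci_diff[OF V0_A[OF x] V0_A[OF y]]
      divA_A n_G(1)[OF that] by metis
  then show "kappa x = kappa y"
    unfolding kappa_def by (intro restrict_ext) (simp add: mod_eq_dvd_iff)
next
  assume k: "kappa x = kappa y"
  define w where "w = x - y"
  have wV: "w \<in> V0" unfolding w_def by (rule V0_diff[OF x y])
  then have w: "w \<in> A" by (rule V0_A)
  have c2: "int p dvd ci j w" if "j \<in> {2..n}" for j
    using fun_cong[OF k, of j] that ci_diff[OF V0_A[OF x] V0_A[OF y], of j]
    by (simp add: kappa_def w_def mod_eq_dvd_iff)
  have sym: "int p dvd ci (l - j) w - ci j w" if j: "j \<in> {1..n}" for j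
  proof -
    have d: "divA p (cnj w - w)" using wV by (simp add: V0_def)
    then have "int p dvd ci (l - j) (cnj w - w)"
      using divA_iff_ci[OF coprime_l_p(1) p_pos(1) divA_A[OF d]] n_G(2)[OF j] by blast
    then have "int p dvd ci j w - ci (l - j) w"
      using ci_cnj[OF w n_G(1)[OF j]] ci_diff[OF A_cnj[OF w] w] by simp
    then show ?thesis by (simp add: dvd_diff_commute)
  qed
  \<comment> \<open>The trace condition says that p divides the sum of all coordinates. Modulo p,
    symmetry makes this twice the sum over 1..n, so coordinate 1 vanishes with the coordinates
    2..n.\<close>
  have "divA p (of_int (- (\<Sum>j\<in>G. ci j w)))"
    using wV unfolding tr_ci[OF w, symmetric] by (intro divA_mult') (auto simp: V0_def)
  then have "int p dvd - (\<Sum>j\<in>G. ci j w)" unfolding divA_Ints[OF p_pos(1)] .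
  then have hs: "int p dvd (\<Sum>j=1..n. ci j w + ci (l - j) w)"
    unfolding sum_G_split dvd_minus_iff .
  have sum2: "(\<Sum>j=1..n. ci j w + ci (l - j) w)
      = (\<Sum>j=1..n. ci (l - j) w - ci j w) + 2 * (\<Sum>j=1..n. ci j w)"
    by (simp add: sum.distrib sum_subtractf)
  have hd: "int p dvd (\<Sum>j=1..n. ci (l - j) w - ci j w)"
    using sym by (intro dvd_sum) auto
  have "int p dvd 2 * (\<Sum>j=1..n. ci j w)"
    by (rule iffD1[OF dvd_add_right_iff[OF hd] hs[unfolded sum2]])
  moreover have "coprime (int p) 2" using coprime_2_p odd_p by simp
  ultimately have "int p dvd (\<Sum>j=1..n. ci j w)" using coprime_dvd_mult_right_iff by blast
  moreover have "(\<Sum>j=1..n. ci j w) = ci 1 w + (\<Sum>j=2..n. ci j w)"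
    using l_eq by (simp add: sum.atLeast_Suc_atMost numeral_2_eq_2 One_nat_def)
  moreover have "int p dvd (\<Sum>j=2..n. ci j w)"
    using c2 by (intro dvd_sum) auto
  ultimately have c1: "int p dvd ci 1 w" by (metis dvd_add_left_iff)
  have c: "int p dvd ci j w" if "j \<in> {1..n}" for j
    using c1 c2[of j] that by (cases "j = 1") auto
  have "int p dvd ci j w" if "j \<in> G" for j
  proof -
    have "int p dvd ci (l - i) w" if "i \<in> {1..n}" for i
      using c[OF that] sym[OF that] by (metis dvd_add_left_iff diff_add_cancel dvd_diff)
    then show ?thesis using that c unfolding G_split(1) by auto
  qed
  then show "divA p (x - y)"
    unfolding w_def[symmetric] divA_iff_ci[OF coprime_l_p(1) p_pos(1) w] by blast
qed

lemma kappa_surj: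
  assumes d: "d \<in> {2..n} \<rightarrow>\<^sub>E {0..<int p}"
  shows "\<exists>x\<in>V0. kappa x = d"
proof -
  \<comment> \<open>\<open>m\<close> inverts l modulo p and cancels the factor l of
    \<open>ci_build\<close>. The first coefficient of \<open>c\<close> is chosen so that the
    coefficients sum to 0, and with them the trace.\<close>
  obtain m q where m: "m * int l + q * int p = 1"
    using coprime_l_p(1) bezout_int[of "int l" "int p"] by (auto simp: coprime_iff_gcd_eq_1)
  define c where "c j = m * (if j = 1 then - (\<Sum>i=2..n. d i) else d j)" for j
  define x where "x = build 1 c"
  have x: "x \<in> A" by (simp add: x_def build_A)
  have "cnj x - x = 0" unfolding x_def by (subst cnj_build) simp_all
  moreover have "(\<Sum>i=1..n. c i) = 0"
  proof -
    have "(\<Sum>i=1..n. c i) = c 1 + (\<Sum>i=2..n. c i)"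
      using l_eq by (simp add: sum.atLeast_Suc_atMost numeral_2_eq_2 One_nat_def)
    also have "(\<Sum>i=2..n. c i) = m * (\<Sum>i=2..n. d i)"
      unfolding sum_distrib_left by (intro sum.cong) (auto simp: c_def)
    finally show ?thesis by (simp add: c_def)
  qed
  then have "tr x = 0" unfolding x_def tr_build by simp
  ultimately have "x \<in> V0" using x by (simp add: V0_def)
  moreover have "kappa x = d"
  proof (rule PiE_ext[OF kappa_range d])
    fix j assume j: "j \<in> {2..n}"
    have "ci j x = int l * c j" unfolding x_def using j by (intro ci_build) auto
    also have "\<dots> = (m * int l) * d j" using j by (simp add: c_def)
    also have "m * int l = 1 - q * int p" using m by simp
    finally have "ci j x = d j + int p * (- q * d j)" by (simp add: algebra_simps)
    then have "ci j x mod int p = d j mod int p" by (simp only: mod_mult_self2)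
    also have "\<dots> = d j" using PiE_mem[OF d j] by simp
    finally show "kappa x j = d j" using j by (simp add: kappa_def)
  qed
  ultimately show ?thesis by blast
qed

lemma card_kappa: "card ({2..n} \<rightarrow>\<^sub>E {0..<int p}) = p ^ (n - 1)"
  using l_eq by (simp add: card_PiE)

lemma W_A: "x \<in> W \<mu> \<Longrightarrow> x \<in> A"
  by (simp add: W_def)

lemma W_cong: "x \<in> W \<mu> \<Longrightarrow> y \<in> A \<Longrightarrow> divA p (y - x) \<Longrightarrow> y \<in> W \<mu>"
proof -
  assume x: "x \<in> W \<mu>" and y: "y \<in> A" "divA p (y - x)"
  then obtain u v where u: "u \<in> A" "v \<in> A" "u * v = 1"
      "divA (2 * p ^ (\<mu> + 1)) (u - 1 - of_nat (2 * p ^ \<mu>) * x)"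
    unfolding W_def by blast
  have "u - 1 - of_nat (2 * p ^ \<mu>) * y = (u - 1 - of_nat (2 * p ^ \<mu>) * x) - of_nat (2 * p ^ \<mu>) * (y - x)"
    by (simp add: algebra_simps)
  moreover have "divA (2 * p ^ (\<mu> + 1)) (of_nat (2 * p ^ \<mu>) * (y - x))"
    using divA_mult_both[of "2 * p ^ \<mu>" p "y - x"] y p_pos by (simp add: mult.assoc power_add)
  ultimately have "divA (2 * p ^ (\<mu> + 1)) (u - 1 - of_nat (2 * p ^ \<mu>) * y)"
    using divA_diff[OF u(4)] by metis
  then show ?thesis using u y unfolding W_def by blast
qed

end

section \<open>Expansions near 1 and the norm bound\<close>

context cyclo
begin

text \<open>Linearisation of a product to first order. Taken over conjugates it turns the norm into
  the trace and \<phi>* into \<open>T\<close>, with an error divisible by m^2.\<close>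

lemma prod_one_plus:
  assumes "finite I" "\<And>i. i \<in> I \<Longrightarrow> f i \<in> A"
  shows "divA (m * m) ((\<Prod>i\<in>I. 1 + of_nat m * f i) - 1 - of_nat m * (\<Sum>i\<in>I. f i))"
  using assms
proof induction
  case (insert i I)
  define P where "P = (\<Prod>i\<in>I. 1 + of_nat m * f i)"
  define S where "S = (\<Sum>i\<in>I. f i)"
  have "divA (m * m) (P - 1 - of_nat m * S)" using insert unfolding P_def S_def by simp
  moreover have "S \<in> A" unfolding S_def using insert by (intro A_sum) auto
  ultimately have "divA (m * m) ((P - 1 - of_nat m * S) * (1 + of_nat m * f i) + of_nat (m * m) * (S * f i))"
    using insert by (intro divA_add divA_mult divA_I A_add A_mult) auto
  also have "(P - 1 - of_nat m * S) * (1 + of_nat m * f i) + of_nat (m * m) * (S * f i)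
      = (1 + of_nat m * f i) * P - 1 - of_nat m * (f i + S)"
    by (simp add: algebra_simps)
  finally show ?case using insert by (simp add: P_def S_def)
qed simp

text \<open>The quadratic term is kept explicit because its binomial coefficient gives a further
  factor p when k = p; from the cubic term on, the power of \<open>t\<close> is enough.\<close>

lemma power_one_plus:
  assumes "t \<in> A"
  shows "\<exists>r\<in>A. (1 + t) ^ k = 1 + of_nat k * t + of_nat (k choose 2) * t\<^sup>2 + t ^ 3 * r"
proof (induction k)
  case 0
  show ?case by (intro bexI[of _ 0]) (auto simp: binomial_eq_0)
next
  case (Suc k)
  then obtain r where r: "r \<in> A" "(1 + t) ^ k = 1 + of_nat k * t + of_nat (k choose 2) * t\<^sup>2 + t ^ 3 * r"
    by blast
  have "(Suc k choose 2) = k + (k choose 2)"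
    using binomial_Suc_Suc[of k 1] by (simp add: numeral_2_eq_2 One_nat_def)
  then have "(1 + t) ^ Suc k = 1 + of_nat (Suc k) * t + of_nat (Suc k choose 2) * t\<^sup>2
      + t ^ 3 * (of_nat (k choose 2) + r + t * r)"
    by (simp add: r(2) algebra_simps power2_eq_square power3_eq_cube)
  moreover have "of_nat (k choose 2) + r + t * r \<in> A"
    using r assms by (intro A_add A_mult) auto
  ultimately show ?case by blast
qed

lemma sig_cnj_commute: "\<not> l dvd i \<Longrightarrow> x \<in> K \<Longrightarrow> sig i (cnj x) = cnj (sig i x)"
  using sig_sig[of i "l - 1" x] sig_sig[of "l - 1" i x] sig_cnj[of x] sig_cnj[OF sig_K[of i x]] l_minus_1(1)
  by (simp add: mult.commute)

text \<open>The norm of a nonzero algebraic integer is a nonzero rational integer, so its conjugates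
  cannot all lie inside the unit disc.\<close>

lemma A_eq_0_of_small:
  assumes b: "b \<in> A" and small: "\<And>i. i \<in> G \<Longrightarrow> norm (sig i b) < 1"
  shows "b = 0"
proof (rule ccontr)
  assume "b \<noteq> 0"
  obtain k where k: "nrm b = of_int k" using nrm_Ints[OF b] by (auto elim: Ints_cases)
  have "k \<noteq> 0" using nrm_nz[OF A_K[OF b] \<open>b \<noteq> 0\<close>] k by auto
  have "norm (nrm b) = (\<Prod>i\<in>G. norm (sig i b))" by (simp add: nrm_def prod_norm)
  also have "\<dots> < (\<Prod>i\<in>G. 1 :: real)"
  proof (rule prod_mono_strict)
    show "finite G" by simp
    show "1 \<in> G" "norm (sig 1 b) < 1" using l_ge_3 small[of 1] by auto
    show "0 \<le> norm (sig i b) \<and> norm (sig i b) \<le> 1" if "i \<in> G" for i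
      using small[OF that] by simp
  qed auto
  finally have "\<bar>k\<bar> < 1" by (simp add: k)
  then show False using \<open>k \<noteq> 0\<close> by simp
qed

end

context cyclo_p
begin

text \<open>The numerical input for units: conjugates of absolute value at most 2/m are smaller than
  1, and m does not divide 2, which excludes norm -1.\<close>

lemma two_p_power: "\<mu> \<ge> 1 \<Longrightarrow> 2 * p ^ \<mu> \<ge> 6"
  using p_pos(2) power_increasing[of 1 \<mu> p] by simp

text \<open>Moving x within its class modulo p to y makes the congruence for the unit an exact
  equation.\<close>

lemma W_E:
  assumes "x \<in> W \<mu>"
  obtains u v y where "u \<in> A" "v \<in> A" "u * v = 1" "y \<in> A" "u = 1 + of_nat (2 * p ^ \<mu>) * y" "divA p (y - x)"
proof -
  obtain u v where u: "u \<in> A" "v \<in> A" "u * v = 1"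
      "divA (2 * p ^ (\<mu> + 1)) (u - 1 - of_nat (2 * p ^ \<mu>) * x)"
    using assms unfolding W_def by blast
  then obtain s where s: "s \<in> A" "u - 1 - of_nat (2 * p ^ \<mu>) * x = of_nat (2 * p ^ (\<mu> + 1)) * s"
    unfolding divA_def by blast
  show thesis
  proof (rule that[OF u(1-3), of "x + of_nat p * s"])
    show "x + of_nat p * s \<in> A" using s W_A[OF assms] by (intro A_add A_mult) auto
    have "u = 1 + of_nat (2 * p ^ \<mu>) * x + of_nat (2 * p ^ (\<mu> + 1)) * s" using s(2) by (simp add: algebra_simps)
    then show "u = 1 + of_nat (2 * p ^ \<mu>) * (x + of_nat p * s)" by (simp add: algebra_simps power_add)
    show "divA p (x + of_nat p * s - x)" using s by (simp add: divA_I)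
  qed
qed

text \<open>A unit congruent to 1 modulo \<open>2p\<^sup>\<mu>\<close> is real: its quotient by its conjugate has absolute value 1
  at all places and is congruent to 1, so it is 1 by the norm bound.\<close>

lemma unit_real:
  assumes \<mu>: "\<mu> \<ge> 1" and u: "u \<in> A" "v \<in> A" "u * v = 1" "y \<in> A" "u = 1 + of_nat (2 * p ^ \<mu>) * y"
  shows "cnj y = y"
proof -
  define m where "m = 2 * p ^ \<mu>"
  have "m \<ge> 6" using two_p_power[OF \<mu>] by (simp add: m_def)
  then have m: "real m \<ge> 6" by simp
  \<comment> \<open>As v is the inverse of u, this is the quotient of u by its conjugate, minus 1,
    divided by m. It is integral, and all its conjugates have absolute value at most 2/m.\<close>
  define b where "b = (y - cnj y) * cnj v"
  have b: "b \<in> A" unfolding b_def using u by (intro A_mult A_diff A_cnj)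
  have cuv: "cnj u * cnj v = 1" using u(3) by (metis complex_cnj_mult complex_cnj_one)
  have eq: "u * cnj v - 1 = of_nat m * b"
  proof -
    have "u * cnj v - 1 = (u - cnj u) * cnj v" by (simp add: left_diff_distrib cuv)
    also have "u - cnj u = of_nat m * (y - cnj y)" by (simp add: u(5) m_def algebra_simps)
    finally show ?thesis by (simp add: b_def)
  qed
  have "b = 0"
  proof (rule A_eq_0_of_small[OF b])
    fix i assume "i \<in> G"
    then have i: "\<not> l dvd i" by (rule G_not_dvd)
    have "norm (sig i (u * cnj v)) = norm (sig i u) * norm (sig i v)"
      using u A_K i by (simp add: sig_mult K_cnj sig_cnj_commute norm_mult)
    also have "\<dots> = norm (sig i (u * v))" using u(1,2) A_K i by (simp add: sig_mult norm_mult)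
    also have "\<dots> = 1" using i by (simp add: u(3))
    finally have 1: "norm (sig i (u * cnj v)) = 1" .
    have "of_nat m * sig i b = sig i (u * cnj v - 1)" using b A_K i by (simp add: eq sig_mult)
    also have "\<dots> = sig i (u * cnj v) - 1" using u A_K i by (simp add: sig_diff K_mult K_cnj)
    finally have "real m * norm (sig i b) = norm (sig i (u * cnj v) - 1)"
      by (metis norm_mult norm_of_nat)
    also have "\<dots> \<le> 2" using norm_triangle_ineq4[of "sig i (u * cnj v)" 1] 1 by simp
    finally have "real m * norm (sig i b) \<le> 2" .
    moreover have "6 * norm (sig i b) \<le> real m * norm (sig i b)" using m by (intro mult_right_mono) auto
    ultimately show "norm (sig i b) < 1" by linarith
  qed
  moreover have "cnj v \<noteq> 0" using cuv by auto
  ultimately show ?thesis by (simp add: b_def)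
qed

text \<open>The norm of u is 1 or -1, and it is 1 + m tr(y) modulo m^2. The value -1 would make m
  divide 2, so m^2 divides m tr(y).\<close>

lemma unit_trace:
  assumes \<mu>: "\<mu> \<ge> 1" and u: "u \<in> A" "v \<in> A" "u * v = 1" "y \<in> A" "u = 1 + of_nat (2 * p ^ \<mu>) * y"
  shows "divA p (tr y)"
proof -
  define m where "m = 2 * p ^ \<mu>"
  have m: "m \<ge> 6" using two_p_power[OF \<mu>] by (simp add: m_def)
  have "nrm u = (\<Prod>i\<in>G. 1 + of_nat m * sig i y)"
    unfolding nrm_def using u(4) A_K G_not_dvd
    by (intro prod.cong) (auto simp: u(5) m_def[symmetric] sig_add sig_mult K_mult)
  then have d: "divA (m * m) (nrm u - 1 - of_nat m * tr y)"
    unfolding tr_def using prod_one_plus[of G "\<lambda>i. sig i y" m] A_sig[OF G_not_dvd u(4)] by simp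
  obtain a b where ab: "nrm u = of_int a" "nrm v = of_int b"
    using nrm_Ints u(1,2) by (meson Ints_cases)
  have "nrm u * nrm v = 1" using nrm_mult[of u v] u A_K G_not_dvd by (simp add: nrm_def)
  then have "of_int (a * b) = (1 :: complex)" using ab by simp
  then have "a * b = 1" using of_int_eq_1_iff by blast
  then have "a = 1 \<or> a = -1" by (auto simp: zmult_eq_1_iff)
  moreover have "a \<noteq> -1"
  proof
    assume "a = -1"
    have "divA m (nrm u - 1 - of_nat m * tr y)" using divA_dvd[OF _ d, of m] by simp
    then have "divA m (nrm u - 1 - of_nat m * tr y + of_nat m * tr y)"
      using tr_A[OF u(4)] by (intro divA_add divA_I)
    then have "divA m (of_int (-2))" by (simp add: ab \<open>a = -1\<close>)
    then have "int m dvd -2" using m by (subst (asm) divA_Ints) auto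
    then have "m dvd 2" using int_dvd_int_iff[of m 2] by simp
    then show False using m by (auto dest: dvd_imp_le)
  qed
  ultimately have "nrm u = 1" by (simp add: ab)
  then have "divA (m * m) (- (of_nat m * tr y))" using d by simp
  then have "divA (m * m) (of_nat m * tr y)" using divA_minus by fastforce
  then have "divA m (tr y)" using m by (simp add: divA_mult_both)
  then show ?thesis by (rule divA_dvd[rotated]) (use \<mu> in \<open>simp add: m_def dvd_power\<close>)
qed

lemma W_subset_V0: assumes \<mu>: "\<mu> \<ge> 1" shows "W \<mu> \<subseteq> V0"
proof
  fix x assume x: "x \<in> W \<mu>"
  then obtain u v y where u: "u \<in> A" "v \<in> A" "u * v = 1" "y \<in> A"
      "u = 1 + of_nat (2 * p ^ \<mu>) * y" "divA p (y - x)"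
    by (rule W_E)
  have "y \<in> V0" using unit_real[OF \<mu> u(1-5)] unit_trace[OF \<mu> u(1-5)] u(4) by (simp add: V0_def)
  then show "x \<in> V0" using V0_cong[of y x] W_A[OF x] divA_minus[OF u(6)] by simp
qed

lemma W_mono: assumes \<mu>: "\<mu> \<ge> 1" shows "W \<mu> \<subseteq> W (\<mu> + 1)"
proof
  fix x assume x: "x \<in> W \<mu>"
  then obtain u v y where u: "u \<in> A" "v \<in> A" "u * v = 1" "y \<in> A"
      "u = 1 + of_nat (2 * p ^ \<mu>) * y" "divA p (y - x)"
    by (rule W_E)
  define m where "m = 2 * p ^ \<mu>"
  define t where "t = of_nat m * y"
  have t: "t \<in> A" unfolding t_def using u(4) by (intro A_mult) auto
  obtain r where r: "r \<in> A" "(1 + t) ^ p = 1 + of_nat p * t + of_nat (p choose 2) * t\<^sup>2 + t ^ 3 * r"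
    using power_one_plus[OF t] by blast
  \<comment> \<open>Since p > 2, the quadratic coefficient carries a factor p. As p divides m, the
    terms with p m^2 and with m^3 are then multiples of m p^2.\<close>
  obtain q where q: "p choose 2 = p * q"
    using dvd_choose_prime[of 2 p] prime_p p_pos by (auto elim: dvdE)
  have M: "2 * p ^ (\<mu> + 1 + 1) = m * (p * p)" by (simp add: m_def power_add)
  obtain k where k: "\<mu> = Suc k" using \<mu> by (cases \<mu>) auto
  have "u ^ p - 1 - of_nat (2 * p ^ (\<mu> + 1)) * x
      = of_nat (m * p) * (y - x) + of_nat (p * (m * m)) * (of_nat q * y\<^sup>2) + of_nat (m * (m * m)) * (y ^ 3 * r)"
  proof -
    have "u ^ p = 1 + of_nat p * t + of_nat (p choose 2) * t\<^sup>2 + t ^ 3 * r"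
      using r(2) u(5) by (simp add: t_def m_def)
    moreover have "2 * p ^ (\<mu> + 1) = m * p" by (simp add: m_def power_add)
    ultimately show ?thesis
      by (simp add: q t_def algebra_simps power2_eq_square power3_eq_cube)
  qed
  moreover have "divA (2 * p ^ (\<mu> + 1 + 1)) (of_nat (m * p) * (y - x))"
    using divA_mult_both[of "m * p" p "y - x"] u(6) p_pos unfolding M by (simp add: m_def mult.assoc)
  moreover have "divA (2 * p ^ (\<mu> + 1 + 1)) (of_nat (p * (m * m)) * (of_nat q * y\<^sup>2))"
    unfolding M using u(4) by (intro divA_of_dvd A_mult A_power) (auto simp: m_def k)
  moreover have "divA (2 * p ^ (\<mu> + 1 + 1)) (of_nat (m * (m * m)) * (y ^ 3 * r))"
    unfolding M using u(4) r(1) by (intro divA_of_dvd A_mult A_power) (auto simp: m_def k)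
  ultimately have "divA (2 * p ^ (\<mu> + 1 + 1)) (u ^ p - 1 - of_nat (2 * p ^ (\<mu> + 1)) * x)"
    by (simp only: divA_add)
  moreover have "u ^ p * v ^ p = 1" using u(3) by (simp flip: power_mult_distrib)
  ultimately show "x \<in> W (\<mu> + 1)"
    unfolding W_def using W_A[OF x] A_power[OF u(1), of p] A_power[OF u(2), of p] by blast
qed

lemma W_eq_V0: assumes W1: "W 1 = V0" and \<mu>: "\<mu> \<ge> 1" shows "W \<mu> = V0"
  using \<mu>
proof (induction \<mu> rule: dec_induct)
  case (step \<mu>)
  then show ?case using W_mono[of \<mu>] W_subset_V0[of "\<mu> + 1"] unfolding Suc_eq_plus1 by auto
qed (rule W1)

text \<open>From left to right, take \<mu> = 1: \<open>T\<close> sends \<open>V0\<close> into pA and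
  hence into \<open>W 1\<close>, which forces \<open>V0\<close> into \<open>W 1\<close>. An odd x
  with p dividing \<open>T x\<close> then lies in \<open>V0\<close>, so it is both even and odd
  modulo p, and 2x is a multiple of p.\<close>

theorem T_injective_iff:
  "(\<forall>\<mu>\<ge>1. \<forall>x\<in>A. T x \<in> W \<mu> \<longrightarrow> x \<in> W \<mu>) \<longleftrightarrow>
    W 1 = V0 \<and> \<not> int p dvd Determinant.det (N_mat l)"
proof
  assume L: "\<forall>\<mu>\<ge>1. \<forall>x\<in>A. T x \<in> W \<mu> \<longrightarrow> x \<in> W \<mu>"
  have "0 \<in> W 1" unfolding W_def by (auto intro!: bexI[of _ 1])
  then have W0: "y \<in> W 1" if "divA p y" for y
    using W_cong[of 0 1 y] that divA_A by simp
  have W1: "W 1 = V0"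
  proof
    show "V0 \<subseteq> W 1" using L T_V0 W0 V0_A by blast
  qed (rule W_subset_V0, simp)
  moreover have "divA p x" if x: "x \<in> A" "divA p (cnj x + x)" "divA p (T x)" for x
  proof -
    have "x \<in> V0" using L W0[OF x(3)] x(1) W1 by blast
    then have "divA p (cnj x + x - (cnj x - x))" using x(2) by (intro divA_diff V0_cnj)
    then show ?thesis using divA_2_cancel[of x] x(1) by simp
  qed
  ultimately show "W 1 = V0 \<and> \<not> int p dvd Determinant.det (N_mat l)"
    unfolding det_N_iff_T_inj by blast
next
  assume R: "W 1 = V0 \<and> \<not> int p dvd Determinant.det (N_mat l)"
  then show "\<forall>\<mu>\<ge>1. \<forall>x\<in>A. T x \<in> W \<mu> \<longrightarrow> x \<in> W \<mu>"
    using W_eq_V0 V0_of_T_V0 by simp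
qed

text \<open>\<open>kappa\<close> identifies \<open>V0\<close> modulo p with a set of p^(n-1)
  elements, and \<open>W 1\<close> is a union of classes modulo p inside \<open>V0\<close>, so it is
  determined by its image.\<close>

lemma kappa_W_card_iff: "card (kappa ` W 1) = p ^ (n - 1) \<longleftrightarrow> W 1 = V0"
proof
  have "W 1 \<subseteq> V0" by (rule W_subset_V0) simp
  have fin: "finite ({2..n} \<rightarrow>\<^sub>E {0..<int p})" by (rule finite_PiE) auto
  have img: "kappa ` V0 = {2..n} \<rightarrow>\<^sub>E {0..<int p}"
    using kappa_range kappa_surj by (auto simp: image_iff) metis
  show "card (kappa ` W 1) = p ^ (n - 1)" if "W 1 = V0"
    unfolding that img by (rule card_kappa)
  assume "card (kappa ` W 1) = p ^ (n - 1)"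
  then have "kappa ` W 1 = {2..n} \<rightarrow>\<^sub>E {0..<int p}"
    using card_subset_eq[OF fin, of "kappa ` W 1"] card_kappa kappa_range by auto
  have "x \<in> W 1" if x: "x \<in> V0" for x
  proof -
    have "kappa x \<in> kappa ` W 1"
      using \<open>kappa ` W 1 = {2..n} \<rightarrow>\<^sub>E {0..<int p}\<close> kappa_range by simp
    then obtain y where y: "y \<in> W 1" "kappa x = kappa y" by blast
    then have "divA p (x - y)" using kappa_eq_iff[OF x] \<open>W 1 \<subseteq> V0\<close> by blast
    then show ?thesis using W_cong y(1) V0_A[OF x] by blast
  qed
  then show "W 1 = V0" using \<open>W 1 \<subseteq> V0\<close> by blast
qed

end


section \<open>Multiplicative congruences\<close>

context cyclo
begin

text \<open>\<open>R (2p\<^sup>\<mu>)\<close> is \<open>S\<^sub>\<mu>\<close>: a single denominator \<open>d\<close>, itself congruent to 1, replaces the local conditions.\<close>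

definition R :: "nat \<Rightarrow> complex set"
  where "R m = {a \<in> K. a \<noteq> 0 \<and> (\<exists>d\<in>A. divA m (d - 1) \<and> divA m (d * (a - 1)))}"

lemma R_K: "a \<in> R m \<Longrightarrow> a \<in> K" and R_nz: "a \<in> R m \<Longrightarrow> a \<noteq> 0"
  by (simp_all add: R_def)

lemma R_I: "a \<in> K \<Longrightarrow> a \<noteq> 0 \<Longrightarrow> d \<in> A \<Longrightarrow> divA m (d - 1) \<Longrightarrow> divA m (d * (a - 1)) \<Longrightarrow> a \<in> R m"
  unfolding R_def by blast

lemma R_E:
  assumes "a \<in> R m"
  obtains d where "d \<in> A" "divA m (d - 1)" "divA m (d * (a - 1))"
  using assms unfolding R_def by blast

lemma divA_mult_minus_1: "x \<in> A \<Longrightarrow> divA m (x - 1) \<Longrightarrow> divA m (y - 1) \<Longrightarrow> divA m (x * y - 1)"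
proof -
  assume "x \<in> A" "divA m (x - 1)" "divA m (y - 1)"
  then have "divA m (x * (y - 1) + (x - 1))" by (intro divA_add divA_mult')
  then show ?thesis by (simp add: algebra_simps)
qed

lemma R_mult: assumes "a \<in> R m" "b \<in> R m" shows "a * b \<in> R m"
proof -
  obtain d where d: "d \<in> A" "divA m (d - 1)" "divA m (d * (a - 1))" using assms(1) by (rule R_E)
  obtain e where e: "e \<in> A" "divA m (e - 1)" "divA m (e * (b - 1))" using assms(2) by (rule R_E)
  have "e * (b - 1) + e \<in> A" using divA_A[OF e(3)] e(1) by (rule A_add)
  then have "divA m ((d * (a - 1)) * (e * (b - 1) + e) + d * (e * (b - 1)))"
    using d e by (intro divA_add divA_mult[OF d(3)] divA_mult'[OF e(3)])
  also have "(d * (a - 1)) * (e * (b - 1) + e) + d * (e * (b - 1)) = (d * e) * (a * b - 1)"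
    by (simp add: algebra_simps)
  finally show ?thesis
    using assms d e by (intro R_I[of _ "d * e"] K_mult A_mult divA_mult_minus_1) (auto dest: R_K R_nz)
qed

lemma R_inverse: assumes "a \<in> R m" shows "inverse a \<in> R m"
proof -
  obtain d where d: "d \<in> A" "divA m (d - 1)" "divA m (d * (a - 1))" using assms by (rule R_E)
  have nz: "a \<noteq> 0" using assms by (rule R_nz)
  have eq: "d * a = d * (a - 1) + d" by (simp add: algebra_simps)
  show ?thesis
  \<comment> \<open>The numerator of a serves as denominator of its inverse; it is congruent to 1 as
    well.\<close>
  proof (rule R_I[of _ "d * a"])
    show "d * a \<in> A" unfolding eq using divA_A[OF d(3)] d(1) by (rule A_add)
    have "divA m (d * (a - 1) + (d - 1))" using d by (intro divA_add)
    then show "divA m (d * a - 1)" by (simp add: algebra_simps)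
    have "d * a * (inverse a - 1) = - (d * (a - 1))" using nz by (simp add: field_simps)
    then show "divA m (d * a * (inverse a - 1))" using divA_minus[OF d(3)] by simp
  qed (use assms nz in \<open>auto dest: R_K\<close>)
qed

lemma R_divide: "a \<in> R m \<Longrightarrow> b \<in> R m \<Longrightarrow> a / b \<in> R m"
  by (simp add: divide_inverse R_mult R_inverse)

lemma R_1: "1 \<in> R m"
  by (rule R_I[of _ 1]) auto

lemma R_prod: "(\<And>i. i \<in> I \<Longrightarrow> f i \<in> R m) \<Longrightarrow> (\<Prod>i\<in>I. f i) \<in> R m"
  by (induction I rule: infinite_finite_induct) (simp_all add: R_1 R_mult)

lemma R_power: "a \<in> R m \<Longrightarrow> a ^ k \<in> R m"
  by (induction k) (simp_all add: R_1 R_mult)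

lemma R_sig: assumes "\<not> l dvd i" "a \<in> R m" shows "sig i a \<in> R m"
proof -
  obtain d where d: "d \<in> A" "divA m (d - 1)" "divA m (d * (a - 1))" using assms(2) by (rule R_E)
  have K: "a \<in> K" "d \<in> K" using assms(2) d by (auto dest: R_K A_K)
  show ?thesis
  proof (rule R_I[of _ "sig i d"])
    have "sig i (d - 1) = sig i d - 1" "sig i (d * (a - 1)) = sig i d * (sig i a - 1)"
      using assms(1) K by (simp_all add: sig_diff sig_mult K_diff)
    then show "divA m (sig i d - 1)" "divA m (sig i d * (sig i a - 1))"
      using divA_sig[OF assms(1)] d by metis+
    show "sig i a \<noteq> 0" using sig_inj[OF assms(1) K(1)] R_nz[OF assms(2)] by blast
  qed (use assms(1) K d in \<open>auto intro: A_sig sig_K\<close>)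
qed

lemma R_dvd: "m dvd k \<Longrightarrow> a \<in> R k \<Longrightarrow> a \<in> R m"
  unfolding R_def using divA_dvd by blast

lemma R_A_iff: assumes "a \<in> A" shows "a \<in> R m \<longleftrightarrow> a \<noteq> 0 \<and> divA m (a - 1)"
proof
  assume a: "a \<in> R m"
  then obtain d where d: "d \<in> A" "divA m (d - 1)" "divA m (d * (a - 1))" by (rule R_E)
  have "divA m (d * (a - 1) - (d - 1) * (a - 1))"
    by (rule divA_diff[OF d(3) divA_mult[OF d(2)]]) (use assms in auto)
  then show "a \<noteq> 0 \<and> divA m (a - 1)" using R_nz[OF a] by (simp add: algebra_simps)
next
  assume "a \<noteq> 0 \<and> divA m (a - 1)"
  then show "a \<in> R m" using assms A_K by (intro R_I[of a 1]) auto
qed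

lemma one_plus_A: "x \<in> A \<Longrightarrow> 1 + of_nat m * x \<in> A"
  by (intro A_add A_mult A_simps)

lemma one_plus_nz: "m > 1 \<Longrightarrow> x \<in> A \<Longrightarrow> 1 + of_nat m * x \<noteq> 0"
proof
  assume m: "m > 1" and x: "x \<in> A" and "1 + of_nat m * x = 0"
  then have "of_nat m * x = - 1" by (simp add: add_eq_0_iff)
  then have "of_int (-1) = of_nat m * x" by simp
  then have "divA m (of_int (-1))" using x divA_I by metis
  then have "int m dvd -1" using m by (subst (asm) divA_Ints) auto
  then show False using m by simp
qed

end

section \<open>The quotient of S_\<mu> by S_(\<mu>+1) as A/pA\<close>

context cyclo_p
begin

definition H :: "nat \<Rightarrow> nat \<Rightarrow> complex set"
  where "H m M = {s * u | s u. s \<in> R M \<and> u \<in> R m \<and> u \<in> A \<and> inverse u \<in> A}"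

definition star :: "complex \<Rightarrow> complex" where "star a = (\<Prod>i=1..n. sig (iinv i) a)"

lemma star_mult: "a \<in> K \<Longrightarrow> b \<in> K \<Longrightarrow> star (a * b) = star a * star b"
  unfolding star_def prod.distrib[symmetric] using iinv_n by (intro prod.cong) (auto simp: sig_mult)

lemma star_R: "a \<in> R k \<Longrightarrow> star a \<in> R k"
  unfolding star_def using iinv_n by (intro R_prod R_sig)

context
  fixes \<mu> m M :: nat
  assumes \<mu>: "\<mu> \<ge> 1" and m_def: "m = 2 * p ^ \<mu>" and M_def: "M = 2 * p ^ (\<mu> + 1)"
begin

lemma m_gt_1: "m > 1" "M > 1" "m > 0" and M_eq: "M = m * p" and m_dvd_M: "m dvd M"
proof -
  have "m \<ge> 6" "M \<ge> 6"
    using two_p_power[OF \<mu>] two_p_power[of "\<mu> + 1"] by (simp_all add: m_def M_def)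
  then show "m > 1" "M > 1" "m > 0" by simp_all
  show "M = m * p" by (simp add: m_def M_def power_add)
  then show "m dvd M" by simp
qed

text \<open>Here \<mu> \<ge> 1 enters: second-order terms vanish modulo M, so x \<mapsto> 1 + m x
  takes sums to products.\<close>

lemma M_dvd_square: "M dvd m * m"
proof -
  obtain k where "\<mu> = Suc k" using \<mu> by (cases \<mu>) auto
  then show ?thesis by (simp add: M_eq) (simp add: m_def)
qed

lemma power_p_cong:
  assumes b: "b \<in> A" "divA m (b - 1)"
  shows "divA M (b ^ p - 1)"
proof -
  define t where "t = b - 1"
  have t: "t \<in> A" unfolding t_def using b by auto
  obtain y where y: "y \<in> A" "t = of_nat m * y" using b by (auto simp: divA_def t_def)
  obtain r where r: "r \<in> A" "(1 + t) ^ p = 1 + of_nat p * t + of_nat (p choose 2) * t\<^sup>2 + t ^ 3 * r"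
    using power_one_plus[OF t] by blast
  have "b ^ p - 1 = of_nat M * y + of_nat (m * m) * (of_nat (p choose 2) * y\<^sup>2 + t * y\<^sup>2 * r)"
  proof -
    have "b ^ p = (1 + t) ^ p" by (simp add: t_def)
    then show ?thesis
      unfolding r(2) by (simp add: y(2) M_eq algebra_simps power2_eq_square power3_eq_cube)
  qed
  moreover have "divA M (of_nat (m * m) * (of_nat (p choose 2) * y\<^sup>2 + t * y\<^sup>2 * r))"
    using M_dvd_square t y r by (intro divA_of_dvd A_add A_mult A_power) auto
  ultimately show ?thesis using y by (simp only: divA_add divA_I)
qed

text \<open>The denominator \<open>c\<close> is replaced by \<open>c\<^sup>p\<close>, which is congruent to 1 modulo \<open>M\<close>.\<close>

lemma quotient_R:
  assumes b: "b \<in> A" "b \<noteq> 0" and c: "c \<in> A" "c \<noteq> 0" "divA m (c - 1)" and bc: "divA M (b - c)"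
  shows "b / c \<in> R M"
proof (rule R_I[of _ "c ^ p"])
  show "divA M (c ^ p - 1)" using c by (intro power_p_cong)
  have "c ^ p = c ^ (p - 1) * c" using p_pos by (metis power_minus_mult)
  then have "c ^ p * (b / c - 1) = c ^ (p - 1) * (b - c)" using c by (simp add: field_simps)
  then show "divA M (c ^ p * (b / c - 1))" using divA_mult'[OF bc] c by auto
qed (use b c in \<open>auto intro: K_divide A_K\<close>)

text \<open>The map from A/pA to S_\<mu>/S_(\<mu>+1) is well defined and injective;
  \<open>R_decompose\<close> is its surjectivity.\<close>

lemma one_plus_quotient_iff:
  assumes x: "x \<in> A" and y: "y \<in> A"
  shows "(1 + of_nat m * x) / (1 + of_nat m * y) \<in> R M \<longleftrightarrow> divA p (x - y)"
proof -
  define b c where "b = 1 + of_nat m * x" and "c = 1 + of_nat m * y"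
  have bc: "b \<in> A" "b \<noteq> 0" "c \<in> A" "c \<noteq> 0" "divA m (c - 1)" "b - c = of_nat m * (x - y)"
    unfolding b_def c_def using x y one_plus_nz[OF m_gt_1(1)] one_plus_A divA_I
    by (simp_all add: right_diff_distrib)
  have iff: "divA M (b - c) \<longleftrightarrow> divA p (x - y)"
    unfolding bc(6) M_eq using m_gt_1 by (intro divA_mult_both)
  have "divA M (b - c)" if bcR: "b / c \<in> R M"
  proof -
    obtain e where e: "e \<in> A" "divA M (e - 1)" "divA M (e * (b / c - 1))" using bcR by (rule R_E)
    have "divA M (c * (e * (b / c - 1)) - (e - 1) * (b - c))"
      by (rule divA_diff[OF divA_mult'[OF e(3) bc(3)] divA_mult[OF e(2) A_diff[OF bc(1,3)]]])
    also have "c * (e * (b / c - 1)) - (e - 1) * (b - c) = b - c"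
      using bc by (simp add: field_simps)
    finally show ?thesis .
  qed
  then show ?thesis using quotient_R[OF bc(1-5)] iff unfolding b_def c_def by blast
qed

text \<open>The denominator e is replaced by d = e^p, which is 1 modulo M, and x is read off from d
  (a - 1) = m x. Then d a = d + m x differs from d (1 + m x) by the multiple (d - 1) m x of
  M.\<close>

lemma R_decompose:
  assumes a: "a \<in> R m"
  obtains x where "x \<in> A" "a / (1 + of_nat m * x) \<in> R M"
proof -
  obtain e where e: "e \<in> A" "divA m (e - 1)" "divA m (e * (a - 1))" using a by (rule R_E)
  define d where "d = e ^ p"
  have d: "d \<in> A" unfolding d_def using e by auto
  have d1: "divA M (d - 1)" unfolding d_def using e by (intro power_p_cong)
  have "e ^ p = e ^ (p - 1) * e" using p_pos by (metis power_minus_mult)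
  then have "d * (a - 1) = e ^ (p - 1) * (e * (a - 1))" by (simp add: d_def)
  then have "divA m (d * (a - 1))" using divA_mult'[OF e(3) A_power[OF e(1)]] by metis
  then obtain x where x: "x \<in> A" "d * (a - 1) = of_nat m * x" by (auto simp: divA_def)
  define b where "b = d + of_nat m * x"
  define c where "c = d * (1 + of_nat m * x)"
  have da: "d * a = b" using x(2) by (simp add: b_def algebra_simps)
  have "d \<noteq> 0"
  proof
    assume "d = 0"
    then have "of_int (-1) = d - 1" by simp
    then have "int M dvd -1" using d1 m_gt_1 divA_Ints[of M "-1"] by simp
    then show False using m_gt_1 by simp
  qed
  then have nz: "b \<noteq> 0" "c \<noteq> 0"
    using da R_nz[OF a] one_plus_nz[OF m_gt_1(1) x(1)] by (auto simp: c_def)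
  have "b / c \<in> R M"
  proof (rule quotient_R[OF _ nz(1) _ nz(2)])
    show "b \<in> A" "c \<in> A"
      unfolding b_def c_def using d x(1) one_plus_A by (simp_all add: A_add A_mult)
    show "divA m (c - 1)" unfolding c_def
      using d divA_dvd[OF m_dvd_M d1] x by (intro divA_mult_minus_1) auto
    have "divA M (- ((d - 1) * (of_nat m * x)))" using d1 x by (intro divA_minus divA_mult) auto
    then show "divA M (b - c)" by (simp add: b_def c_def algebra_simps)
  qed
  moreover have "b / c = a / (1 + of_nat m * x)"
    using \<open>d \<noteq> 0\<close> by (simp add: c_def da[symmetric])
  ultimately show thesis using that x by simp
qed

lemma H_I: "s \<in> R M \<Longrightarrow> u \<in> R m \<Longrightarrow> u \<in> A \<Longrightarrow> inverse u \<in> A \<Longrightarrow> s * u \<in> H m M"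
  unfolding H_def by blast

lemma H_E:
  assumes "a \<in> H m M"
  obtains s u where "a = s * u" "s \<in> R M" "u \<in> R m" "u \<in> A" "inverse u \<in> A"
  using assms unfolding H_def by blast

lemma H_R: "a \<in> H m M \<Longrightarrow> a \<in> R m"
  using R_dvd[OF m_dvd_M] by (auto elim!: H_E intro: R_mult)

lemma R_M_H: "a \<in> R M \<Longrightarrow> a \<in> H m M"
  using H_I[of a 1] R_1 by simp

lemma H_mult: "a \<in> H m M \<Longrightarrow> b \<in> H m M \<Longrightarrow> a * b \<in> H m M"
proof (elim H_E)
  fix s u t v assume h: "a = s * u" "s \<in> R M" "u \<in> R m" "u \<in> A" "inverse u \<in> A"
    "b = t * v" "t \<in> R M" "v \<in> R m" "v \<in> A" "inverse v \<in> A"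
  have "(s * t) * (u * v) \<in> H m M" using h by (intro H_I) (auto intro: R_mult)
  then show "a * b \<in> H m M" using h by (simp add: mult_ac)
qed

lemma H_inverse: "a \<in> H m M \<Longrightarrow> inverse a \<in> H m M"
proof (elim H_E)
  fix s u assume h: "a = s * u" "s \<in> R M" "u \<in> R m" "u \<in> A" "inverse u \<in> A"
  have "inverse s * inverse u \<in> H m M" using h by (intro H_I) (auto intro: R_inverse)
  then show "inverse a \<in> H m M" using h by simp
qed

lemma H_sig: "\<not> l dvd i \<Longrightarrow> a \<in> H m M \<Longrightarrow> sig i a \<in> H m M"
proof (elim H_E)
  fix s u assume i: "\<not> l dvd i" and h: "a = s * u" "s \<in> R M" "u \<in> R m" "u \<in> A" "inverse u \<in> A"
  have "inverse (sig i u) = sig i (inverse u)"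
    using sig_divide[OF i, of 1 u] i h by (simp add: inverse_eq_divide A_K)
  then have "sig i s * sig i u \<in> H m M" using i h by (intro H_I) (auto intro: R_sig A_sig)
  then show "sig i a \<in> H m M" using i h by (simp add: sig_mult R_K)
qed

lemma H_prod: "(\<And>i. i \<in> I \<Longrightarrow> f i \<in> H m M) \<Longrightarrow> (\<Prod>i\<in>I. f i) \<in> H m M"
  by (induction I rule: infinite_finite_induct) (simp_all add: R_M_H R_1 H_mult)

lemma H_mult_cancel: "a \<in> H m M \<Longrightarrow> a * b \<in> H m M \<longleftrightarrow> b \<in> H m M"
proof
  assume a: "a \<in> H m M" "a * b \<in> H m M"
  have "a \<noteq> 0" using H_R[OF a(1)] R_nz by blast
  then have "b = inverse a * (a * b)" by simp
  then show "b \<in> H m M" using H_mult[OF H_inverse[OF a(1)] a(2)] by metis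
qed (rule H_mult)

lemma one_plus_H_iff: assumes x: "x \<in> A" shows "1 + of_nat m * x \<in> H m M \<longleftrightarrow> x \<in> W \<mu>"
proof
  assume "1 + of_nat m * x \<in> H m M"
  then obtain s u where su: "1 + of_nat m * x = s * u" "s \<in> R M" "u \<in> R m" "u \<in> A" "inverse u \<in> A"
    by (rule H_E)
  have u0: "u \<noteq> 0" using su R_nz by blast
  have "divA m (u - 1)" using R_A_iff su by blast
  then obtain y where y: "y \<in> A" "u - 1 = of_nat m * y" by (auto simp: divA_def)
  then have u: "u = 1 + of_nat m * y" by (simp add: algebra_simps)
  have "(1 + of_nat m * x) / (1 + of_nat m * y) = s" using su(1) u0 by (simp add: u[symmetric])
  then have "divA p (x - y)" using one_plus_quotient_iff[OF x y(1)] su(2) by simp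
  then have "divA p (y - x)" using divA_minus[of p "x - y"] by simp
  then have "divA M (of_nat m * (y - x))" unfolding M_eq using divA_mult_both m_gt_1 by blast
  then have "divA M (u - 1 - of_nat m * x)" by (simp add: u algebra_simps)
  moreover have "u * inverse u = 1" using u0 by simp
  ultimately show "x \<in> W \<mu>"
    unfolding W_def m_def[symmetric] M_def[symmetric] using x su(4,5) by blast
next
  assume "x \<in> W \<mu>"
  then obtain u v y where u: "u \<in> A" "v \<in> A" "u * v = 1" "y \<in> A"
      "u = 1 + of_nat (2 * p ^ \<mu>) * y" "divA p (y - x)"
    by (rule W_E)
  have um: "u = 1 + of_nat m * y" using u(5) by (simp add: m_def)
  have u0: "u \<noteq> 0" using u(3) by auto
  have "(1 + of_nat m * x) / u \<in> R M"
    unfolding um one_plus_quotient_iff[OF x u(4)] using divA_minus[OF u(6)] by simp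
  moreover have "u \<in> R m" unfolding R_A_iff[OF u(1)] using u0 u(4) by (auto simp: um)
  moreover have "inverse u = v" using u(3) by (rule inverse_unique)
  ultimately have "(1 + of_nat m * x) / u * u \<in> H m M" using u by (intro H_I) auto
  then show "1 + of_nat m * x \<in> H m M" using u0 by simp
qed

lemma star_H: "a \<in> H m M \<Longrightarrow> star a \<in> H m M"
  unfolding star_def using iinv_n by (intro H_prod H_sig)

text \<open>The expansion of the product of conjugates has error m^2, a multiple of M; so on classes
  modulo S_(\<mu>+1) the map \<open>star\<close> becomes \<open>T\<close>.\<close>

lemma star_one_plus: assumes x: "x \<in> A"
  shows "star (1 + of_nat m * x) / (1 + of_nat m * T x) \<in> R M"
proof (rule quotient_R)
  have a: "1 + of_nat m * x \<in> A" using x by (rule one_plus_A)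
  have s: "star (1 + of_nat m * x) = (\<Prod>i=1..n. 1 + of_nat m * sig (iinv i) x)"
    unfolding star_def using iinv_n x A_K by (intro prod.cong) (auto simp: sig_add sig_mult K_mult)
  show "star (1 + of_nat m * x) \<in> A" unfolding star_def using iinv_n a by (intro A_prod A_sig)
  show "star (1 + of_nat m * x) \<noteq> 0"
    unfolding s using one_plus_nz[OF m_gt_1(1) A_sig[OF iinv_n x]] by simp
  show "1 + of_nat m * T x \<in> A" using T_A[OF x] by (rule one_plus_A)
  show "1 + of_nat m * T x \<noteq> 0" by (rule one_plus_nz[OF m_gt_1(1) T_A[OF x]])
  show "divA m (1 + of_nat m * T x - 1)" using T_A[OF x] by auto
  have "divA (m * m) (star (1 + of_nat m * x) - 1 - of_nat m * T x)"
    unfolding s T_def using iinv_n x by (intro prod_one_plus A_sig) auto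
  then show "divA M (star (1 + of_nat m * x) - (1 + of_nat m * T x))"
    using divA_dvd[OF M_dvd_square] by (simp add: algebra_simps)
qed

text \<open>Every class of S_\<mu> modulo S_(\<mu>+1) is represented by some 1 + m x, where
  \<open>star\<close> acts as \<open>T\<close> and membership in \<open>H m M\<close> becomes
  membership in \<open>W\<close>.\<close>

lemma star_injective_iff:
  "(\<forall>a\<in>R m. star a \<in> H m M \<longrightarrow> a \<in> H m M) \<longleftrightarrow> (\<forall>x\<in>A. T x \<in> W \<mu> \<longrightarrow> x \<in> W \<mu>)"
proof -
  have st: "star (1 + of_nat m * x) \<in> H m M \<longleftrightarrow> T x \<in> W \<mu>" if x: "x \<in> A" for x
  proof -
    have "star (1 + of_nat m * x) = (star (1 + of_nat m * x) / (1 + of_nat m * T x)) * (1 + of_nat m * T x)"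
      using one_plus_nz[OF m_gt_1(1) T_A[OF x]] by simp
    then show ?thesis
      using H_mult_cancel[OF R_M_H[OF star_one_plus[OF x]]] one_plus_H_iff[OF T_A[OF x]] by metis
  qed
  show ?thesis
  proof (intro iffI ballI impI)
    fix x assume L: "\<forall>a\<in>R m. star a \<in> H m M \<longrightarrow> a \<in> H m M" and x: "x \<in> A" "T x \<in> W \<mu>"
    have "1 + of_nat m * x \<in> R m"
      using x one_plus_nz[OF m_gt_1(1) x(1)] one_plus_A by (subst R_A_iff) auto
    then show "x \<in> W \<mu>" using L st x one_plus_H_iff by blast
  next
    fix a assume Rt: "\<forall>x\<in>A. T x \<in> W \<mu> \<longrightarrow> x \<in> W \<mu>" and a: "a \<in> R m" "star a \<in> H m M"
    obtain x where x: "x \<in> A" "a / (1 + of_nat m * x) \<in> R M" using a(1) by (rule R_decompose)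
    define s b where "s = a / (1 + of_nat m * x)" and "b = 1 + of_nat m * x"
    have sb: "a = s * b" using one_plus_nz[OF m_gt_1(1) x(1)] by (simp add: s_def b_def)
    have s: "s \<in> R M" using x by (simp add: s_def)
    have "b \<in> K" unfolding b_def using x one_plus_A A_K by blast
    then have "star a = star s * star b" unfolding sb using s by (intro star_mult) (auto dest: R_K)
    then have "star b \<in> H m M" using a(2) H_mult_cancel[OF R_M_H[OF star_R[OF s]]] by simp
    then have "b \<in> H m M" using st Rt x one_plus_H_iff unfolding b_def by blast
    then show "a \<in> H m M" unfolding sb using H_mult R_M_H[OF s] by blast
  qed
qed

text \<open>S_\<mu>/S_(\<mu>+1) has exponent p; this is what makes its subgroup H_\<mu>/S_(\<mu>+1)
  a vector space over Z/p.\<close>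

lemma R_power_p: assumes "a \<in> R m" shows "a ^ p \<in> R M"
proof -
  obtain x where x: "x \<in> A" "a / (1 + of_nat m * x) \<in> R M" using assms by (rule R_decompose)
  define s b where "s = a / (1 + of_nat m * x)" and "b = 1 + of_nat m * x"
  have sb: "a = s * b" using one_plus_nz[OF m_gt_1(1) x(1)] by (simp add: s_def b_def)
  have b: "b \<in> A" "b \<noteq> 0" unfolding b_def using x one_plus_A one_plus_nz[OF m_gt_1(1) x(1)] by simp_all
  have "b ^ p \<in> R M"
    using power_p_cong[OF b(1)] x b by (subst R_A_iff) (auto simp: b_def)
  then show ?thesis unfolding sb power_mult_distrib using x by (intro R_mult R_power[of s]) (simp_all add: s_def)
qed

end

end


section \<open>The field, its automorphisms and ray congruences\<close>

lemma CC_simps [simp]: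
  "carrier CC = UNIV" "x \<otimes>\<^bsub>CC\<^esub> y = x * y" "x \<oplus>\<^bsub>CC\<^esub> y = x + y" "\<one>\<^bsub>CC\<^esub> = 1" "\<zero>\<^bsub>CC\<^esub> = 0"
  by (simp_all add: ring_of_type_algebra_def)

lemma CC_a_inv [simp]: "\<ominus>\<^bsub>CC\<^esub> x = - x"
proof -
  interpret field CC by (rule field_from_type_algebra)
  show ?thesis by (rule minus_equality) simp_all
qed

lemma CC_m_inv [simp]: "x \<noteq> 0 \<Longrightarrow> inv\<^bsub>CC\<^esub> x = inverse x"
proof -
  interpret field CC by (rule field_from_type_algebra)
  assume "x \<noteq> 0"
  then show ?thesis by (intro comm_inv_char) simp_all
qed

lemma field_units_simps [simp]:
  "carrier (field_units F) = F - {0}" "x \<otimes>\<^bsub>field_units F\<^esub> y = x * y" "\<one>\<^bsub>field_units F\<^esub> = 1"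
  by (simp_all add: field_units_def)

lemma int_ring_simps [simp]:
  "carrier (int_ring F) = {x \<in> F. algebraic_int x}" "x \<otimes>\<^bsub>int_ring F\<^esub> y = x * y"
  "x \<oplus>\<^bsub>int_ring F\<^esub> y = x + y" "\<one>\<^bsub>int_ring F\<^esub> = 1" "\<zero>\<^bsub>int_ring F\<^esub> = 0"
  by (simp_all add: int_ring_def)

context cyclo
begin

lemma cyclotomic_eq_K: "cyclotomic l = K"
proof
  show "cyclotomic l \<subseteq> K"
  proof
    fix x assume "x \<in> cyclotomic l"
    then have "x \<in> generate_field CC {z}" by (simp add: cyclotomic_def)
    then show "x \<in> K"
      by induction (use K_zeta_power[of 1] in \<open>auto simp: K_add K_mult K_minus K_inverse\<close>)
  qed
next
  let ?F = "generate_field CC {z}"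
  have one: "1 \<in> ?F" using generate_field.one[of CC "{z}"] by simp
  have z: "z \<in> ?F" by (rule generate_field.incl) simp
  have add: "x + y \<in> ?F" if "x \<in> ?F" "y \<in> ?F" for x y
    using generate_field.eng_add[OF that] by simp
  have mult: "x * y \<in> ?F" if "x \<in> ?F" "y \<in> ?F" for x y
    using generate_field.eng_mult[OF that] by simp
  have minus: "- x \<in> ?F" if "x \<in> ?F" for x
    using generate_field.a_inv[OF that] by simp
  have inverse: "inverse x \<in> ?F" if "x \<in> ?F" "x \<noteq> 0" for x
    using generate_field.m_inv[OF that(1)] that(2) by simp
  have zero: "0 \<in> ?F" using add[OF one minus[OF one]] by simp
  have nat: "of_nat k \<in> ?F" for k by (induction k) (simp_all add: zero one add)
  have int: "of_int k \<in> ?F" for k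
    using nat[of "nat \<bar>k\<bar>"] minus[OF nat[of "nat \<bar>k\<bar>"]] by (cases "k \<ge> 0") simp_all
  have rat: "of_rat q \<in> ?F" for q
  proof (cases q)
    case (Fract a b)
    have "of_rat q = (of_int a * inverse (of_int b) :: complex)"
      using Fract by (simp add: of_rat_rat divide_inverse)
    also have "\<dots> \<in> ?F" using Fract by (intro mult int inverse) auto
    finally show ?thesis .
  qed
  have "ev 1 f \<in> ?F" for f
  proof (induction f)
    case 0
    show ?case by (simp add: ev_def zero)
  next
    case (pCons a f)
    have "ev 1 (pCons a f) = of_rat a + z * ev 1 f"
      by (simp add: ev_def of_rat_hom.map_poly_pCons_hom)
    then show ?case using pCons add rat mult z by simp
  qed
  then show "K \<subseteq> cyclotomic l" by (auto simp: K_def cyclotomic_def)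
qed

lemma carrier_int_ring: "carrier (int_ring K) = A"
  by (auto simp: A_def)

lemma cring_int_ring: "cring (int_ring K)"
proof (rule cringI)
  show "abelian_group (int_ring K)"
    by (rule abelian_groupI, unfold carrier_int_ring)
      (auto simp: A_add add.assoc add.commute intro: bexI[of _ "- _"] A_minus)
  show "comm_monoid (int_ring K)"
    by (rule comm_monoidI, unfold carrier_int_ring) (auto simp: mult_ac)
qed (unfold carrier_int_ring, simp add: distrib_right)

text \<open>Local to global. The denominators of c = (a - 1)/m together with mA generate an ideal
  that lies in no prime above m, because c is integral locally there. Hence 1 = y + m t with y a
  denominator of c, and y is congruent to 1. Conversely, a denominator congruent to 1 modulo m
  avoids every prime above m.\<close>

lemma ray_cong_iff:
  assumes m: "m > 0" and a: "a \<in> K" "a \<noteq> 0"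
  shows "ray_cong K m a \<longleftrightarrow> a \<in> R m"
proof
  assume rc: "ray_cong K m a"
  define c where "c = (a - 1) / of_nat m"
  define I where "I = {y + of_nat m * t | y t. y \<in> A \<and> t \<in> A \<and> y * c \<in> A}"
  have I_I: "y + of_nat m * t \<in> I" if "y \<in> A" "t \<in> A" "y * c \<in> A" for y t
    unfolding I_def using that by blast
  have "0 \<in> I" "of_nat m \<in> I" using I_I[of 0 0] I_I[of 0 1] by simp_all
  interpret int: cring "int_ring K" by (rule cring_int_ring)
  have a_inv: "\<ominus>\<^bsub>int_ring K\<^esub> x = - x" if "x \<in> A" for x
    using that by (intro int.minus_equality) (simp_all add: A_def K_minus)
  have ideal: "ideal I (int_ring K)"
  proof (rule idealI)
    show "subgroup I (add_monoid (int_ring K))"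
    proof (rule int.add.subgroupI)
      show "I \<subseteq> carrier (int_ring K)"
        unfolding carrier_int_ring I_def by (auto simp: A_add A_mult)
      show "I \<noteq> {}" using \<open>0 \<in> I\<close> by blast
    next
      fix x assume "x \<in> I"
      then obtain y t where yt: "x = y + of_nat m * t" "y \<in> A" "t \<in> A" "y * c \<in> A" unfolding I_def by blast
      have "- y * c \<in> A" using A_minus[OF yt(4)] by simp
      then have "- x \<in> I" using I_I[of "- y" "- t"] yt by (simp add: A_minus)
      moreover have "x \<in> A" using yt by (simp add: A_add A_mult)
      ultimately show "\<ominus>\<^bsub>int_ring K\<^esub> x \<in> I" using a_inv by simp
    next
      fix x x' assume "x \<in> I" "x' \<in> I"
      then obtain y t y' t' where yt: "x = y + of_nat m * t" "y \<in> A" "t \<in> A" "y * c \<in> A"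
          "x' = y' + of_nat m * t'" "y' \<in> A" "t' \<in> A" "y' * c \<in> A"
        unfolding I_def by blast
      have "(y + y') * c \<in> A" using A_add[OF yt(4,8)] by (simp add: distrib_right)
      then have "(y + y') + of_nat m * (t + t') \<in> I" using yt by (intro I_I) auto
      then show "x \<oplus>\<^bsub>int_ring K\<^esub> x' \<in> I" using yt by (simp add: algebra_simps)
    qed
  next
    fix x w assume "x \<in> I" and w: "w \<in> carrier (int_ring K)"
    then obtain y t where yt: "x = y + of_nat m * t" "y \<in> A" "t \<in> A" "y * c \<in> A" unfolding I_def by blast
    have wA: "w \<in> A" using w carrier_int_ring by blast
    have "(w * y) * c \<in> A" using A_mult[OF wA yt(4)] by (simp add: mult.assoc)
    then have "w * y + of_nat m * (w * t) \<in> I" using yt wA by (intro I_I) auto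
    then show "w \<otimes>\<^bsub>int_ring K\<^esub> x \<in> I" "x \<otimes>\<^bsub>int_ring K\<^esub> w \<in> I"
      using yt by (simp_all add: algebra_simps)
  qed (rule int.ring_axioms)
  have "1 \<in> I"
  proof (rule ccontr)
    assume "1 \<notin> I"
    then have "I \<noteq> carrier (int_ring K)" unfolding carrier_int_ring by auto
    then obtain P where P: "maximalideal P (int_ring K)" "I \<subseteq> P"
      using exists_maximalideal[OF cring_int_ring ideal] by blast
    have "of_nat m \<in> P" "0 \<in> P" using P \<open>of_nat m \<in> I\<close> \<open>0 \<in> I\<close> by auto
    then have "P \<in> primes_of K"
      using int.maximalideal_prime[OF P(1)] m by (auto simp: primes_of_def)
    then have "c \<in> localisation K P" using rc \<open>of_nat m \<in> P\<close> by (simp add: ray_cong_def c_def)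
    then obtain x y where xy: "c = x / y" "x \<in> A" "y \<in> A" "y \<notin> P"
      unfolding localisation_def carrier_int_ring by blast
    then have "y \<noteq> 0" using \<open>0 \<in> P\<close> by auto
    then have "y * c \<in> A" using xy by simp
    then have "y \<in> I" using I_I[of y 0] xy by simp
    then show False using P xy by blast
  qed
  then obtain y t where yt: "1 = y + of_nat m * t" "y \<in> A" "t \<in> A" "y * c \<in> A" unfolding I_def by blast
  show "a \<in> R m"
  proof (rule R_I[OF a yt(2)])
    have "y - 1 = of_nat m * (- t)" using yt(1) by (simp add: algebra_simps)
    then show "divA m (y - 1)" using yt(3) divA_I A_minus by metis
    have "y * (a - 1) = of_nat m * (y * c)" using m by (simp add: c_def)
    then show "divA m (y * (a - 1))" using yt(4) divA_I by metis
  qed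
next
  assume "a \<in> R m"
  then obtain d where d: "d \<in> A" "divA m (d - 1)" "divA m (d * (a - 1))" by (rule R_E)
  obtain t where t: "t \<in> A" "d - 1 = of_nat m * t" using d(2) by (auto simp: divA_def)
  obtain s where s: "s \<in> A" "d * (a - 1) = of_nat m * s" using d(3) by (auto simp: divA_def)
  show "ray_cong K m a"
    unfolding ray_cong_def
  proof (intro ballI impI)
    fix P assume P: "P \<in> primes_of K" and mP: "of_nat m \<in> P"
    interpret P: primeideal P "int_ring K" using P by (simp add: primes_of_def)
    have "d \<notin> P"
    proof
      assume dP: "d \<in> P"
      have mt: "of_nat m * (- t) \<in> P"
        using P.I_r_closed[OF mP, of "- t"] A_minus[OF t(1)] unfolding carrier_int_ring by simp
      then have "d + of_nat m * (- t) \<in> P" 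
        using additive_subgroup.a_closed[OF P.additive_subgroup_axioms dP mt] by simp
      moreover have "d + of_nat m * (- t) = 1" using t(2) by (simp add: algebra_simps)
      ultimately have "\<one>\<^bsub>int_ring K\<^esub> \<in> P" by simp
      then show False using P.I_notcarr P.one_imp_carrier by blast
    qed
    moreover have "0 \<in> P" 
      using additive_subgroup.zero_closed[OF P.additive_subgroup_axioms] by simp
    ultimately have d0: "d \<noteq> 0" by auto
    have loc: "x / d \<in> localisation K P" if "x \<in> A" for x
      unfolding localisation_def carrier_int_ring using that d(1) \<open>d \<notin> P\<close> by blast
    have "(d + of_nat m * s) / d \<in> localisation K P" 
      using d(1) s(1) by (intro loc) (simp add: A_add A_mult)
    moreover have "a = (d + of_nat m * s) / d"
      unfolding s(2)[symmetric] using d0 by (simp add: field_simps)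
    moreover have "(a - 1) / of_nat m = s / d" using s(2) d0 m by (simp add: field_simps)
    ultimately show "a \<in> localisation K P \<and> (a - 1) / of_nat m \<in> localisation K P"
      using loc[OF s(1)] by metis
  qed
qed

section \<open>Automorphisms of K and their inverses\<close>

lemma gal_carrier_eqI:
  assumes "\<sigma> \<in> carrier (gal F L)" "\<tau> \<in> carrier (gal F L)" "\<And>x. x \<in> L \<Longrightarrow> \<sigma> x = \<tau> x"
  shows "\<sigma> = \<tau>"
  using assms unfolding gal_def Bij_def by (auto intro: extensionalityI)

lemma gal_determined:
  assumes \<sigma>: "\<sigma> \<in> carrier (gal \<rat> K)" and \<sigma>z: "\<sigma> z = z ^ i" and x: "x \<in> K" and i: "\<not> l dvd i"
  shows "\<sigma> x = sig i x"
proof -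
  have hom: "\<sigma> (a + b) = \<sigma> a + \<sigma> b" "\<sigma> (a * b) = \<sigma> a * \<sigma> b" if "a \<in> K" "b \<in> K" for a b
  proof -
    have "\<sigma> \<in> Ring.ring_hom (CC\<lparr>carrier := K\<rparr>) (CC\<lparr>carrier := K\<rparr>)" using \<sigma> by (simp add: gal_def)
    from ring_hom_add[OF this, of a b] ring_hom_mult[OF this, of a b] that
    show "\<sigma> (a + b) = \<sigma> a + \<sigma> b" "\<sigma> (a * b) = \<sigma> a * \<sigma> b" by simp_all
  qed
  have rat: "\<sigma> q = q" if "q \<in> \<rat>" for q using \<sigma> that by (auto simp: gal_def)
  obtain f where f: "x = ev 1 f" using x by (elim KE)
  have "\<sigma> (ev 1 f) = ev i f"
  proof (induction f)
    case 0
    show ?case using rat[of 0] by (simp add: ev_def)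
  next
    case (pCons a f)
    have e: "ev j (pCons a f) = of_rat a + z ^ j * ev j f" for j
      by (simp add: ev_def of_rat_hom.map_poly_pCons_hom)
    have "\<sigma> (ev 1 (pCons a f)) = \<sigma> (of_rat a) + \<sigma> (z ^ 1) * \<sigma> (ev 1 f)"
      unfolding e using K_Rats[of "of_rat a"] K_zeta_power[of 1] by (simp add: hom K_mult del: power_one_right)
    then show ?case using rat[of "of_rat a"] pCons by (simp add: e \<sigma>z)
  qed
  then show ?thesis using f sig_ev[OF i] by simp
qed

lemma restrict_sig_gal:
  assumes i: "\<not> l dvd i"
  shows "restrict (sig i) K \<in> carrier (gal \<rat> K)"
proof -
  obtain j where j: "j \<in> G" "(i * j) mod l = 1" "(j * i) mod l = 1" using G_inverse[OF i] by blast
  have jd: "\<not> l dvd j" using j G_not_dvd by blast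
  have inv: "sig i (sig j x) = x" "sig j (sig i x) = x" if "x \<in> K" for x
  proof -
    have "sig (i * j) x = sig 1 x" "sig (j * i) x = sig 1 x" using j l_ge_3 by (auto intro: sig_cong)
    then show "sig i (sig j x) = x" "sig j (sig i x) = x"
      using sig_sig[OF i jd that] sig_sig[OF jd i that] sig_1[OF that] by simp_all
  qed
  have "bij_betw (sig i) K K"
    by (rule bij_betw_byWitness[where f' = "sig j"]) (use inv sig_K i jd in auto)
  then have "bij_betw (restrict (sig i) K) K K" by (simp cong: bij_betw_cong)
  moreover have "restrict (sig i) K \<in> Ring.ring_hom (CC\<lparr>carrier := K\<rparr>) (CC\<lparr>carrier := K\<rparr>)"
    using i by (auto intro!: ring_hom_memI simp: sig_K sig_add sig_mult K_add K_mult)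
  ultimately show ?thesis using i by (auto simp: gal_def Bij_def sig_Rats K_Rats)
qed

lemma phi_eq:
  assumes i: "\<not> l dvd i"
  shows "phi l i = restrict (sig i) K"
  unfolding phi_def cyclotomic_eq_K
proof (rule the_equality)
  have z: "z \<in> K" using K_zeta_power[of 1] by simp
  show "restrict (sig i) K \<in> carrier (gal \<rat> K) \<and> restrict (sig i) K z = z ^ i"
    using restrict_sig_gal[OF i] z sig_zeta_power[OF i, of 1] by simp
  fix \<sigma> assume s: "\<sigma> \<in> carrier (gal \<rat> K) \<and> \<sigma> z = z ^ i"
  show "\<sigma> = restrict (sig i) K"
    using s gal_determined[of \<sigma> i] i by (intro gal_carrier_eqI[OF _ restrict_sig_gal[OF i]]) auto
qed

lemma gal_mult:
  "\<sigma> \<in> carrier (gal F L) \<Longrightarrow> \<tau> \<in> carrier (gal F L) \<Longrightarrow> \<sigma> \<otimes>\<^bsub>gal F L\<^esub> \<tau> = compose L \<sigma> \<tau>"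
  by (simp add: gal_def BijGroup_def)

lemma gal_one: "\<one>\<^bsub>gal F L\<^esub> = (\<lambda>x\<in>L. x)"
  by (simp add: gal_def BijGroup_def)

lemma inv_phi:
  assumes i: "\<not> l dvd i" and j: "\<not> l dvd j" and ij: "(i * j) mod l = 1"
  shows "inv\<^bsub>gal \<rat> K\<^esub> (phi l i) = restrict (sig j) K"
proof -
  let ?\<sigma> = "\<lambda>i. restrict (sig i) K"
  have mem: "?\<sigma> i \<in> carrier (gal \<rat> K)" "?\<sigma> j \<in> carrier (gal \<rat> K)"
    using restrict_sig_gal i j by blast+
  have "sig (i * j) x = x" "sig (j * i) x = x" if "x \<in> K" for x
    using ij l_ge_3 sig_1[OF that] sig_cong[of "i * j" 1 x] by (simp_all add: mult.commute)
  then have inv: "compose K (?\<sigma> i) (?\<sigma> j) = (\<lambda>x\<in>K. x)" "compose K (?\<sigma> j) (?\<sigma> i) = (\<lambda>x\<in>K. x)"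
    unfolding compose_def using sig_sig[OF i j] sig_sig[OF j i] sig_K i j
    by (auto intro!: restrict_ext)
  show ?thesis
    unfolding m_inv_def phi_eq[OF i] gal_one
  proof (rule the_equality)
    show "?\<sigma> j \<in> carrier (gal \<rat> K) \<and> ?\<sigma> i \<otimes>\<^bsub>gal \<rat> K\<^esub> ?\<sigma> j = (\<lambda>x\<in>K. x) \<and> ?\<sigma> j \<otimes>\<^bsub>gal \<rat> K\<^esub> ?\<sigma> i = (\<lambda>x\<in>K. x)"
      using mem inv by (simp add: gal_mult)
    fix \<tau> assume t: "\<tau> \<in> carrier (gal \<rat> K) \<and> ?\<sigma> i \<otimes>\<^bsub>gal \<rat> K\<^esub> \<tau> = (\<lambda>x\<in>K. x) \<and> \<tau> \<otimes>\<^bsub>gal \<rat> K\<^esub> ?\<sigma> i = (\<lambda>x\<in>K. x)"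
    show "\<tau> = ?\<sigma> j"
    proof (rule gal_carrier_eqI[OF _ mem(2)])
      fix x assume x: "x \<in> K"
      have "\<tau> \<otimes>\<^bsub>gal \<rat> K\<^esub> ?\<sigma> i = compose K \<tau> (?\<sigma> i)" using t mem by (intro gal_mult) auto
      with t have "compose K \<tau> (?\<sigma> i) = (\<lambda>x\<in>K. x)" by metis
      then have "compose K \<tau> (?\<sigma> i) (sig j x) = sig j x" using sig_K[OF j x] by simp
      moreover have "sig i (sig j x) = x"
        using sig_sig[OF i j x] \<open>\<And>x. x \<in> K \<Longrightarrow> sig (i * j) x = x\<close> x by simp
      ultimately show "\<tau> x = ?\<sigma> j x" using sig_K[OF j x] x by (simp add: compose_def)
    qed (use t in blast)
  qed
qed

end


section \<open>Dimension count\<close>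

lemma exponent_module_vectorspace:
  assumes G: "comm_group G" and p: "Factorial_Ring.prime (p :: nat)"
    and exponent: "\<And>x. x \<in> carrier G \<Longrightarrow> x [^]\<^bsub>G\<^esub> p = \<one>\<^bsub>G\<^esub>"
  shows "vectorspace (residue_ring (int p)) (exponent_module G)"
proof -
  interpret G: comm_group G by fact
  interpret F: residues_prime p "residue_ring (int p)" by unfold_locales (rule p)
  \<comment> \<open>Scalar arithmetic is reduced modulo p, while exponents are integers; exponent p
    of the group reconciles the two in the module axioms.\<close>
  have pow_mod: "x [^]\<^bsub>G\<^esub> (a mod int p) = x [^]\<^bsub>G\<^esub> a" if x: "x \<in> carrier G" for x and a :: int
  proof -
    have "x [^]\<^bsub>G\<^esub> (int p * (a div int p)) = (x [^]\<^bsub>G\<^esub> int p) [^]\<^bsub>G\<^esub> (a div int p)"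
      using x by (simp add: G.int_pow_pow)
    also have "\<dots> = \<one>\<^bsub>G\<^esub>" using exponent[OF x] by (simp add: int_pow_int)
    finally have 1: "x [^]\<^bsub>G\<^esub> (int p * (a div int p)) = \<one>\<^bsub>G\<^esub>" .
    have "x [^]\<^bsub>G\<^esub> a = x [^]\<^bsub>G\<^esub> (int p * (a div int p) + a mod int p)" by simp
    also have "\<dots> = x [^]\<^bsub>G\<^esub> (int p * (a div int p)) \<otimes>\<^bsub>G\<^esub> x [^]\<^bsub>G\<^esub> (a mod int p)"
      using x by (rule G.int_pow_mult)
    finally show ?thesis using 1 x by simp
  qed
  have "abelian_group (exponent_module G)"
  proof (rule abelian_groupI)
    fix x assume "x \<in> carrier (exponent_module G)"
    then have x: "x \<in> carrier G" by (simp add: exponent_module_def)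
    then show "\<exists>y\<in>carrier (exponent_module G). y \<oplus>\<^bsub>exponent_module G\<^esub> x = \<zero>\<^bsub>exponent_module G\<^esub>"
      by (intro bexI[of _ "inv\<^bsub>G\<^esub> x"]) (simp_all add: exponent_module_def)
  qed (simp_all add: exponent_module_def G.m_assoc G.m_comm G.m_lcomm)
  then have "module (residue_ring (int p)) (exponent_module G)"
    by (rule moduleI[OF F.cring])
      (simp_all add: exponent_module_def residue_ring_def pow_mod G.int_pow_mult G.int_pow_pow
        G.int_pow_distrib mult.commute)
  then show ?thesis
    by (intro vectorspace.intro F.is_field)
qed

text \<open>Each vector is exactly one linear combination of a finite basis, with p choices per
  coefficient. This converts the dimension into a cardinality that can be compared with the count by
  \<open>kappa\<close>.\<close>

lemma card_eq_power_dim_mod: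
  assumes G: "comm_group G" "finite (carrier G)" and p: "Factorial_Ring.prime (p :: nat)"
    and exponent: "\<And>x. x \<in> carrier G \<Longrightarrow> x [^]\<^bsub>G\<^esub> p = \<one>\<^bsub>G\<^esub>"
  shows "card (carrier G) = p ^ dim_mod p G"
proof -
  interpret vectorspace "residue_ring (int p)" "exponent_module G"
    using G(1) p exponent by (rule exponent_module_vectorspace)
  let ?V = "exponent_module G"
  have car: "carrier ?V = carrier G" by (simp add: exponent_module_def)
  have "span (carrier ?V) = carrier ?V"
    using in_own_span[of "carrier ?V"] span_is_subset2[of "carrier ?V"] by blast
  then have "fin_dim" unfolding fin_dim_def using G(2) car by (metis order_refl)
  then obtain B where B: "finite B" "basis B" using finite_basis_exists by blast
  have BV: "B \<subseteq> carrier ?V" using B(2) by (simp add: basis_def)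
  let ?L = "B \<rightarrow>\<^sub>E carrier (residue_ring (int p))"
  have uniq: "\<exists>!a. a \<in> ?L \<and> lincomb a B = v" if "v \<in> carrier ?V" for v
    using basis_criterion[OF B(1) BV] B(2) that by blast
  have "bij_betw (\<lambda>a. lincomb a B) ?L (carrier ?V)"
  proof (rule bij_betwI')
    fix a b assume ab: "a \<in> ?L" "b \<in> ?L"
    have "a \<in> B \<rightarrow> carrier (residue_ring (int p))" using ab by (auto simp: PiE_def)
    then have cl: "lincomb a B \<in> carrier ?V" using BV by (rule lincomb_closed[rotated])
    show "(lincomb a B = lincomb b B) = (a = b)" using uniq[OF cl] ab by metis
    show "lincomb a B \<in> carrier ?V" by (rule cl)
  next
    fix v assume "v \<in> carrier ?V"
    then show "\<exists>a\<in>?L. v = lincomb a B" using uniq by metis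
  qed
  then have "card (carrier G) = card ?L" using bij_betw_same_card car by metis
  also have "\<dots> = p ^ card B" using B(1) by (simp add: card_PiE residue_ring_def)
  also have "card B = dim_mod p G" using dim_basis[OF B] by (simp add: dim_mod_def)
  finally show ?thesis .
qed

section \<open>Subgroups of the multiplicative group and their cosets\<close>

context cyclo
begin

lemma field_units_comm_group: "comm_group (field_units K)"
proof (rule comm_groupI)
  fix x assume "x \<in> carrier (field_units K)"
  then show "\<exists>y\<in>carrier (field_units K). y \<otimes>\<^bsub>field_units K\<^esub> x = \<one>\<^bsub>field_units K\<^esub>"
    by (intro bexI[of _ "inverse x"]) auto
qed (auto simp: mult_ac)

lemma field_units_inv: "x \<in> K - {0} \<Longrightarrow> inv\<^bsub>field_units K\<^esub> x = inverse x"
proof -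
  interpret comm_group "field_units K" by (rule field_units_comm_group)
  show "x \<in> K - {0} \<Longrightarrow> inv\<^bsub>field_units K\<^esub> x = inverse x"
    by (rule comm_inv_char) auto
qed

lemma subgroup_field_unitsI:
  assumes "S \<subseteq> K - {0}" "1 \<in> S" "\<And>a b. a \<in> S \<Longrightarrow> b \<in> S \<Longrightarrow> a * b \<in> S" "\<And>a. a \<in> S \<Longrightarrow> inverse a \<in> S"
  shows "subgroup S (field_units K)"
proof -
  interpret comm_group "field_units K" by (rule field_units_comm_group)
  have "inv\<^bsub>field_units K\<^esub> a \<in> S" if "a \<in> S" for a
    using field_units_inv[OF subsetD[OF assms(1) that]] assms(4)[OF that] by simp
  then show ?thesis using assms by (intro subgroupI) auto
qed

lemma R_subset: "R m \<subseteq> K - {0}"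
  by (auto simp: R_def)

lemma R_subgroup: "subgroup (R m) (field_units K)"
  by (rule subgroup_field_unitsI[OF R_subset R_1 R_mult R_inverse])

lemma r_coset_field_units: "S #>\<^bsub>field_units K\<^esub> a = (\<lambda>h. h * a) ` S"
  by (auto simp: r_coset_def)

lemma r_coset_eq_iff:
  assumes S: "subgroup S (field_units K)" and ab: "a \<in> K - {0}" "b \<in> K - {0}"
  shows "S #>\<^bsub>field_units K\<^esub> a = S #>\<^bsub>field_units K\<^esub> b \<longleftrightarrow> a / b \<in> S"
proof -
  interpret comm_group "field_units K" by (rule field_units_comm_group)
  have one: "1 \<in> S" using subgroup.one_closed[OF S] by simp
  have mult: "x * y \<in> S" if "x \<in> S" "y \<in> S" for x y using subgroup.m_closed[OF S that] by simp
  have inv: "inverse x \<in> S" if "x \<in> S" for x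
    using subgroup.m_inv_closed[OF S that] field_units_inv[of x] subgroup.mem_carrier[OF S that] by simp
  show ?thesis
    unfolding r_coset_field_units
  proof
    assume "(\<lambda>h. h * a) ` S = (\<lambda>h. h * b) ` S"
    then have "1 * a \<in> (\<lambda>h. h * b) ` S" using one by blast
    then obtain h where "h \<in> S" "a = h * b" by auto
    then show "a / b \<in> S" using ab by simp
  next
    assume q: "a / b \<in> S"
    have "h * a \<in> (\<lambda>h. h * b) ` S" if "h \<in> S" for h
      using mult[OF that q] ab by (intro image_eqI[of _ _ "h * (a / b)"]) auto
    moreover have "h * b \<in> (\<lambda>h. h * a) ` S" if "h \<in> S" for h
      using mult[OF that inv[OF q]] ab by (intro image_eqI[of _ _ "h * inverse (a / b)"]) auto
    ultimately show "(\<lambda>h. h * a) ` S = (\<lambda>h. h * b) ` S" by blast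
  qed
qed

end

context cyclo_p
begin

lemma H_subgroup: "\<mu> \<ge> 1 \<Longrightarrow> m = 2 * p ^ \<mu> \<Longrightarrow> M = 2 * p ^ (\<mu> + 1) \<Longrightarrow> subgroup (H m M) (field_units K)"
proof -
  assume a: "\<mu> \<ge> 1" "m = 2 * p ^ \<mu>" "M = 2 * p ^ (\<mu> + 1)"
  show ?thesis
  proof (rule subgroup_field_unitsI)
    show "H m M \<subseteq> K - {0}" using H_R[OF a] R_subset by blast
  qed (fact R_M_H[OF a R_1] H_mult[OF a] H_inverse[OF a])+
qed

lemma S_ray_eq: "S_ray l p \<mu> = R (2 * p ^ \<mu>)"
  unfolding S_ray_def cyclotomic_eq_K
  using ray_cong_iff[of "2 * p ^ \<mu>"] p_pos(1) R_subset by auto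

lemma Units_int_ring: "Units (int_ring K) = {u \<in> A. u \<noteq> 0 \<and> inverse u \<in> A}"
proof (intro equalityI subsetI)
  fix u assume "u \<in> Units (int_ring K)"
  then obtain v where v: "u \<in> A" "v \<in> A" "v * u = 1"
    unfolding Units_def carrier_int_ring by auto
  then have "u * v = 1" by (simp add: mult.commute)
  then have "inverse u = v" by (rule inverse_unique)
  then show "u \<in> {u \<in> A. u \<noteq> 0 \<and> inverse u \<in> A}" using v by auto
next
  fix u assume "u \<in> {u \<in> A. u \<noteq> 0 \<and> inverse u \<in> A}"
  then show "u \<in> Units (int_ring K)"
    unfolding Units_def carrier_int_ring by (auto intro!: bexI[of _ "inverse u"])
qed

lemma H_ray_eq: "H_ray l p \<mu> = H (2 * p ^ \<mu>) (2 * p ^ (\<mu> + 1))"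
  unfolding H_ray_def S_ray_eq cyclotomic_eq_K Units_int_ring set_mult_def H_def
  using R_nz by auto

lemma phi_star_eq: assumes "a \<in> K" shows "phi_star l a = star a"
  unfolding phi_star_def star_def cyclotomic_eq_K n_def[symmetric]
proof (rule prod.cong)
  fix i assume "i \<in> {1..n}"
  then have i: "\<not> l dvd i" using n_G G_not_dvd by blast
  show "(inv\<^bsub>gal \<rat> K\<^esub> (phi l i)) a = sig (iinv i) a"
    using inv_phi[OF i iinv(4,2)[OF i]] assms by simp
qed simp

text \<open>Classes of H_1 modulo S_2 are represented by 1 + 2p x with x in \<open>W 1\<close>, and
  two of them agree iff \<open>kappa\<close> does; so \<open>kappa\<close> of a representative is a
  bijection on classes. Exponent p comes from \<open>R_power_p\<close>.\<close>

lemma card_H_mod_S: "card (carrier (H_mod_S l p 1)) = card (kappa ` W 1)"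
  and H_mod_S_props: "comm_group (H_mod_S l p 1)" "finite (carrier (H_mod_S l p 1))"
    "\<And>C. C \<in> carrier (H_mod_S l p 1) \<Longrightarrow> C [^]\<^bsub>H_mod_S l p 1\<^esub> p = \<one>\<^bsub>H_mod_S l p 1\<^esub>"
proof -
  define m M where "m = 2 * p ^ 1" and "M = 2 * p ^ (1 + 1)"
  note ctx = order_refl[of "1 :: nat"] m_def M_def
  define Q where "Q = (field_units K)\<lparr>carrier := H m M\<rparr>"
  have eq: "H_mod_S l p 1 = Q Mod R M"
    by (simp only: Q_def H_ray_eq S_ray_eq cyclotomic_eq_K m_def M_def)
  interpret FU: comm_group "field_units K" by (rule field_units_comm_group)
  have Q: "comm_group Q"
    unfolding Q_def using FU.subgroup_imp_group[OF H_subgroup[OF ctx]]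
    by (rule group.group_comm_groupI) (simp add: mult.commute)
  interpret Q: comm_group Q by (rule Q)
  have RQ: "subgroup (R M) Q"
    unfolding Q_def using R_M_H[OF ctx] 
    by (intro FU.subgroup_incl R_subgroup H_subgroup[OF ctx]) auto
  show "comm_group (H_mod_S l p 1)" unfolding eq by (rule Q.abelian_FactGroup[OF RQ])
  have norm: "R M \<lhd> Q" by (rule Q.subgroup_imp_normal[OF RQ])
  have carQ: "carrier (Q Mod R M) = (\<lambda>a. R M #>\<^bsub>field_units K\<^esub> a) ` H m M"
    by (auto simp: FactGroup_def RCOSETS_def Q_def)
  define U where "U = (\<lambda>x. 1 + of_nat m * x) ` W 1"
  have m1: "m > 1" by (rule m_gt_1(1)[OF ctx])
  have UH: "U \<subseteq> H m M"
    unfolding U_def using one_plus_H_iff[OF ctx W_A] by blast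
  have "carrier (Q Mod R M) = (\<lambda>a. R M #>\<^bsub>field_units K\<^esub> a) ` U"
  proof (rule antisym)
    show "carrier (Q Mod R M) \<subseteq> (\<lambda>a. R M #>\<^bsub>field_units K\<^esub> a) ` U"
    proof
      fix C assume "C \<in> carrier (Q Mod R M)"
      then obtain a where a: "a \<in> H m M" "C = R M #>\<^bsub>field_units K\<^esub> a" unfolding carQ by blast
      have aR: "a \<in> R m" by (rule H_R[OF ctx a(1)])
      obtain x where x: "x \<in> A" "a / (1 + of_nat m * x) \<in> R M" using R_decompose[OF ctx aR] .
      have nz: "1 + of_nat m * x \<noteq> 0" by (rule one_plus_nz[OF m1 x(1)])
      have "a = (a / (1 + of_nat m * x)) * (1 + of_nat m * x)" using nz by simp
      then have "1 + of_nat m * x \<in> H m M"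
        using a(1) H_mult_cancel[OF ctx R_M_H[OF ctx x(2)]] by metis
      then have "x \<in> W 1" using one_plus_H_iff[OF ctx x(1)] by blast
      moreover have "C = R M #>\<^bsub>field_units K\<^esub> (1 + of_nat m * x)"
        unfolding a(2) using x nz aR A_K[OF one_plus_A[OF x(1)]] R_K R_nz
        by (subst r_coset_eq_iff[OF R_subgroup]) auto
      ultimately show "C \<in> (\<lambda>a. R M #>\<^bsub>field_units K\<^esub> a) ` U" unfolding U_def by blast
    qed
    show "(\<lambda>a. R M #>\<^bsub>field_units K\<^esub> a) ` U \<subseteq> carrier (Q Mod R M)" unfolding carQ using UH by blast
  qed
  then have car: "carrier (Q Mod R M) = (\<lambda>x. R M #>\<^bsub>field_units K\<^esub> (1 + of_nat m * x)) ` W 1"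
    by (simp add: U_def image_image)
  have same: "R M #>\<^bsub>field_units K\<^esub> (1 + of_nat m * x) = R M #>\<^bsub>field_units K\<^esub> (1 + of_nat m * y)
      \<longleftrightarrow> kappa x = kappa y" if "x \<in> W 1" "y \<in> W 1" for x y
  proof -
    have V: "x \<in> V0" "y \<in> V0" using W_subset_V0[of 1] that by auto
    have "R M #>\<^bsub>field_units K\<^esub> (1 + of_nat m * x) = R M #>\<^bsub>field_units K\<^esub> (1 + of_nat m * y)
        \<longleftrightarrow> (1 + of_nat m * x) / (1 + of_nat m * y) \<in> R M"
      using that W_A one_plus_nz[OF m1] A_K one_plus_A by (intro r_coset_eq_iff[OF R_subgroup]) auto
    then show ?thesis
      using one_plus_quotient_iff[OF ctx W_A[OF that(1)] W_A[OF that(2)]] kappa_eq_iff[OF V] by blast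
  qed
  define f where "f C = kappa (SOME x. x \<in> W 1 \<and> C = R M #>\<^bsub>field_units K\<^esub> (1 + of_nat m * x))" for C
  have f: "f (R M #>\<^bsub>field_units K\<^esub> (1 + of_nat m * x)) = kappa x" if x: "x \<in> W 1" for x
  proof -
    let ?P = "\<lambda>y. y \<in> W 1 \<and> R M #>\<^bsub>field_units K\<^esub> (1 + of_nat m * x) = R M #>\<^bsub>field_units K\<^esub> (1 + of_nat m * y)"
    have "?P (SOME y. ?P y)" by (rule someI[of ?P x]) (use x in simp)
    then show ?thesis unfolding f_def using same[OF x, of "SOME y. ?P y"] by simp
  qed
  have bij: "bij_betw f (carrier (Q Mod R M)) (kappa ` W 1)"
  proof (rule bij_betw_imageI)
    show "inj_on f (carrier (Q Mod R M))"
    proof (rule inj_onI)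
      fix C D assume "C \<in> carrier (Q Mod R M)" "D \<in> carrier (Q Mod R M)" and fCD: "f C = f D"
      then obtain x y where xy: "x \<in> W 1" "y \<in> W 1"
          "C = R M #>\<^bsub>field_units K\<^esub> (1 + of_nat m * x)" "D = R M #>\<^bsub>field_units K\<^esub> (1 + of_nat m * y)"
        unfolding car by blast
      have "kappa x = kappa y" using fCD f[OF xy(1)] f[OF xy(2)] unfolding xy(3,4) by simp
      then show "C = D" unfolding xy(3,4) same[OF xy(1,2)] .
    qed
    show "f ` carrier (Q Mod R M) = kappa ` W 1"
      unfolding car image_image using f by (intro image_cong) auto
  qed
  show "card (carrier (H_mod_S l p 1)) = card (kappa ` W 1)"
    unfolding eq by (rule bij_betw_same_card[OF bij])
  have "finite (kappa ` W 1)"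
    using kappa_range by (intro finite_subset[OF _ finite_PiE[of "{2..n}" "\<lambda>_. {0..<int p}"]]) auto
  then show "finite (carrier (H_mod_S l p 1))"
    unfolding eq using bij_betw_finite[OF bij] by simp
  fix C assume "C \<in> carrier (H_mod_S l p 1)"
  then obtain a where a: "a \<in> H m M" "C = R M #>\<^bsub>field_units K\<^esub> a" unfolding eq carQ by blast
  have ap: "a ^ p \<in> R M" by (rule R_power_p[OF ctx H_R[OF ctx a(1)]])
  have aQ: "a \<in> carrier Q" using a by (simp add: Q_def)
  have C: "C = R M #>\<^bsub>Q\<^esub> a" using a(2) by (simp add: Q_def)
  have powQ: "a ^ k \<in> carrier Q" for k
    by (induction k) (use aQ H_mult[OF ctx] R_M_H[OF ctx R_1] in \<open>auto simp: Q_def\<close>)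
  have "C [^]\<^bsub>Q Mod R M\<^esub> k = R M #>\<^bsub>Q\<^esub> (a ^ k)" for k :: nat
  proof (induction k)
    case 0
    have "R M #>\<^bsub>Q\<^esub> 1 = R M" by (auto simp: r_coset_def Q_def)
    then show ?case by (simp add: FactGroup_def)
  next
    case (Suc k)
    have "C [^]\<^bsub>Q Mod R M\<^esub> Suc k = (R M #>\<^bsub>Q\<^esub> (a ^ k)) <#>\<^bsub>Q\<^esub> (R M #>\<^bsub>Q\<^esub> a)"
      using Suc C by (simp add: FactGroup_def nat_pow_def)
    also have "\<dots> = R M #>\<^bsub>Q\<^esub> (a ^ k \<otimes>\<^bsub>Q\<^esub> a)" by (rule normal.rcos_sum[OF norm powQ aQ])
    finally show ?case by (simp add: Q_def mult.commute)
  qed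
  then have "C [^]\<^bsub>Q Mod R M\<^esub> p = R M #>\<^bsub>field_units K\<^esub> (a ^ p)" by (simp add: Q_def)
  also have "\<dots> = R M #>\<^bsub>field_units K\<^esub> 1"
    using ap r_coset_eq_iff[OF R_subgroup subsetD[OF R_subset ap], of 1] by simp
  also have "\<dots> = R M" by (auto simp: r_coset_field_units)
  finally show "C [^]\<^bsub>H_mod_S l p 1\<^esub> p = \<one>\<^bsub>H_mod_S l p 1\<^esub>"
    unfolding eq by (simp add: FactGroup_def)
qed

lemma dim_H_mod_S_iff: "dim_mod p (H_mod_S l p 1) = half l - 1 \<longleftrightarrow> W 1 = V0"
proof -
  have "card (kappa ` W 1) = p ^ dim_mod p (H_mod_S l p 1)"
    unfolding card_H_mod_S[symmetric] by (rule card_eq_power_dim_mod[OF H_mod_S_props(1,2) prime_p H_mod_S_props(3)])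
  then have "dim_mod p (H_mod_S l p 1) = n - 1 \<longleftrightarrow> card (kappa ` W 1) = p ^ (n - 1)"
    using p_pos by (simp add: power_inject_exp)
  then show ?thesis using kappa_W_card_iff by (simp add: n_def)
qed

end


section \<open>Artin symbols and the fields\<close>

context cyclo
begin

lemma prime_idealD:
  assumes P: "P \<in> primes_of K"
  shows prime_ideal_subset: "P \<subseteq> A" and prime_ideal_one: "1 \<notin> P" and prime_ideal_0: "0 \<in> P"
    and prime_ideal_add: "\<And>x y. x \<in> P \<Longrightarrow> y \<in> P \<Longrightarrow> x + y \<in> P"
    and prime_ideal_mult: "\<And>x y. x \<in> P \<Longrightarrow> y \<in> A \<Longrightarrow> x * y \<in> P"
    and prime_ideal_prime: "\<And>x y. x \<in> A \<Longrightarrow> y \<in> A \<Longrightarrow> x * y \<in> P \<Longrightarrow> x \<in> P \<or> y \<in> P"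
proof -
  interpret P: primeideal P "int_ring K" using P by (simp add: primes_of_def)
  show "P \<subseteq> A" using P.a_subset unfolding carrier_int_ring .
  show "1 \<notin> P" using P.I_notcarr P.one_imp_carrier by auto
  show "0 \<in> P" using additive_subgroup.zero_closed[OF P.additive_subgroup_axioms] by simp
  show "x + y \<in> P" if "x \<in> P" "y \<in> P" for x y
    using additive_subgroup.a_closed[OF P.additive_subgroup_axioms that] by simp
  show "x * y \<in> P" if "x \<in> P" "y \<in> A" for x y
    using P.I_r_closed[of x y] that unfolding carrier_int_ring by simp
  show "x \<in> P \<or> y \<in> P" if "x \<in> A" "y \<in> A" "x * y \<in> P" for x y
    using P.I_prime[of x y] that unfolding carrier_int_ring by simp
qed

lemma fractional_ideals_pow_subset:
  assumes P: "P \<in> primes_of K"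
  shows "P [^]\<^bsub>fractional_ideals K\<^esub> k \<subseteq> A" "P [^]\<^bsub>fractional_ideals K\<^esub> Suc k \<subseteq> P"
proof -
  have A: "P [^]\<^bsub>fractional_ideals K\<^esub> k \<subseteq> A" for k :: nat
  proof (induction k)
    case 0
    show ?case by (simp add: fractional_ideals_def A_def)
  next
    case (Suc k)
    have "x \<in> A" if "x \<in> ideal_prod CC (P [^]\<^bsub>fractional_ideals K\<^esub> k) P" for x
      using that by induction (use Suc prime_ideal_subset[OF P] in \<open>auto simp: A_mult A_add\<close>)
    then show ?case by (auto simp: fractional_ideals_def)
  qed
  show "P [^]\<^bsub>fractional_ideals K\<^esub> k \<subseteq> A" by (rule A)
  have "x \<in> P" if "x \<in> ideal_prod CC (P [^]\<^bsub>fractional_ideals K\<^esub> k) P" for x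
    using that
  proof induction
    case (prod i j)
    then show ?case using prime_ideal_mult[OF P, of j i] A[of k] by (auto simp: mult.commute)
  qed (simp add: prime_ideal_add[OF P])
  then show "P [^]\<^bsub>fractional_ideals K\<^esub> Suc k \<subseteq> P" by (auto simp: fractional_ideals_def)
qed

text \<open>Exponent 0 is attained because b/d is a unit at P. For a positive exponent, every
  element of the localised power is u/v with u in P and v outside P; equating this with b/d gives b
  v in P, against primality.\<close>

lemma ideal_order_principal_unit:
  assumes P: "P \<in> primes_of K" and b: "b \<in> A" "b \<notin> P" and d: "d \<in> A" "d \<notin> P" and \<omega>: "\<omega> = b / d"
  shows "ideal_order K P (principal_ideal K \<omega>) = 0"
  unfolding ideal_order_def
proof (rule Greatest_equality)
  show "principal_ideal K \<omega> \<subseteq> ideal_prod CC (P [^]\<^bsub>fractional_ideals K\<^esub> (0::int)) (localisation K P)"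
  proof
    fix x assume "x \<in> principal_ideal K \<omega>"
    then obtain a where a: "a \<in> A" "x = \<omega> * a" unfolding principal_ideal_def carrier_int_ring by blast
    have "x = (b * a) / d" using a by (simp add: \<omega>)
    then have "x \<in> localisation K P"
      unfolding localisation_def carrier_int_ring using a b d A_mult[OF b(1) a(1)] by blast
    moreover have "1 \<in> P [^]\<^bsub>fractional_ideals K\<^esub> (0::int)"
      by (simp add: fractional_ideals_def int_pow_def2)
    ultimately have "1 \<otimes>\<^bsub>CC\<^esub> x \<in> ideal_prod CC (P [^]\<^bsub>fractional_ideals K\<^esub> (0::int)) (localisation K P)"
      by (intro ideal_prod.prod)
    then show "x \<in> ideal_prod CC (P [^]\<^bsub>fractional_ideals K\<^esub> (0::int)) (localisation K P)" by simp
  qed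
next
  fix e :: int
  assume sub: "principal_ideal K \<omega> \<subseteq> ideal_prod CC (P [^]\<^bsub>fractional_ideals K\<^esub> e) (localisation K P)"
  show "e \<le> 0"
  proof (rule ccontr)
    assume "\<not> e \<le> 0"
    then obtain k where e: "e = int (Suc k)" by (metis not_le zero_less_imp_eq_int gr0_implies_Suc)
    have Pe: "P [^]\<^bsub>fractional_ideals K\<^esub> e \<subseteq> P"
      unfolding e int_pow_int by (rule fractional_ideals_pow_subset(2)[OF P])
    have "\<exists>u v. x = u / v \<and> u \<in> P \<and> v \<in> A \<and> v \<notin> P"
      if "x \<in> ideal_prod CC (P [^]\<^bsub>fractional_ideals K\<^esub> e) (localisation K P)" for x
      using that
    proof induction
      case (prod i j)
      then obtain s v where sv: "j = s / v" "s \<in> A" "v \<in> A" "v \<notin> P"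
        unfolding localisation_def carrier_int_ring by blast
      have "i * s \<in> P" using prod Pe sv prime_ideal_mult[OF P] by blast
      then show ?case using sv by (intro exI[of _ "i * s"] exI[of _ v]) simp
    next
      case (sum x y)
      then obtain u v u' v' where uv: "x = u / v" "u \<in> P" "v \<in> A" "v \<notin> P"
          "y = u' / v'" "u' \<in> P" "v' \<in> A" "v' \<notin> P" by blast
      have nz: "v \<noteq> 0" "v' \<noteq> 0" using uv prime_ideal_0[OF P] by auto
      have "u * v' + u' * v \<in> P" using uv prime_ideal_mult[OF P] prime_ideal_add[OF P] by blast
      moreover have "v * v' \<notin> P" using uv prime_ideal_prime[OF P] by blast
      moreover have "x + y = (u * v' + u' * v) / (v * v')" using uv nz by (simp add: field_simps)
      ultimately show ?case using uv A_mult by (intro exI[of _ "u * v' + u' * v"] exI[of _ "v * v'"]) auto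
    qed
    moreover have "\<omega> \<in> principal_ideal K \<omega>"
      unfolding principal_ideal_def carrier_int_ring by (intro image_eqI[of _ _ 1]) auto
    ultimately obtain u v where uv: "\<omega> = u / v" "u \<in> P" "v \<in> A" "v \<notin> P" using sub by blast
    have "v \<noteq> 0" "d \<noteq> 0" using uv d prime_ideal_0[OF P] by auto
    then have "b * v = u * d" using uv(1) \<omega> by (simp add: field_simps)
    then have "b * v \<in> P" using prime_ideal_mult[OF P uv(2) d(1)] by simp
    then show False using prime_ideal_prime[OF P b(1) uv(3)] b uv by blast
  qed
qed

lemma principal_ideal_fractional:
  assumes b: "b \<in> A" and d: "d \<in> A" "d \<noteq> 0" and \<omega>: "\<omega> = b / d" "\<omega> \<noteq> 0"
  shows "principal_ideal K \<omega> \<in> carrier (fractional_ideals K)"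
proof -
  interpret int: cring "int_ring K" by (rule cring_int_ring)
  have eq: "(*) d ` principal_ideal K \<omega> = PIdl\<^bsub>int_ring K\<^esub> b"
    unfolding principal_ideal_def cgenideal_def carrier_int_ring using d by (auto simp: \<omega>(1) image_iff mult.commute)
  have "ideal ((*) d ` principal_ideal K \<omega>) (int_ring K)"
    unfolding eq using b by (intro int.cgenideal_ideal) (unfold carrier_int_ring)
  moreover have "principal_ideal K \<omega> \<noteq> {0}"
  proof -
    have "\<omega> \<in> principal_ideal K \<omega>"
      unfolding principal_ideal_def carrier_int_ring by (intro image_eqI[of _ _ 1]) auto
    then show ?thesis using \<omega>(2) by auto
  qed
  moreover have "d \<in> carrier (int_ring K) - {0}" using d carrier_int_ring by blast
  ultimately show ?thesis
    unfolding fractional_ideals_def partial_object.select_convs by blast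
qed

lemma principal_ideal_eq_iff:
  assumes a: "a \<noteq> 0" and \<omega>: "\<omega> \<noteq> 0"
  shows "principal_ideal K \<omega> = principal_ideal K a \<longleftrightarrow> (\<exists>u\<in>A. inverse u \<in> A \<and> u \<noteq> 0 \<and> \<omega> = a * u)"
  unfolding principal_ideal_def carrier_int_ring
proof
  assume eq: "(*) \<omega> ` A = (*) a ` A"
  have "\<omega> * 1 \<in> (*) a ` A" unfolding eq[symmetric] by (intro imageI) simp
  then obtain u where u: "u \<in> A" "\<omega> = a * u" by auto
  have "a * 1 \<in> (*) \<omega> ` A" unfolding eq by (intro imageI) simp
  then obtain v where v: "v \<in> A" "a = \<omega> * v" by auto
  have "a * (u * v) = a * 1" using u(2) v(2) by (simp add: mult.assoc[symmetric])
  then have uv: "u * v = 1" using a by (metis mult_left_cancel)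
  then have "inverse u = v" "u \<noteq> 0" by (auto intro: inverse_unique)
  then show "\<exists>u\<in>A. inverse u \<in> A \<and> u \<noteq> 0 \<and> \<omega> = a * u" using u v by blast
next
  assume "\<exists>u\<in>A. inverse u \<in> A \<and> u \<noteq> 0 \<and> \<omega> = a * u"
  then obtain u where u: "u \<in> A" "inverse u \<in> A" "u \<noteq> 0" "\<omega> = a * u" by blast
  show "(*) \<omega> ` A = (*) a ` A"
  proof (intro equalityI image_subsetI)
    fix x assume x: "x \<in> A"
    show "\<omega> * x \<in> (*) a ` A"
      using A_mult[OF u(1) x] by (intro image_eqI[of _ _ "u * x"]) (simp_all add: u(4) mult.assoc)
    show "a * x \<in> (*) \<omega> ` A"
      using A_mult[OF u(2) x] u(3) by (intro image_eqI[of _ _ "inverse u * x"]) (simp_all add: u(4))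
  qed
qed

end

context cyclo_p
begin

context
  fixes \<mu> m M :: nat
  assumes \<mu>: "\<mu> \<ge> 1" and m_def: "m = 2 * p ^ \<mu>" and M_def: "M = 2 * p ^ (\<mu> + 1)"
begin

private lemmas ctx = \<mu> m_def M_def

text \<open>The prime contains M while c is only known to be 1 modulo m. Passing to c^p, which is 1
  modulo M, puts 1 into P if c lies in P.\<close>

lemma not_in_prime_of_cong_1:
  assumes P: "P \<in> primes_of K" "of_nat M \<in> P" and c: "c \<in> A" "divA m (c - 1)"
  shows "c \<notin> P"
proof
  assume "c \<in> P"
  then have "c * c ^ (p - 1) \<in> P" using prime_ideal_mult[OF P(1)] c(1) by blast
  then have cp: "c ^ p \<in> P" using p_pos by (metis power_minus_mult mult.commute)
  obtain t where t: "t \<in> A" "c ^ p - 1 = of_nat M * t"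
    using power_p_cong[OF ctx c] by (auto simp: divA_def)
  have "of_nat M * (- t) \<in> P" using prime_ideal_mult[OF P A_minus[OF t(1)]] .
  then have "c ^ p + of_nat M * (- t) \<in> P" using prime_ideal_add[OF P(1) cp] by blast
  moreover have "c ^ p + of_nat M * (- t) = 1" using t(2) by (simp add: algebra_simps)
  ultimately show False using prime_ideal_one[OF P(1)] by simp
qed

text \<open>Numerator and denominator of \<omega> can both be taken congruent to 1 modulo m, so
  neither lies in a prime containing M. This brings the ideal into the domain where the ray class
  field controls its Artin symbol.\<close>

lemma principal_ideal_prime_to:
  assumes \<omega>: "\<omega> \<in> R m"
  shows "principal_ideal K \<omega> \<in> ideals_prime_to K M"
proof -
  obtain d where d: "d \<in> A" "divA m (d - 1)" "divA m (d * (\<omega> - 1))" using \<omega> by (rule R_E)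
  define b where "b = d + d * (\<omega> - 1)"
  have b: "b \<in> A" unfolding b_def by (rule A_add[OF d(1) divA_A[OF d(3)]])
  have "divA m ((d - 1) + d * (\<omega> - 1))" by (rule divA_add[OF d(2,3)])
  then have b1: "divA m (b - 1)" by (simp add: b_def algebra_simps)
  have d0: "d \<noteq> 0"
  proof
    assume "d = 0"
    then have "divA m (of_int (-1))" using d(2) by simp
    then show False using m_gt_1[OF ctx] by (subst (asm) divA_Ints) auto
  qed
  have q: "\<omega> = b / d" using d0 by (simp add: b_def field_simps)
  show ?thesis
    unfolding ideals_prime_to_def
    using principal_ideal_fractional[OF b d(1) d0 q R_nz[OF \<omega>]]
      ideal_order_principal_unit[OF _ b _ d(1) _ q] not_in_prime_of_cong_1 b b1 d by blast
qed

text \<open>The kernel of the Artin map consists of the ideals generated by elements of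
  \<open>R M\<close>. If \<omega> generates such an ideal, then \<omega> = a u with a in
  \<open>R M\<close> and u a unit, and u = \<omega>/a lies in \<open>R m\<close>; that is membership
  in \<open>H m M\<close>.\<close>

lemma artin_trivial_iff:
  assumes L: "ray_class_field K M L" and \<omega>: "\<omega> \<in> R m"
  shows "(\<forall>x\<in>L. artin K L (principal_ideal K \<omega>) x = x) \<longleftrightarrow> \<omega> \<in> H m M"
proof -
  define I where "I = principal_ideal K \<omega>"
  have I: "I \<in> ideals_prime_to K M" unfolding I_def by (rule principal_ideal_prime_to[OF \<omega>])
  then have "artin K L I \<in> carrier (gal K L)" using L unfolding ray_class_field_def by blast
  then have ext: "artin K L I \<in> extensional L" by (simp add: gal_def Bij_def)
  have "(\<forall>x\<in>L. artin K L I x = x) \<longleftrightarrow> artin K L I = \<one>\<^bsub>gal K L\<^esub>"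
    unfolding gal_one using ext by (auto intro!: extensionalityI[of _ L])
  also have "\<dots> \<longleftrightarrow> I \<in> {I \<in> ideals_prime_to K M. artin K L I = \<one>\<^bsub>gal K L\<^esub>}" using I by simp
  also have "{I \<in> ideals_prime_to K M. artin K L I = \<one>\<^bsub>gal K L\<^esub>}
      = principal_ideal K ` {a \<in> carrier (field_units K). ray_cong K M a}"
    using L unfolding ray_class_field_def by blast
  also have "{a \<in> carrier (field_units K). ray_cong K M a} = R M"
    using ray_cong_iff[of M] m_gt_1[OF ctx] R_subset by auto
  also have "I \<in> principal_ideal K ` R M \<longleftrightarrow> (\<exists>a\<in>R M. \<exists>u\<in>A. inverse u \<in> A \<and> u \<noteq> 0 \<and> \<omega> = a * u)"
    unfolding I_def using principal_ideal_eq_iff[OF R_nz R_nz[OF \<omega>]] by (auto simp: image_iff)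
  also have "\<dots> \<longleftrightarrow> \<omega> \<in> H m M"
  proof
    assume "\<exists>a\<in>R M. \<exists>u\<in>A. inverse u \<in> A \<and> u \<noteq> 0 \<and> \<omega> = a * u"
    then obtain a u where au: "a \<in> R M" "u \<in> A" "inverse u \<in> A" "u \<noteq> 0" "\<omega> = a * u" by blast
    have "u = \<omega> / a" using au R_nz[OF au(1)] by simp
    then have "u \<in> R m" using R_divide[OF \<omega> R_dvd[OF m_dvd_M[OF ctx] au(1)]] by simp
    then show "\<omega> \<in> H m M" using H_I[OF ctx] au by simp
  next
    assume "\<omega> \<in> H m M"
    then show "\<exists>a\<in>R M. \<exists>u\<in>A. inverse u \<in> A \<and> u \<noteq> 0 \<and> \<omega> = a * u"
      using R_nz by (elim H_E[OF ctx]) blast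
  qed
  finally show ?thesis unfolding I_def .
qed

text \<open>\<open>phi_tilde\<close> extracts the only element of a set of cosets. This set is a
  singleton because \<open>star\<close> is multiplicative and maps \<open>H m M\<close> into
  itself.\<close>

lemma kernel_phi_tilde_iff:
  assumes \<omega>: "\<omega> \<in> R m"
  shows "H_ray l p \<mu> #>\<^bsub>field_units (cyclotomic l)\<^esub> \<omega>
      \<in> kernel (S_mod_H l p \<mu>) (S_mod_H l p \<mu>) (phi_tilde l p \<mu>) \<longleftrightarrow> star \<omega> \<in> H m M"
proof -
  have Heq: "H_ray l p \<mu> = H m M" by (simp only: H_ray_eq m_def M_def)
  have Seq: "S_ray l p \<mu> = R m" by (simp only: S_ray_eq m_def)
  have sub: "subgroup (H m M) (field_units K)" by (rule H_subgroup[OF ctx])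
  let ?C = "\<lambda>a. H m M #>\<^bsub>field_units K\<^esub> a"
  have KK: "star a \<in> K - {0}" if "a \<in> R m" for a using star_R[OF that] R_subset by blast
  have "?C (phi_star l a) = ?C (star \<omega>)" if aC: "a \<in> ?C \<omega>" for a
  proof -
    obtain h where h: "h \<in> H m M" "a = h * \<omega>" using aC by (auto simp: r_coset_field_units)
    have hR: "h \<in> R m" by (rule H_R[OF ctx h(1)])
    have aR: "a \<in> R m" unfolding h(2) by (rule R_mult[OF hR \<omega>])
    have "star a / star \<omega> = star h"
      using star_mult[OF R_K[OF hR] R_K[OF \<omega>]] KK[OF \<omega>] by (simp add: h(2))
    then show ?thesis
      using r_coset_eq_iff[OF sub KK[OF aR] KK[OF \<omega>]] star_H[OF ctx h(1)] phi_star_eq[OF R_K[OF aR]] by simp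
  qed
  moreover have "1 * \<omega> \<in> ?C \<omega>" using R_M_H[OF ctx R_1] by (auto simp: r_coset_field_units)
  ultimately have "(\<lambda>a. ?C (phi_star l a)) ` ?C \<omega> = {?C (star \<omega>)}" by blast
  then have pt: "phi_tilde l p \<mu> (?C \<omega>) = ?C (star \<omega>)"
    unfolding phi_tilde_def Heq cyclotomic_eq_K by simp
  have one: "?C 1 = H m M" by (auto simp: r_coset_field_units)
  have "?C \<omega> \<in> carrier ((field_units K)\<lparr>carrier := R m\<rparr> Mod H m M)"
    using \<omega> by (auto simp: FactGroup_def RCOSETS_def)
  then have "?C \<omega> \<in> kernel (S_mod_H l p \<mu>) (S_mod_H l p \<mu>) (phi_tilde l p \<mu>) \<longleftrightarrow> ?C (star \<omega>) = H m M"
    unfolding kernel_def Heq Seq cyclotomic_eq_K by (simp add: pt FactGroup_def)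
  also have "\<dots> \<longleftrightarrow> star \<omega> \<in> H m M"
    using r_coset_eq_iff[OF sub KK[OF \<omega>], of 1] by (simp add: one)
  finally show ?thesis unfolding Heq cyclotomic_eq_K .
qed

lemma K_field_eq_iff:
  assumes L: "ray_class_field K M L"
  shows "K_field l p \<mu> L = L \<longleftrightarrow> (\<forall>a\<in>R m. star a \<in> H m M \<longrightarrow> a \<in> H m M)"
proof -
  have "K_field l p \<mu> L = L \<longleftrightarrow>
      (\<forall>\<omega>\<in>R m. star \<omega> \<in> H m M \<longrightarrow> (\<forall>x\<in>L. artin K L (principal_ideal K \<omega>) x = x))"
    unfolding K_field_def using kernel_phi_tilde_iff
    unfolding cyclotomic_eq_K S_ray_eq m_def[symmetric] by blast
  then show ?thesis using artin_trivial_iff[OF L] by blast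
qed

end

end

theorem corollary4p6:
  fixes l p :: nat and k :: "nat \<Rightarrow> complex set"
  assumes "Factorial_Ring.prime l" and "odd l" and "Factorial_Ring.prime p" and "odd p"
    and "\<And>\<mu>. \<mu> \<ge> 1 \<Longrightarrow> ray_class_field (cyclotomic l) (2 * p ^ \<mu>) (k \<mu>)"
    and "\<not> p dvd l * h_plus l * half l"
  shows "(\<forall>\<mu>\<ge>1. K_field l p \<mu> (k (\<mu> + 1)) = k (\<mu> + 1)) \<longleftrightarrow>
    dim_mod p (H_mod_S l p 1) = half l - 1 \<and> \<not> int p dvd Determinant.det (N_mat l)"
proof -
  interpret cyclo_p l p
    using assms(1-4,6) by unfold_locales auto
  have "K_field l p \<mu> (k (\<mu> + 1)) = k (\<mu> + 1) \<longleftrightarrow> (\<forall>x\<in>A. T x \<in> W \<mu> \<longrightarrow> x \<in> W \<mu>)"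
    if "\<mu> \<ge> 1" for \<mu>
    using K_field_eq_iff[OF that refl refl] star_injective_iff[OF that refl refl]
      assms(5)[of "\<mu> + 1"] by (simp add: cyclotomic_eq_K)
  then show ?thesis
    unfolding dim_H_mod_S_iff T_injective_iff[symmetric] by blast
qed

end
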